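(* Let $p$ be a prime, $c>1$ a constant, $\alpha_n=\frac{c\log n}{n}$, and for each $n$ with $\alpha_n\le1/2$ let $\beta_n\in[\alpha_n,1-\alpha_n]$ and let $\Gamma(n)\in G(n,\beta_n)$ be an Erdős–Rényi random graph. Then for every finite abelian $p$-group $G$, $\lim_{n\to\infty}\mathbb{E}(\#\mathrm{Sur}(S_{\Gamma(n),p},G))=|\wedge^2 G|$.
   Context: $G(n,q)$ is the Erdős–Rényi random graph on $n$ vertices with independent edge probability $q$. $S_\Gamma$ is the sandpile group of $\Gamma$ (cokernel of the reduced Laplacian) and $S_{\Gamma,p}$ its Sylow $p$-subgroup (subgroup of elements of $p$-power order). $\mathrm{Sur}(A,B)$ is the set of surjective homomorphisms $A\to B$, and $\wedge^2G$ is the quotient of $G\otimes G$ by the subgroup generated by elements $g\otimes g$. *)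

theory Defs
  imports
    "HOL-Probability.Probability"
    "HOL-Algebra.Free_Abelian_Groups"
    "HOL-Algebra.Multiplicative_Group"
    "Jordan_Normal_Form.Determinant"
begin

text \<open>A simple graph with vertex set \<open>{..<n}\<close> is given by its set of edges, each edge being a
  two-element subset of \<open>{..<n}\<close>.\<close>

definition possible_edges :: "nat \<Rightarrow> nat set set" where
  "possible_edges n = {e. e \<subseteq> {..<n} \<and> card e = 2}"

definition erdos_renyi :: "nat \<Rightarrow> real \<Rightarrow> nat set set pmf" where
  "erdos_renyi n q =
     map_pmf (\<lambda>b. {e \<in> possible_edges n. b e})
       (Pi_pmf (possible_edges n) False (\<lambda>_. bernoulli_pmf q))"

definition laplacian :: "nat \<Rightarrow> nat set set \<Rightarrow> int mat" where
  "laplacian n E = mat n n (\<lambda>(i, j).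
     if i = j then int (card {e \<in> E. i \<in> e}) else if {i, j} \<in> E then - 1 else 0)"

text \<open>The deleted vertex is the last one; up to isomorphism the cokernel does not depend on
  this choice.\<close>

definition reduced_laplacian :: "nat \<Rightarrow> nat set set \<Rightarrow> int mat" where
  "reduced_laplacian n E = mat_delete (laplacian n E) (n - 1) (n - 1)"

definition cokernel :: "int mat \<Rightarrow> int vec set monoid" where
  "cokernel A =
     monoid_vec TYPE(int) (dim_row A) Mod ((\<lambda>v. A *\<^sub>v v) ` carrier_vec (dim_col A))"

definition sandpile_group :: "nat \<Rightarrow> nat set set \<Rightarrow> int vec set monoid" where
  "sandpile_group n E = cokernel (reduced_laplacian n E)"

text \<open>The sandpile group of a disconnected graph is infinite. Elements of infinite order have
  \<open>ord\<close> equal to \<open>0\<close>, which is not a power of a prime, so they are excluded here.\<close>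

definition sylow_part :: "nat \<Rightarrow> ('a, 'b) monoid_scheme \<Rightarrow> ('a, 'b) monoid_scheme" where
  "sylow_part p S = S\<lparr>carrier := {x \<in> carrier S. \<exists>k. group.ord S x = p ^ k}\<rparr>"

text \<open>Extensionality gives one function per homomorphism, so that the cardinality is the right one.\<close>

definition Sur :: "('a, 'c) monoid_scheme \<Rightarrow> ('b, 'd) monoid_scheme \<Rightarrow> ('a \<Rightarrow> 'b) set" where
  "Sur A B = epi A B \<inter> extensional (carrier A)"

definition tensor_relations ::
    "('a, 'c) monoid_scheme \<Rightarrow> ('b, 'd) monoid_scheme \<Rightarrow> ('a \<times> 'b \<Rightarrow>\<^sub>0 int) set" where
  "tensor_relations A B = generate (free_Abelian_group (carrier A \<times> carrier B))
     ({frag_of (x \<otimes>\<^bsub>A\<^esub> x', y) - frag_of (x, y) - frag_of (x', y) | x x' y.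
         x \<in> carrier A \<and> x' \<in> carrier A \<and> y \<in> carrier B} \<union>
      {frag_of (x, y \<otimes>\<^bsub>B\<^esub> y') - frag_of (x, y) - frag_of (x, y') | x y y'.
         x \<in> carrier A \<and> y \<in> carrier B \<and> y' \<in> carrier B})"

definition tensor_group ::
    "('a, 'c) monoid_scheme \<Rightarrow> ('b, 'd) monoid_scheme \<Rightarrow> ('a \<times> 'b \<Rightarrow>\<^sub>0 int) set monoid" where
  "tensor_group A B = free_Abelian_group (carrier A \<times> carrier B) Mod tensor_relations A B"

definition pure_tensor ::
    "('a, 'c) monoid_scheme \<Rightarrow> ('b, 'd) monoid_scheme \<Rightarrow> 'a \<Rightarrow> 'b \<Rightarrow> ('a \<times> 'b \<Rightarrow>\<^sub>0 int) set" where
  "pure_tensor A B x y =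
     tensor_relations A B #>\<^bsub>free_Abelian_group (carrier A \<times> carrier B)\<^esub> frag_of (x, y)"

definition exterior_square ::
    "('a, 'c) monoid_scheme \<Rightarrow> ('a \<times> 'a \<Rightarrow>\<^sub>0 int) set set monoid" where
  "exterior_square A = tensor_group A A Mod
     generate (tensor_group A A) {pure_tensor A A g g | g. g \<in> carrier A}"

end

theory Submission
  imports
    Defs
    "HOL-Real_Asymp.Real_Asymp"
    "HOL-Number_Theory.Cong"
    "HOL-Algebra.SimpleGroups"
begin

text \<open>A homomorphism from the cokernel of the reduced Laplacian to \<open>G\<close> is a labelling of the vertices by
  \<open>G\<close>, zero at the deleted vertex, that the Laplacian annihilates. Detecting this relation by characters
  and averaging over the independent edges turns the expected number of surjections into a sum, over
  all labellings of the vertices by pairs \<open>(f, C)\<close> of an element and a character of \<open>G\<close>, of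
  \<open>\<Prod>e. 1 - q + q * K e\<close>, where \<open>K e\<close> is a root of unity that depends only on the labels of the two ends
  of \<open>e\<close>. Labellings into a set on which \<open>K\<close> is constantly \<open>1\<close> have weight \<open>1\<close>; the maximal such sets
  that matter for surjections are the graphs of the alternating bicharacters of \<open>G\<close>, which are the
  characters of the exterior square. Every other labelling leaves its best such set at some vertices,
  and \<open>q (1 - q) \<ge> c ln n / n\<close> with \<open>c > 1\<close> makes the total weight of all of them negligible: the vertices
  left out cost a factor \<open>n\<close> each for their choice but gain a factor \<open>n powr - c\<close>.

  The Sylow part has the same surjections onto a \<open>p\<close>-group as the cokernel unless the reduced Laplacian is
  singular. A singular one has at least \<open>l - 1\<close> surjections onto a group of prime order \<open>l\<close>, whose
  expected number tends to \<open>1\<close>, so singularity has vanishing probability. Characters of the Sylow part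
  extend to the cokernel because it is a pure subgroup, so that the contribution of the singular Laplacians
  is bounded by moments of numbers of homomorphisms, which are bounded uniformly in \<open>n\<close>.\<close>

section \<open>Homomorphisms of groups\<close>

definition Hom :: "('a, 'c) monoid_scheme \<Rightarrow> ('b, 'd) monoid_scheme \<Rightarrow> ('a \<Rightarrow> 'b) set" where
  "Hom A B = hom A B \<inter> extensional (carrier A)"

lemma Hom_eqI:
  assumes "f \<in> Hom A B" "g \<in> Hom A B" "\<And>x. x \<in> carrier A \<Longrightarrow> f x = g x"
  shows "f = g"
  using assms by (auto simp: Hom_def intro: extensionalityI)

lemma (in group) restrict_subgroup_in_Hom:
  assumes "subgroup P G" "f \<in> hom G B"
  shows "restrict f P \<in> Hom (G\<lparr>carrier := P\<rparr>) B"
proof -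
  interpret P: subgroup P G by fact
  show ?thesis using assms(2) P.mem_carrier by (simp add: Hom_def hom_def Pi_iff)
qed

lemma restrict_in_Hom:
  assumes "group A" "f \<in> hom A B"
  shows "restrict f (carrier A) \<in> Hom A B"
  using group.restrict_subgroup_in_Hom[OF assms(1) group.subgroup_self[OF assms(1)] assms(2)] by simp

lemma Sur_eq: "Sur A B = {f \<in> Hom A B. f ` carrier A = carrier B}"
  by (auto simp: Sur_def Hom_def epi_def)

lemma group_homI: "group G \<Longrightarrow> group H \<Longrightarrow> h \<in> hom G H \<Longrightarrow> group_hom G H h"
  by (simp add: group_hom_def group_hom_axioms_def)

lemma (in group_hom) factor_through_image:
  assumes k: "group_hom G K k" and kernels: "kernel G H h \<subseteq> kernel G K k"
  obtains g where "g \<in> hom (H\<lparr>carrier := h ` carrier G\<rparr>) K" "\<And>x. x \<in> carrier G \<Longrightarrow> g (h x) = k x"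
proof -
  interpret k: group_hom G K k by (rule k)
  have "k x = k y" if xy: "x \<in> carrier G" "y \<in> carrier G" "h x = h y" for x y
  proof -
    have "x \<otimes> inv y \<in> kernel G H h" using xy by (simp add: kernel_def)
    then have "x \<otimes> inv y \<in> kernel G K k" using kernels by blast
    then have "k x \<otimes>\<^bsub>K\<^esub> inv\<^bsub>K\<^esub> k y = \<one>\<^bsub>K\<^esub>" using xy by (simp add: kernel_def)
    then show ?thesis using xy k.H.inv_equality by fastforce
  qed
  then obtain g where g: "\<And>x. x \<in> carrier G \<Longrightarrow> k x = g (h x)"
    using function_factors_left_gen[of "\<lambda>x. x \<in> carrier G" h k] by blast
  show ?thesis
  proof
    show "g \<in> hom (H\<lparr>carrier := h ` carrier G\<rparr>) K"
      by (rule homI) (auto simp: g[symmetric] simp flip: hom_mult)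
  qed (simp add: g)
qed

lemma (in group_hom) hom_eq_one_on_generate:
  assumes "S \<subseteq> carrier G" "\<And>s. s \<in> S \<Longrightarrow> h s = \<one>\<^bsub>H\<^esub>" "x \<in> generate G S"
  shows "h x = \<one>\<^bsub>H\<^esub>"
proof -
  have "generate G S \<subseteq> kernel G H h"
    by (rule G.generate_subgroup_incl[OF _ subgroup_kernel]) (use assms in \<open>auto simp: kernel_def\<close>)
  then show ?thesis using assms by (auto simp: kernel_def)
qed

lemma (in group_hom) hom_eq_on_generate:
  assumes k: "group_hom G H k" and S: "S \<subseteq> carrier G" "\<And>s. s \<in> S \<Longrightarrow> h s = k s"
    and x: "x \<in> generate G S"
  shows "h x = k x"
proof -
  interpret k: group_hom G H k by (rule k)
  from x show ?thesis
  proof (induction rule: generate.induct)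
    case (eng x y)
    then show ?case using G.generate_in_carrier[OF S(1)] by simp
  qed (use S in auto)
qed

lemma (in group) generate_subgroup: "subgroup H G \<Longrightarrow> generate G H = H"
  using generate_subgroup_incl[of H H] by (auto intro: generate.incl)

lemma (in comm_group) comm_group_subgroup:
  assumes "subgroup H G"
  shows "comm_group (G\<lparr>carrier := H\<rparr>)"
proof (rule group.group_comm_groupI)
  show "group (G\<lparr>carrier := H\<rparr>)" by (rule subgroup_imp_group[OF assms])
  show "x \<otimes>\<^bsub>G\<lparr>carrier := H\<rparr>\<^esub> y = y \<otimes>\<^bsub>G\<lparr>carrier := H\<rparr>\<^esub> x"
    if "x \<in> carrier (G\<lparr>carrier := H\<rparr>)" "y \<in> carrier (G\<lparr>carrier := H\<rparr>)" for x y
    using that subgroup.mem_carrier[OF assms] by (simp add: m_comm)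
qed

lemma (in comm_group) group_hom_Mod:
  assumes "subgroup R G"
  shows "group_hom G (G Mod R) (\<lambda>x. R #> x)"
  using abelian_FactGroup[OF assms] normal.r_coset_hom_Mod[OF subgroup_imp_normal[OF assms]]
  by (simp add: group_homI is_group comm_group_def)

locale finite_comm_group = comm_group +
  assumes finite_carrier: "finite (carrier G)"
begin

lemma order_pos: "order G > 0"
  by (simp add: order_gt_0_iff_finite finite_carrier)

end

lemma finite_comm_groupI: "comm_group G \<Longrightarrow> finite (carrier G) \<Longrightarrow> finite_comm_group G"
  by (simp add: finite_comm_group_def finite_comm_group_axioms_def)

section \<open>Characters of abelian groups\<close>

definition circle_group :: "complex monoid" where
  "circle_group = \<lparr>carrier = {z. norm z = 1}, mult = (*), one = 1\<rparr>"

lemma carrier_circle_group [simp]: "carrier circle_group = {z. norm z = 1}"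
  and mult_circle_group [simp]: "x \<otimes>\<^bsub>circle_group\<^esub> y = x * y"
  and one_circle_group [simp]: "\<one>\<^bsub>circle_group\<^esub> = 1"
  by (simp_all add: circle_group_def)

lemma norm_1_mult_cnj: "norm z = 1 \<Longrightarrow> z * cnj z = 1" "norm z = 1 \<Longrightarrow> cnj z * z = 1"
  by (simp_all add: complex_norm_square [symmetric] mult.commute)

lemma comm_group_circle_group: "comm_group circle_group"
proof (rule comm_groupI)
  show "\<exists>y\<in>carrier circle_group. y \<otimes>\<^bsub>circle_group\<^esub> x = \<one>\<^bsub>circle_group\<^esub>"
    if "x \<in> carrier circle_group" for x
    using that by (intro bexI[of _ "cnj x"]) (auto simp: norm_1_mult_cnj)
qed (auto simp: norm_mult)

interpretation circle: comm_group circle_group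
  by (rule comm_group_circle_group)

lemma inv_circle_group [simp]: "norm z = 1 \<Longrightarrow> inv\<^bsub>circle_group\<^esub> z = cnj z"
  by (intro circle.inv_equality) (auto simp: norm_1_mult_cnj)

lemma pow_circle_group [simp]: "x [^]\<^bsub>circle_group\<^esub> (n::nat) = x ^ n"
  by (induction n) auto

lemma int_pow_circle_group [simp]:
  assumes "norm x = 1"
  shows "x [^]\<^bsub>circle_group\<^esub> (k::int) = x powi k"
proof (cases k rule: int_cases2)
  case (nonneg n)
  then show ?thesis by (simp add: int_pow_int)
next
  case (nonpos n)
  then show ?thesis using assms
    by (simp add: circle.int_pow_neg_int power_int_minus norm_power)
       (metis complex_cnj_power inverse_unique norm_1_mult_cnj(1) norm_power power_one)
qed

definition characters :: "('a, 'b) monoid_scheme \<Rightarrow> ('a \<Rightarrow> complex) set" where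
  "characters G = Hom G circle_group"

lemma charactersD:
  assumes "\<xi> \<in> characters G"
  shows "x \<in> carrier G \<Longrightarrow> norm (\<xi> x) = 1"
    and "x \<in> carrier G \<Longrightarrow> y \<in> carrier G \<Longrightarrow> \<xi> (x \<otimes>\<^bsub>G\<^esub> y) = \<xi> x * \<xi> y"
    and "x \<notin> carrier G \<Longrightarrow> \<xi> x = undefined"
  using assms by (auto simp: characters_def Hom_def hom_def extensional_def)

lemma charactersI:
  assumes "\<And>x. x \<in> carrier G \<Longrightarrow> norm (\<xi> x) = 1"
    and "\<And>x y. x \<in> carrier G \<Longrightarrow> y \<in> carrier G \<Longrightarrow> \<xi> (x \<otimes>\<^bsub>G\<^esub> y) = \<xi> x * \<xi> y"
    and "\<And>x. x \<notin> carrier G \<Longrightarrow> \<xi> x = undefined"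
  shows "\<xi> \<in> characters G"
  using assms by (auto simp: characters_def Hom_def hom_def extensional_def)

lemma characters_mult_cnj:
  assumes "\<xi> \<in> characters G" "x \<in> carrier G"
  shows "\<xi> x * cnj (\<xi> x) = 1" "cnj (\<xi> x) * \<xi> x = 1"
  using charactersD(1)[OF assms] norm_1_mult_cnj by auto

lemma characters_cnj_eq_inverse:
  assumes "\<xi> \<in> characters G" "x \<in> carrier G"
  shows "cnj (\<xi> x) = inverse (\<xi> x)"
  using characters_mult_cnj(1)[OF assms] by (metis inverse_unique)

lemma characters_eqI:
  assumes "\<xi> \<in> characters G" "\<psi> \<in> characters G" "\<And>x. x \<in> carrier G \<Longrightarrow> \<xi> x = \<psi> x"
  shows "\<xi> = \<psi>"
  using assms Hom_eqI unfolding characters_def by blast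

definition trivial_character :: "('a, 'b) monoid_scheme \<Rightarrow> 'a \<Rightarrow> complex" where
  "trivial_character G = (\<lambda>x\<in>carrier G. 1)"

context group
begin

lemma character_group_hom: "\<xi> \<in> characters G \<Longrightarrow> group_hom G circle_group \<xi>"
  by (auto simp: characters_def Hom_def group_homI is_group circle.is_group)

lemma character_one [simp]: "\<xi> \<in> characters G \<Longrightarrow> \<xi> \<one> = 1"
  using group_hom.hom_one[OF character_group_hom] by fastforce

lemma character_pow: "\<xi> \<in> characters G \<Longrightarrow> x \<in> carrier G \<Longrightarrow> \<xi> (x [^] (n::nat)) = \<xi> x ^ n"
  using group_hom.hom_nat_pow[OF character_group_hom] by fastforce

lemma character_int_pow: "\<xi> \<in> characters G \<Longrightarrow> x \<in> carrier G \<Longrightarrow> \<xi> (x [^] (k::int)) = \<xi> x powi k"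
  using group_hom.hom_int_pow[OF character_group_hom] by (simp add: charactersD)

lemma character_inv: "\<xi> \<in> characters G \<Longrightarrow> x \<in> carrier G \<Longrightarrow> \<xi> (inv x) = cnj (\<xi> x)"
  using group_hom.hom_inv[OF character_group_hom] by (simp add: charactersD)

lemma trivial_character [simp, intro]: "trivial_character G \<in> characters G"
  by (rule charactersI) (auto simp: trivial_character_def)

lemma characters_mult:
  assumes "\<xi> \<in> characters G" "\<psi> \<in> characters G"
  shows "(\<lambda>x\<in>carrier G. \<xi> x * \<psi> x) \<in> characters G"
  using assms by (intro charactersI) (auto simp: charactersD norm_mult)

lemma characters_cnj:
  assumes "\<xi> \<in> characters G"
  shows "(\<lambda>x\<in>carrier G. cnj (\<xi> x)) \<in> characters G"
  using assms by (intro charactersI) (auto simp: charactersD)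

end

lemma (in comm_group) character_finprod:
  assumes \<xi>: "\<xi> \<in> characters G" and "finite A" "g \<in> A \<rightarrow> carrier G"
  shows "\<xi> (finprod G g A) = (\<Prod>i\<in>A. \<xi> (g i))"
  using assms(2,3)
proof (induction A rule: finite_induct)
  case (insert a A)
  then show ?case using \<xi> by (simp add: charactersD Pi_iff)
qed (simp add: \<xi>)

lemma norm_one_root_exists:
  assumes "norm z = 1" "n > (0::nat)"
  obtains w :: complex where "w ^ n = z" "norm w = 1"
proof -
  obtain w where w: "z = w ^ n" using exists_complex_root assms(2) by blast
  then have "norm w ^ n = 1" using assms(1) by (simp add: norm_power)
  then have "norm w = 1" using power_eq_1_iff[of "norm w" n] assms(2) by simp
  then show ?thesis using that w by blast
qed

lemma nontrivial_root_of_unity_exists: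
  assumes "n \<noteq> (1::nat)"
  obtains z :: complex where "z ^ n = 1" "z \<noteq> 1" "norm z = 1"
proof (cases "n = 0")
  case True
  then show ?thesis using that[of "-1"] by simp
next
  case False
  have "{z::complex. z ^ n = 1} \<noteq> {1}"
    using card_roots_unity_eq[of n] assms False by force
  then obtain z :: complex where z: "z ^ n = 1" "z \<noteq> 1" by force
  then have "norm z ^ n = 1" by (metis norm_one norm_power)
  then have "norm z = 1" using power_eq_1_iff[of "norm z" n] False by simp
  then show ?thesis using that z by blast
qed

subsection \<open>Extension of characters\<close>

lemma (in group) character_on_image:
  assumes f: "group_hom A G f" and k: "group_hom A circle_group k"
    and kernels: "kernel A G f \<subseteq> kernel A circle_group k"
  obtains \<psi> where "\<psi> \<in> characters (G\<lparr>carrier := f ` carrier A\<rparr>)" "\<And>x. x \<in> carrier A \<Longrightarrow> \<psi> (f x) = k x"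
proof -
  obtain g where g: "g \<in> hom (G\<lparr>carrier := f ` carrier A\<rparr>) circle_group"
    "\<And>x. x \<in> carrier A \<Longrightarrow> g (f x) = k x"
    using group_hom.factor_through_image[OF f k kernels] by blast
  have "group (G\<lparr>carrier := f ` carrier A\<rparr>)"
    by (rule subgroup_imp_group[OF group_hom.img_is_subgroup[OF f]])
  from restrict_in_Hom[OF this g(1)]
  have "restrict g (f ` carrier A) \<in> characters (G\<lparr>carrier := f ` carrier A\<rparr>)"
    by (simp add: characters_def)
  then show ?thesis by (rule that) (simp add: g(2))
qed

context comm_group
begin

lemma group_hom_adjoin:
  assumes H: "subgroup H G" and a: "a \<in> carrier G"
  shows "group_hom (G\<lparr>carrier := H\<rparr> \<times>\<times> integer_group) G (\<lambda>(h, l). h \<otimes> a [^] (l::int))"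
proof (rule group_homI)
  interpret H: subgroup H G by (rule H)
  show "group (G\<lparr>carrier := H\<rparr> \<times>\<times> integer_group)"
    by (rule DirProd_group) (simp_all add: subgroup_imp_group[OF H])
  show "(\<lambda>(h, l). h \<otimes> a [^] l) \<in> hom (G\<lparr>carrier := H\<rparr> \<times>\<times> integer_group) G"
    using a by (auto simp: hom_def int_pow_mult m_ac)
qed (rule is_group)

lemma character_adjoin_group_hom:
  assumes \<xi>: "\<xi> \<in> characters G" and z: "norm z = 1"
  shows "group_hom (G \<times>\<times> integer_group) circle_group (\<lambda>(h, l). \<xi> h * z powi l)"
proof (rule group_homI)
  show "group (G \<times>\<times> integer_group)" by (rule DirProd_group) (simp_all add: is_group)
  have "z \<noteq> 0" using z by auto
  then show "(\<lambda>(h, l). \<xi> h * z powi l) \<in> hom (G \<times>\<times> integer_group) circle_group"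
    using \<xi> z by (auto simp: hom_def norm_mult norm_power_int power_int_add charactersD)
qed (rule circle.is_group)

lemma character_extend_adjoin:
  assumes H: "subgroup H G" and \<xi>: "\<xi> \<in> characters (G\<lparr>carrier := H\<rparr>)"
    and a: "a \<in> carrier G" and z: "norm z = 1"
    and compatible: "\<And>l::int. a [^] l \<in> H \<Longrightarrow> \<xi> (a [^] l) = z powi l"
  obtains K \<psi> where "subgroup K G" "H \<subseteq> K" "a \<in> K"
    "\<psi> \<in> characters (G\<lparr>carrier := K\<rparr>)" "\<And>h. h \<in> H \<Longrightarrow> \<psi> h = \<xi> h" "\<psi> a = z"
proof -
  interpret H: subgroup H G by (rule H)
  interpret GH: comm_group "G\<lparr>carrier := H\<rparr>" by (rule comm_group_subgroup[OF H])
  let ?A = "G\<lparr>carrier := H\<rparr> \<times>\<times> integer_group"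
  define f where "f = (\<lambda>(h, l::int). h \<otimes> a [^] l)"
  define k where "k = (\<lambda>(h, l::int). \<xi> h * z powi l)"
  have f: "group_hom ?A G f" unfolding f_def by (rule group_hom_adjoin[OF H a])
  have k: "group_hom ?A circle_group k" unfolding k_def by (rule GH.character_adjoin_group_hom[OF \<xi> z])
  have "kernel ?A G f \<subseteq> kernel ?A circle_group k"
  proof (rule subsetI, clarsimp simp: kernel_def f_def k_def)
    fix h and l :: int assume h: "h \<in> H" and "h \<otimes> a [^] l = \<one>"
    then have "h = a [^] (- l)"
      using a by (simp add: int_pow_neg) (metis H.mem_carrier int_pow_closed inv_equality)
    then have "\<xi> h = z powi (- l)" using compatible[of "- l"] h by simp
    moreover have "z \<noteq> 0" using z by auto
    ultimately show "\<xi> h * z powi l = 1" by (simp add: power_int_minus)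
  qed
  from character_on_image[OF f k this] obtain \<psi> where \<psi>: "\<psi> \<in> characters (G\<lparr>carrier := f ` carrier ?A\<rparr>)"
    "\<And>x. x \<in> carrier ?A \<Longrightarrow> \<psi> (f x) = k x" by metis
  have f_H: "h \<in> f ` carrier ?A" "\<psi> h = \<xi> h" if "h \<in> H" for h
    using imageI[of "(h, 0)" "carrier ?A" f] \<psi>(2)[of "(h, 0)"] that by (simp_all add: f_def k_def)
  have f_a: "a \<in> f ` carrier ?A" "\<psi> a = z"
    using imageI[of "(\<one>, 1)" "carrier ?A" f] \<psi>(2)[of "(\<one>, 1)"] GH.character_one[OF \<xi>] a
    by (simp_all add: f_def k_def)
  show ?thesis
    by (rule that[OF group_hom.img_is_subgroup[OF f] _ f_a(1) \<psi>(1) f_H(2) f_a(2)]) (use f_H(1) in blast)+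
qed

lemma int_pow_mem_subgroup_iff:
  assumes H: "subgroup H G" and a: "a \<in> carrier G"
  shows "a [^] (l::int) \<in> H \<longleftrightarrow> int (group.ord (G Mod H) (H #> a)) dvd l"
proof -
  interpret H: normal H G by (rule subgroup_imp_normal[OF H])
  interpret Q: group "G Mod H" by (rule H.factorgroup_is_group)
  have "a [^] l \<in> H \<longleftrightarrow> H #> (a [^] l) = H"
    using a coset_join1[OF _ _ H] coset_join2[OF _ H] by auto
  also have "\<dots> \<longleftrightarrow> (H #> a) [^]\<^bsub>G Mod H\<^esub> l = \<one>\<^bsub>G Mod H\<^esub>"
    using a by (simp add: H.FactGroup_int_pow)
  also have "\<dots> \<longleftrightarrow> int (Q.ord (H #> a)) dvd l"
    using a by (intro Q.int_pow_eq_id) (auto simp: carrier_FactGroup)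
  finally show ?thesis .
qed

lemma exists_compatible_value:
  assumes H: "subgroup H G" and \<xi>: "\<xi> \<in> characters (G\<lparr>carrier := H\<rparr>)" and a: "a \<in> carrier G"
  obtains z where "norm z = 1" "\<And>l::int. a [^] l \<in> H \<Longrightarrow> \<xi> (a [^] l) = z powi l"
proof -
  interpret GH: group "G\<lparr>carrier := H\<rparr>" by (rule subgroup_imp_group[OF H])
  define t where "t = group.ord (G Mod H) (H #> a)"
  have mem: "a [^] l \<in> H \<longleftrightarrow> int t dvd l" for l :: int
    unfolding t_def by (rule int_pow_mem_subgroup_iff[OF H a])
  have atH: "a [^] int t \<in> H" by (simp add: mem)
  then have "norm (\<xi> (a [^] int t)) = 1" using charactersD(1)[OF \<xi>] by simp
  moreover have "\<xi> (a [^] int t) = 1" if "t = 0" using that GH.character_one[OF \<xi>] by simp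
  ultimately obtain z where z: "z ^ t = \<xi> (a [^] int t)" "norm z = 1"
    using norm_one_root_exists[of _ t] by (cases "t = 0") (auto intro: that[of 1])
  have "\<xi> (a [^] l) = z powi l" if "a [^] l \<in> H" for l :: int
  proof -
    have "int t dvd l" using that by (simp add: mem)
    then obtain j where j: "l = int t * j" by (rule dvdE)
    have "\<xi> (a [^] l) = \<xi> ((a [^] int t) [^]\<^bsub>G\<lparr>carrier := H\<rparr>\<^esub> j)"
      using a int_pow_consistent[OF H atH, of j] by (simp add: j int_pow_pow)
    also have "\<dots> = (z ^ t) powi j" using GH.character_int_pow[OF \<xi>, of "a [^] int t" j] atH z by simp
    also have "\<dots> = z powi l" by (simp add: j power_int_mult)
    finally show ?thesis .
  qed
  with z(2) show ?thesis by (rule that)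
qed

lemma character_extend:
  assumes "finite F" "F \<subseteq> carrier G" "subgroup H G" "generate G (H \<union> F) = carrier G"
    and "\<xi> \<in> characters (G\<lparr>carrier := H\<rparr>)"
  obtains \<psi> where "\<psi> \<in> characters G" "\<And>h. h \<in> H \<Longrightarrow> \<psi> h = \<xi> h"
proof -
  have "\<exists>\<psi>\<in>characters G. \<forall>h\<in>H. \<psi> h = \<xi> h"
    using assms
  proof (induction F arbitrary: H \<xi> rule: finite_induct)
    case empty
    then have "H = carrier G" by (simp add: generate_subgroup)
    then show ?case using empty by auto
  next
    case (insert a F)
    from insert.prems have a: "a \<in> carrier G" by simp
    obtain z where "norm z = 1" "\<And>l::int. a [^] l \<in> H \<Longrightarrow> \<xi> (a [^] l) = z powi l"
      using exists_compatible_value insert.prems a by blast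
    then obtain K \<psi> where K: "subgroup K G" "H \<subseteq> K" "a \<in> K" "\<psi> \<in> characters (G\<lparr>carrier := K\<rparr>)"
      and \<psi>: "\<And>h. h \<in> H \<Longrightarrow> \<psi> h = \<xi> h"
      using character_extend_adjoin[OF insert.prems(2,4) a] by metis
    have KF: "K \<union> F \<subseteq> carrier G" using subgroup.subset[OF K(1)] insert.prems by auto
    have "carrier G \<subseteq> generate G (K \<union> F)"
      unfolding insert.prems(3)[symmetric] by (rule mono_generate) (use K in auto)
    then have "generate G (K \<union> F) = carrier G" using generate_incl[OF KF] by blast
    then obtain \<psi>' where "\<psi>' \<in> characters G" "\<forall>h\<in>K. \<psi>' h = \<psi> h"
      using insert.IH[OF _ K(1) _ K(4)] insert.prems by auto
    then show ?case using \<psi> K by (intro bexI[of _ \<psi>']) auto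
  qed
  then show ?thesis using that by blast
qed

end

subsection \<open>Character orthogonality\<close>

context finite_comm_group
begin

lemma characters_separate_one:
  assumes a: "a \<in> carrier G" "a \<noteq> \<one>"
  obtains \<xi> where "\<xi> \<in> characters G" "\<xi> a \<noteq> 1"
proof -
  have H: "subgroup {\<one>} G" by (rule triv_subgroup)
  obtain z :: complex where z: "z ^ ord a = 1" "z \<noteq> 1" "norm z = 1"
    using nontrivial_root_of_unity_exists[of "ord a"] a ord_eq_1 by metis
  let ?\<xi> = "trivial_character (G\<lparr>carrier := {\<one>}\<rparr>)"
  have \<xi>: "?\<xi> \<in> characters (G\<lparr>carrier := {\<one>}\<rparr>)"
    by (rule group.trivial_character[OF subgroup_imp_group[OF H]])
  have "?\<xi> (a [^] l) = z powi l" if "a [^] l \<in> {\<one>}" for l :: int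
  proof -
    obtain j where "l = int (ord a) * j" using \<open>a [^] l \<in> {\<one>}\<close> a int_pow_eq_id by (auto elim: dvdE)
    then show ?thesis using z that by (simp add: trivial_character_def power_int_mult)
  qed
  then obtain K \<psi> where K: "subgroup K G" "a \<in> K" "\<psi> \<in> characters (G\<lparr>carrier := K\<rparr>)" "\<psi> a = z"
    using character_extend_adjoin[OF H \<xi> a(1) z(3)] by metis
  have "generate G (K \<union> carrier G) = carrier G"
    using generate_subgroup[of "carrier G"] subgroup.subset[OF K(1)]
    by (simp add: subgroup_self Un_absorb1)
  then obtain \<phi> where "\<phi> \<in> characters G" "\<And>h. h \<in> K \<Longrightarrow> \<phi> h = \<psi> h"
    using character_extend[OF finite_carrier _ K(1) _ K(3)] by blast
  then show ?thesis using that z K by metis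
qed

lemma characters_separate:
  assumes "x \<in> carrier G" "y \<in> carrier G" "\<And>\<xi>. \<xi> \<in> characters G \<Longrightarrow> \<xi> x = \<xi> y"
  shows "x = y"
proof -
  have "\<xi> (x \<otimes> inv y) = 1" if "\<xi> \<in> characters G" for \<xi>
    using that assms(1,2) assms(3)[OF that] by (simp add: charactersD character_inv characters_mult_cnj)
  then have "x \<otimes> inv y = \<one>" using characters_separate_one[of "x \<otimes> inv y"] assms(1,2) by auto
  then show ?thesis using assms(1,2) inv_equality by fastforce
qed

lemma finite_characters: "finite (characters G)"
proof -
  have "characters G \<subseteq> carrier G \<rightarrow>\<^sub>E {z. z ^ order G = 1}"
  proof
    fix \<xi> assume \<xi>: "\<xi> \<in> characters G"
    have "\<xi> x ^ order G = 1" if "x \<in> carrier G" for x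
      using character_pow[OF \<xi> that, of "order G"] pow_order_eq_1[OF that] \<xi> by simp
    then show "\<xi> \<in> carrier G \<rightarrow>\<^sub>E {z. z ^ order G = 1}" using charactersD(3)[OF \<xi>] by auto
  qed
  moreover have "finite {z::complex. z ^ order G = 1}"
    using order_pos by (intro finite_roots_unity) simp
  ultimately show ?thesis by (meson finite_PiE finite_carrier finite_subset)
qed

lemma sum_mult_cnj_characters:
  assumes "\<xi> \<in> characters G" "\<psi> \<in> characters G"
  shows "(\<Sum>x\<in>carrier G. \<xi> x * cnj (\<psi> x)) = (if \<xi> = \<psi> then of_nat (order G) else 0)"
proof (cases "\<xi> = \<psi>")
  case True
  then show ?thesis using assms by (simp add: characters_mult_cnj order_def)
next
  case False
  let ?f = "\<lambda>x. \<xi> x * cnj (\<psi> x)"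
  obtain y where y: "y \<in> carrier G" "\<xi> y \<noteq> \<psi> y" using False characters_eqI assms by blast
  have "?f y \<noteq> 1"
  proof
    assume "?f y = 1"
    then have "\<xi> y * (cnj (\<psi> y) * \<psi> y) = \<psi> y" by (metis mult.assoc mult_1)
    then show False using y characters_mult_cnj[OF assms(2) y(1)] by simp
  qed
  have "bij_betw (\<lambda>x. y \<otimes> x) (carrier G) (carrier G)"
    using y by (intro bij_betwI[of _ _ _ "\<lambda>x. inv y \<otimes> x"]) (auto simp: m_assoc[symmetric])
  then have "sum ?f (carrier G) = (\<Sum>x\<in>carrier G. ?f (y \<otimes> x))"
    by (intro sum.reindex_bij_betw[symmetric])
  also have "\<dots> = (\<Sum>x\<in>carrier G. ?f y * ?f x)"
    using assms y by (intro sum.cong) (auto simp: charactersD)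
  also have "\<dots> = ?f y * sum ?f (carrier G)" by (simp add: sum_distrib_left)
  finally have "(1 - ?f y) * sum ?f (carrier G) = 0" by (simp add: algebra_simps)
  with \<open>?f y \<noteq> 1\<close> False show ?thesis by simp
qed

lemma sum_characters_eq_card:
  assumes "x \<in> carrier G"
  shows "(\<Sum>\<xi>\<in>characters G. \<xi> x) = (if x = \<one> then of_nat (card (characters G)) else 0)"
proof (cases "x = \<one>")
  case False
  obtain \<psi> where \<psi>: "\<psi> \<in> characters G" "\<psi> x \<noteq> 1"
    using characters_separate_one[OF assms False] by blast
  have "bij_betw (\<lambda>\<xi>. \<lambda>y\<in>carrier G. \<psi> y * \<xi> y) (characters G) (characters G)"
  proof (rule bij_betwI[of _ _ _ "\<lambda>\<xi>. \<lambda>y\<in>carrier G. cnj (\<psi> y) * \<xi> y"])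
    show "(\<lambda>\<xi>. \<lambda>y\<in>carrier G. \<psi> y * \<xi> y) \<in> characters G \<rightarrow> characters G"
      using characters_mult[OF \<psi>(1)] by blast
    show "(\<lambda>\<xi>. \<lambda>y\<in>carrier G. cnj (\<psi> y) * \<xi> y) \<in> characters G \<rightarrow> characters G"
      using characters_mult[OF characters_cnj[OF \<psi>(1)]] by (simp cong: restrict_cong)
  qed (auto simp: fun_eq_iff mult.assoc[symmetric] characters_mult_cnj[OF \<psi>(1)] charactersD(3))
  then have "(\<Sum>\<xi>\<in>characters G. \<xi> x) = (\<Sum>\<xi>\<in>characters G. \<psi> x * \<xi> x)"
    using assms sum.reindex_bij_betw[of "\<lambda>\<xi>. \<lambda>y\<in>carrier G. \<psi> y * \<xi> y" _ _ "\<lambda>\<xi>. \<xi> x"] by simp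
  then have "(1 - \<psi> x) * (\<Sum>\<xi>\<in>characters G. \<xi> x) = 0"
    by (simp add: left_diff_distrib flip: sum_distrib_left)
  then show ?thesis using \<psi> False by simp
qed simp

lemma card_characters: "card (characters G) = order G"
proof -
  have "(\<Sum>x\<in>carrier G. \<xi> x) = (if \<xi> = trivial_character G then of_nat (order G) else 0)"
    if "\<xi> \<in> characters G" for \<xi>
    using sum_mult_cnj_characters[OF that trivial_character] by (simp add: trivial_character_def)
  then have "(\<Sum>\<xi>\<in>characters G. \<Sum>x\<in>carrier G. \<xi> x) = of_nat (order G)"
    by (simp add: finite_characters)
  moreover have "(\<Sum>x\<in>carrier G. \<Sum>\<xi>\<in>characters G. \<xi> x) = of_nat (card (characters G))"
    by (simp add: sum_characters_eq_card finite_carrier)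
  ultimately have "complex_of_nat (card (characters G)) = of_nat (order G)"
    using sum.swap[of "\<lambda>\<xi> x. \<xi> x" "carrier G" "characters G"] by simp
  then show ?thesis by simp
qed

lemma sum_characters:
  "x \<in> carrier G \<Longrightarrow> (\<Sum>\<xi>\<in>characters G. \<xi> x) = (if x = \<one> then of_nat (order G) else 0)"
  by (simp add: sum_characters_eq_card card_characters)

lemma sum_characters_mult_cnj:
  assumes "x \<in> carrier G" "y \<in> carrier G"
  shows "(\<Sum>\<xi>\<in>characters G. \<xi> x * cnj (\<xi> y)) = (if x = y then of_nat (order G) else 0)"
proof -
  have "(\<Sum>\<xi>\<in>characters G. \<xi> x * cnj (\<xi> y)) = (\<Sum>\<xi>\<in>characters G. \<xi> (x \<otimes> inv y))"
    using assms by (intro sum.cong) (auto simp: charactersD character_inv)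
  also have "\<dots> = (if x \<otimes> inv y = \<one> then of_nat (order G) else 0)"
    using assms by (simp add: sum_characters)
  also have "x \<otimes> inv y = \<one> \<longleftrightarrow> x = y"
    using assms inv_equality by fastforce
  finally show ?thesis .
qed

end

section \<open>The phase space of a finite abelian group\<close>

definition phase_space :: "('a, 'b) monoid_scheme \<Rightarrow> ('a \<times> ('a \<Rightarrow> complex)) set" where
  "phase_space G = carrier G \<times> characters G"

text \<open>The factor that an edge between vertices with labels \<open>u = (f, C)\<close> and \<open>v = (g, D)\<close>
  contributes to the character sum, namely \<open>(C - D) (f - g)\<close> in additive notation.\<close>

definition phase_kernel :: "'a \<times> ('a \<Rightarrow> complex) \<Rightarrow> 'a \<times> ('a \<Rightarrow> complex) \<Rightarrow> complex" where
  "phase_kernel u v = snd u (fst u) * snd v (fst v) * cnj (snd u (fst v)) * cnj (snd v (fst u))"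

definition isotropic :: "('a \<times> ('a \<Rightarrow> complex)) set \<Rightarrow> bool" where
  "isotropic U \<longleftrightarrow> (\<forall>u\<in>U. \<forall>v\<in>U. phase_kernel u v = 1)"

lemma isotropic_subset: "isotropic U \<Longrightarrow> W \<subseteq> U \<Longrightarrow> isotropic W"
  unfolding isotropic_def by blast

definition alt_bichars :: "('a, 'b) monoid_scheme \<Rightarrow> ('a \<Rightarrow> 'a \<Rightarrow> complex) set" where
  "alt_bichars G = {b \<in> carrier G \<rightarrow>\<^sub>E characters G.
     (\<forall>x\<in>carrier G. \<forall>y\<in>carrier G. \<forall>z\<in>carrier G. b (x \<otimes>\<^bsub>G\<^esub> y) z = b x z * b y z) \<and>
     (\<forall>x\<in>carrier G. b x x = 1)}"

lemma phase_kernel_commute: "phase_kernel u v = phase_kernel v u"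
  by (simp add: phase_kernel_def ac_simps)

lemma phase_spaceD:
  assumes "u \<in> phase_space G"
  shows "fst u \<in> carrier G" "snd u \<in> characters G"
  using assms by (auto simp: phase_space_def)

lemma norm_phase_kernel:
  "u \<in> phase_space G \<Longrightarrow> v \<in> phase_space G \<Longrightarrow> norm (phase_kernel u v) = 1"
  by (cases u; cases v) (auto simp: phase_kernel_def norm_mult charactersD phase_space_def)

lemma phase_kernel_refl:
  assumes "u \<in> phase_space G"
  shows "phase_kernel u u = 1"
proof -
  have "phase_kernel u u =
    (snd u (fst u) * cnj (snd u (fst u))) * (snd u (fst u) * cnj (snd u (fst u)))"
    by (simp add: phase_kernel_def)
  then show ?thesis using characters_mult_cnj[of "snd u" G "fst u"] phase_spaceD[OF assms] by simp
qed

context comm_group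
begin

definition phase_affine ::
    "'a \<times> ('a \<Rightarrow> complex) \<Rightarrow> 'a \<times> ('a \<Rightarrow> complex) \<Rightarrow> 'a \<times> ('a \<Rightarrow> complex) \<Rightarrow> 'a \<times> ('a \<Rightarrow> complex)" where
  "phase_affine u v w =
     (fst u \<otimes> inv fst v \<otimes> fst w, \<lambda>g\<in>carrier G. snd u g * cnj (snd v g) * snd w g)"

lemma phase_affine_in_phase_space:
  assumes "u \<in> phase_space G" "v \<in> phase_space G" "w \<in> phase_space G"
  shows "phase_affine u v w \<in> phase_space G"
proof -
  note charsI = characters_mult[OF characters_mult[OF phase_spaceD(2)[OF assms(1)]
        characters_cnj[OF phase_spaceD(2)[OF assms(2)]]] phase_spaceD(2)[OF assms(3)]]
  show ?thesis
    using charsI assms by (auto simp: phase_affine_def phase_space_def cong: restrict_cong)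
qed

text \<open>The kernel is \<open>Q (u - v)\<close> for the quadratic form \<open>Q (f, C) = C f\<close>, and
  \<open>Q (x - u + v - w)\<close> expands by polarization.\<close>

lemma phase_kernel_affine:
  assumes "u \<in> phase_space G" "v \<in> phase_space G" "w \<in> phase_space G" "x \<in> phase_space G"
  shows "phase_kernel x (phase_affine u v w) =
    phase_kernel x u * phase_kernel x w * phase_kernel u v * phase_kernel v w *
    cnj (phase_kernel x v) * cnj (phase_kernel u w)"
proof -
  obtain f C f' C' f'' C'' g D where eq: "u = (f, C)" "v = (f', C')" "w = (f'', C'')" "x = (g, D)"
    by (metis surj_pair)
  have points: "f \<in> carrier G" "f' \<in> carrier G" "f'' \<in> carrier G" "g \<in> carrier G"
    "C \<in> characters G" "C' \<in> characters G" "C'' \<in> characters G" "D \<in> characters G"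
    using assms eq by (auto simp: phase_space_def)
  have nonzero: "E h \<noteq> 0" if "E \<in> characters G" "h \<in> carrier G" for E h
    using charactersD(1)[OF that] by auto
  show ?thesis
    using points
    by (simp add: phase_kernel_def phase_affine_def eq charactersD character_inv nonzero
        characters_cnj_eq_inverse field_simps)
qed

lemma alt_bicharsD:
  assumes "b \<in> alt_bichars G"
  shows "x \<in> carrier G \<Longrightarrow> b x \<in> characters G"
    and "x \<in> carrier G \<Longrightarrow> y \<in> carrier G \<Longrightarrow> z \<in> carrier G \<Longrightarrow> b (x \<otimes> y) z = b x z * b y z"
    and "x \<in> carrier G \<Longrightarrow> b x x = 1"
  using assms by (auto simp: alt_bichars_def)

lemma alt_bichars_eqI:
  assumes "b \<in> alt_bichars G" "b' \<in> alt_bichars G" "\<And>x. x \<in> carrier G \<Longrightarrow> b x = b' x"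
  shows "b = b'"
  by (rule PiE_ext[of b "carrier G" "\<lambda>_. characters G" b']) (use assms in \<open>auto simp: alt_bichars_def\<close>)

lemma alt_bichars_antisym:
  assumes b: "b \<in> alt_bichars G" and xy: "x \<in> carrier G" "y \<in> carrier G"
  shows "b x y * b y x = 1"
proof -
  have "1 = b (x \<otimes> y) (x \<otimes> y)" using alt_bicharsD(3)[OF b] xy by simp
  also have "\<dots> = (b x x * b x y) * (b y x * b y y)"
    using xy alt_bicharsD(2)[OF b, of x y "x \<otimes> y"]
    by (simp add: charactersD(2)[OF alt_bicharsD(1)[OF b]])
  also have "\<dots> = b x y * b y x" using xy alt_bicharsD(3)[OF b] by simp
  finally show ?thesis by simp
qed

lemma alt_bichars_one:
  assumes b: "b \<in> alt_bichars G"
  shows "b \<one> = trivial_character G"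
proof (rule characters_eqI)
  fix x assume x: "x \<in> carrier G"
  have "b \<one> x * b \<one> x = b \<one> x" using alt_bicharsD(2)[OF b, of \<one> \<one> x] x by simp
  moreover have "b \<one> x \<noteq> 0" using charactersD(1)[OF alt_bicharsD(1)[OF b], of \<one> x] x by auto
  ultimately show "b \<one> x = trivial_character G x" using x by (simp add: trivial_character_def)
qed (use alt_bicharsD[OF b] in auto)

lemma alt_bichars_graph_isotropic:
  assumes b: "b \<in> alt_bichars G"
  shows "isotropic ((\<lambda>x. (x, b x)) ` carrier G)"
proof -
  have "phase_kernel (x, b x) (y, b y) = 1" if "x \<in> carrier G" "y \<in> carrier G" for x y
  proof -
    have "phase_kernel (x, b x) (y, b y) = cnj (b x y * b y x)"
      using alt_bicharsD(3)[OF b] that by (simp add: phase_kernel_def)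
    then show ?thesis using alt_bichars_antisym[OF b that] by simp
  qed
  then show ?thesis by (auto simp: isotropic_def)
qed

lemma isotropic_self:
  assumes U: "U \<subseteq> phase_space G" "isotropic U" and root: "(\<one>, trivial_character G) \<in> U" and u: "u \<in> U"
  shows "snd u (fst u) = 1"
  using U(2) u root phase_spaceD[OF subsetD[OF U(1) u]]
  by (force simp: isotropic_def phase_kernel_def trivial_character_def)

lemma isotropic_antisym:
  assumes U: "U \<subseteq> phase_space G" "isotropic U" and root: "(\<one>, trivial_character G) \<in> U"
    and uv: "u \<in> U" "v \<in> U"
  shows "snd u (fst v) = cnj (snd v (fst u))"
proof -
  have "cnj (snd u (fst v)) * cnj (snd v (fst u)) = 1"
    using U(2) uv isotropic_self[OF U root, of u] isotropic_self[OF U root, of v]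
    by (force simp: isotropic_def phase_kernel_def)
  then have "snd u (fst v) * cnj (snd u (fst v)) * cnj (snd v (fst u)) = snd u (fst v)"
    by (simp add: mult.assoc)
  moreover have "snd u (fst v) * cnj (snd u (fst v)) = 1"
    using U(1) uv by (intro characters_mult_cnj(1)[of _ G] phase_spaceD) auto
  ultimately show ?thesis by simp
qed

lemma isotropic_eq_alt_bichars_graph:
  assumes U: "U \<subseteq> phase_space G" "isotropic U"
    and root: "(\<one>, trivial_character G) \<in> U" and onto: "fst ` U = carrier G"
  obtains b where "b \<in> alt_bichars G" "\<And>u. u \<in> U \<Longrightarrow> snd u = b (fst u)"
proof -
  note inU = subsetD[OF U(1), THEN phase_spaceD(1)] subsetD[OF U(1), THEN phase_spaceD(2)]
  note self = isotropic_self[OF U root] and antisym = isotropic_antisym[OF U root]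
  have over: "\<exists>u\<in>U. fst u = x" if "x \<in> carrier G" for x
    using that onto[symmetric] by auto
  have "snd u = snd v" if uv: "u \<in> U" "v \<in> U" "fst u = fst v" for u v
  proof (rule characters_eqI[OF inU(2)[OF uv(1)] inU(2)[OF uv(2)]])
    fix x assume "x \<in> carrier G"
    then obtain w where "w \<in> U" "fst w = x" using over by blast
    then show "snd u x = snd v x" using antisym[OF uv(1), of w] antisym[OF uv(2), of w] uv(3) by simp
  qed
  then obtain b' where b': "\<And>u. u \<in> U \<Longrightarrow> snd u = b' (fst u)"
    using function_factors_left_gen[of "\<lambda>u. u \<in> U" fst snd] by metis
  define b where "b = restrict b' (carrier G)"
  have b: "snd u = b (fst u)" if "u \<in> U" for u using b'[OF that] inU[OF that] by (simp add: b_def)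
  have b_eq: "b x z = cnj (snd w x)" if x: "x \<in> carrier G" and w: "w \<in> U" "z = fst w" for x z w
  proof -
    obtain u where "u \<in> U" "fst u = x" using over[OF x] by blast
    then show ?thesis using antisym[of u w] b[of u] w by simp
  qed
  have "b \<in> alt_bichars G"
    unfolding alt_bichars_def
  proof (intro CollectI conjI ballI)
    show "b \<in> carrier G \<rightarrow>\<^sub>E characters G"
    proof (rule PiE_I)
      fix x assume "x \<in> carrier G"
      then obtain u where "u \<in> U" "fst u = x" using over by blast
      then show "b x \<in> characters G" using b[of u] inU[of u] by simp
    qed (simp add: b_def)
    fix x assume x: "x \<in> carrier G"
    obtain u where "u \<in> U" "fst u = x" using over[OF x] by blast
    then show "b x x = 1" using b[of u] self[of u] by simp
    fix y z assume y: "y \<in> carrier G" and z: "z \<in> carrier G"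
    obtain w where w: "w \<in> U" "z = fst w" using over[OF z] by blast
    then show "b (x \<otimes> y) z = b x z * b y z"
      using b_eq[OF _ w] x y charactersD(2)[OF inU(2)[OF w(1)]] by simp
  qed
  then show ?thesis using that b by blast
qed

end

context finite_comm_group
begin

lemma finite_phase_space: "finite (phase_space G)"
  by (simp add: phase_space_def finite_characters finite_carrier)

lemma sum_phase_kernel_mult_cnj:
  assumes "u \<in> phase_space G" "u' \<in> phase_space G"
  shows "(\<Sum>v\<in>phase_space G. phase_kernel u v * cnj (phase_kernel u' v)) =
    (if u = u' then (of_nat (order G))\<^sup>2 else 0)"
proof -
  obtain f C f' C' where eq: "u = (f, C)" "u' = (f', C')" by force
  have points: "f \<in> carrier G" "f' \<in> carrier G" "C \<in> characters G" "C' \<in> characters G"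
    using assms eq by (auto simp: phase_space_def)
  have "(\<Sum>v\<in>phase_space G. phase_kernel u v * cnj (phase_kernel u' v)) =
    (\<Sum>g\<in>carrier G. \<Sum>D\<in>characters G. phase_kernel u (g, D) * cnj (phase_kernel u' (g, D)))"
    by (simp add: phase_space_def sum.cartesian_product)
  also have "\<dots> = (\<Sum>g\<in>carrier G. \<Sum>D\<in>characters G.
      (C f * cnj (C' f')) * ((C' g * cnj (C g)) * (D f' * cnj (D f))))"
  proof (intro sum.cong refl)
    fix g D assume g: "g \<in> carrier G" and D: "D \<in> characters G"
    have "phase_kernel u (g, D) * cnj (phase_kernel u' (g, D)) =
      (D g * cnj (D g)) * ((C f * cnj (C' f')) * ((C' g * cnj (C g)) * (D f' * cnj (D f))))"
      by (simp add: phase_kernel_def eq ac_simps)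
    then show "phase_kernel u (g, D) * cnj (phase_kernel u' (g, D)) =
      (C f * cnj (C' f')) * ((C' g * cnj (C g)) * (D f' * cnj (D f)))"
      using characters_mult_cnj[OF D g] by simp
  qed
  also have "\<dots> = (C f * cnj (C' f')) * ((\<Sum>g\<in>carrier G. C' g * cnj (C g)) *
      (\<Sum>D\<in>characters G. D f' * cnj (D f)))"
    by (simp only: sum_distrib_left sum_distrib_right) (rule sum.swap)
  also have "\<dots> = (if u = u' then (of_nat (order G))\<^sup>2 else 0)"
    using points
    by (simp add: sum_mult_cnj_characters sum_characters_mult_cnj eq characters_mult_cnj power2_eq_square)
  finally show ?thesis .
qed

lemma sum_norm_sum_phase_kernel:
  assumes U: "U \<subseteq> phase_space G"
  shows "(\<Sum>v\<in>phase_space G. (norm (\<Sum>u\<in>U. phase_kernel u v))\<^sup>2) = (order G)\<^sup>2 * card U"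
proof -
  have finU: "finite U" using U finite_phase_space finite_subset by blast
  have "complex_of_real (\<Sum>v\<in>phase_space G. (norm (\<Sum>u\<in>U. phase_kernel u v))\<^sup>2) =
    (\<Sum>v\<in>phase_space G. (\<Sum>u\<in>U. phase_kernel u v) * cnj (\<Sum>u\<in>U. phase_kernel u v))"
    by (simp add: complex_norm_square del: of_real_power)
  also have "\<dots> = (\<Sum>v\<in>phase_space G. \<Sum>u\<in>U. \<Sum>u'\<in>U. phase_kernel u v * cnj (phase_kernel u' v))"
    by (simp add: sum_product)
  also have "\<dots> = (\<Sum>u\<in>U. \<Sum>v\<in>phase_space G. \<Sum>u'\<in>U. phase_kernel u v * cnj (phase_kernel u' v))"
    by (rule sum.swap)
  also have "\<dots> = (\<Sum>u\<in>U. \<Sum>u'\<in>U. \<Sum>v\<in>phase_space G. phase_kernel u v * cnj (phase_kernel u' v))"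
    by (intro sum.cong refl sum.swap)
  also have "\<dots> = (\<Sum>u\<in>U. \<Sum>u'\<in>U. if u = u' then (of_nat (order G))\<^sup>2 else 0)"
    using U by (intro sum.cong refl sum_phase_kernel_mult_cnj) auto
  also have "\<dots> = complex_of_real ((order G)\<^sup>2 * card U)" by (simp add: finU)
  finally show ?thesis unfolding of_real_eq_iff by simp
qed

lemma isotropic_sum_norm_sum_phase_kernel:
  assumes "isotropic U"
  shows "(\<Sum>v\<in>U. (norm (\<Sum>u\<in>U. phase_kernel u v))\<^sup>2) = (real (card U))\<^sup>2 * card U"
proof -
  have "(norm (\<Sum>u\<in>U. phase_kernel u v))\<^sup>2 = (real (card U))\<^sup>2" if "v \<in> U" for v
    using assms that by (simp add: isotropic_def)
  then show ?thesis by simp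
qed

lemma card_isotropic_le:
  assumes U: "U \<subseteq> phase_space G" "isotropic U"
  shows "card U \<le> order G"
proof (cases "U = {}")
  case False
  then have pos: "real (card U) > 0"
    using U(1) finite_phase_space finite_subset by (simp add: card_gt_0_iff) blast
  have "(\<Sum>v\<in>U. (norm (\<Sum>u\<in>U. phase_kernel u v))\<^sup>2) \<le>
    (\<Sum>v\<in>phase_space G. (norm (\<Sum>u\<in>U. phase_kernel u v))\<^sup>2)"
    by (intro sum_mono2 U(1) finite_phase_space) auto
  then have "(real (card U))\<^sup>2 * card U \<le> (real (order G))\<^sup>2 * card U"
    by (simp add: isotropic_sum_norm_sum_phase_kernel[OF U(2)] sum_norm_sum_phase_kernel[OF U(1)])
  then show ?thesis using pos by (simp add: power_mono_iff flip: of_nat_power)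
qed simp

lemma sum_phase_kernel_maximal_isotropic:
  assumes U: "U \<subseteq> phase_space G" "isotropic U" and card: "card U = order G"
    and v: "v \<in> phase_space G - U"
  shows "(\<Sum>u\<in>U. phase_kernel u v) = 0"
proof -
  let ?S = "\<lambda>v. (norm (\<Sum>u\<in>U. phase_kernel u v))\<^sup>2"
  have "sum ?S (phase_space G - U) = sum ?S (phase_space G) - sum ?S U"
    by (rule sum_diff[OF finite_phase_space U(1)])
  also have "\<dots> = 0"
    by (simp add: sum_norm_sum_phase_kernel[OF U(1)] isotropic_sum_norm_sum_phase_kernel[OF U(2)] card)
  finally have "?S v = 0" using v finite_phase_space by (subst (asm) sum_nonneg_eq_0_iff) auto
  then show ?thesis by simp
qed

lemma maximal_isotropic_affine_closed:
  assumes U: "U \<subseteq> phase_space G" "isotropic U" and card: "card U = order G"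
    and uvw: "u \<in> U" "v \<in> U" "w \<in> U"
  shows "phase_affine u v w \<in> U" (is "?y \<in> U")
proof (rule ccontr)
  assume "?y \<notin> U"
  moreover have "?y \<in> phase_space G" using U(1) uvw by (intro phase_affine_in_phase_space) auto
  ultimately have "(\<Sum>x\<in>U. phase_kernel x ?y) = 0"
    using sum_phase_kernel_maximal_isotropic[OF U card] by blast
  moreover have "phase_kernel x ?y = 1" if "x \<in> U" for x
    using U uvw that by (subst phase_kernel_affine) (auto simp: isotropic_def)
  ultimately show False using card order_pos by simp
qed

lemma maximal_isotropic_onto:
  assumes U: "U \<subseteq> phase_space G" "isotropic U" and card: "card U = order G"
    and one: "\<one> \<in> fst ` U" and gen: "generate G (fst ` U) = carrier G"
  shows "fst ` U = carrier G"
proof -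
  have closed: "x \<otimes> inv y \<otimes> z \<in> fst ` U" if "x \<in> fst ` U" "y \<in> fst ` U" "z \<in> fst ` U" for x y z
  proof -
    from that obtain u v w where "u \<in> U" "v \<in> U" "w \<in> U" "x = fst u" "y = fst v" "z = fst w" by blast
    then show ?thesis
      using maximal_isotropic_affine_closed[OF U card, of u v w] by (force simp: phase_affine_def)
  qed
  have sub: "fst ` U \<subseteq> carrier G" using U by (auto simp: phase_space_def)
  have "subgroup (fst ` U) G"
  proof (rule subgroupI)
    show "inv x \<in> fst ` U" if "x \<in> fst ` U" for x
      using closed[OF one that one] subsetD[OF sub that] by simp
    show "x \<otimes> y \<in> fst ` U" if "x \<in> fst ` U" "y \<in> fst ` U" for x y
      using closed[OF that(1) one that(2)] subsetD[OF sub that(1)] by simp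
  qed (use sub one in auto)
  then show ?thesis using gen generate_subgroup by simp
qed

end

section \<open>Energy of maps into a finite kernel space\<close>

subsection \<open>Sums over small subsets\<close>

definition small_subsets :: "real \<Rightarrow> nat \<Rightarrow> nat set set" where
  "small_subsets \<epsilon> n = {S. S \<subseteq> {..<n} \<and> real (card S) \<le> \<epsilon> * real n}"

lemma finite_small_subsets: "finite (small_subsets \<epsilon> n)"
  by (rule finite_subset[of _ "Pow {..<n}"]) (auto simp: small_subsets_def)

lemma sum_Pow_power_card:
  fixes y :: "'a :: comm_semiring_1"
  assumes "finite A"
  shows "(\<Sum>S\<in>Pow A. y ^ card S) = (1 + y) ^ card A"
  using prod_add[OF assms, of "\<lambda>_. y" "\<lambda>_. 1"] by (simp add: add.commute)

lemma sum_small_subsets_nonempty_le: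
  fixes y :: real
  assumes "y \<ge> 0"
  shows "(\<Sum>S\<in>small_subsets \<epsilon> n - {{}}. y ^ card S) \<le> (1 + y) ^ n - 1"
proof -
  have "(\<Sum>S\<in>small_subsets \<epsilon> n - {{}}. y ^ card S) \<le> (\<Sum>S\<in>Pow {..<n} - {{}}. y ^ card S)"
    using assms by (intro sum_mono2) (auto simp: small_subsets_def)
  also have "\<dots> = (1 + y) ^ n - 1"
    using sum_Pow_power_card[of "{..<n}" y] by (simp add: sum_diff1)
  finally show ?thesis .
qed

lemma sum_small_subsets_le:
  fixes M l :: real
  assumes M_nonneg: "M \<ge> 0" and l_ge_1: "l \<ge> 1"
  shows "(\<Sum>S\<in>small_subsets \<epsilon> n. M ^ card S) \<le> ((1 + M / l) * l powr \<epsilon>) ^ n"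
proof -
  have "M ^ card S \<le> (M / l) ^ card S * (l powr \<epsilon>) ^ n" if S: "S \<in> small_subsets \<epsilon> n" for S
  proof -
    have "l ^ card S = l powr card S" using l_ge_1 by (simp add: powr_realpow)
    also have "\<dots> \<le> l powr (\<epsilon> * n)" using S l_ge_1 by (intro powr_mono) (auto simp: small_subsets_def)
    also have "\<dots> = (l powr \<epsilon>) ^ n" using l_ge_1 by (simp add: powr_powr[symmetric] powr_realpow)
    finally have "(M / l) ^ card S * l ^ card S \<le> (M / l) ^ card S * (l powr \<epsilon>) ^ n"
      using M_nonneg l_ge_1 by (intro mult_left_mono) auto
    then show ?thesis using l_ge_1 by (simp flip: power_mult_distrib)
  qed
  then have "(\<Sum>S\<in>small_subsets \<epsilon> n. M ^ card S) \<le>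
      (\<Sum>S\<in>small_subsets \<epsilon> n. (M / l) ^ card S * (l powr \<epsilon>) ^ n)"
    by (rule sum_mono)
  also have "\<dots> \<le> (\<Sum>S\<in>Pow {..<n}. (M / l) ^ card S * (l powr \<epsilon>) ^ n)"
    using M_nonneg l_ge_1 by (intro sum_mono2) (auto simp: small_subsets_def)
  also have "\<dots> = ((1 + M / l) * l powr \<epsilon>) ^ n"
    by (simp add: sum_Pow_power_card power_mult_distrib flip: sum_distrib_right)
  finally show ?thesis .
qed

lemma sum_small_subsets_tendsto:
  fixes M \<rho> :: real
  assumes M_nonneg: "M \<ge> 0" and \<rho>: "0 \<le> \<rho>" "\<rho> < 1"
  shows "\<forall>\<^sub>F \<epsilon> in at_right 0. (\<lambda>n. (\<Sum>S\<in>small_subsets \<epsilon> n. M ^ card S) * \<rho> ^ n) \<longlonglongrightarrow> 0"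
proof -
  have "((\<lambda>l. (1 + M / l) * \<rho>) \<longlongrightarrow> \<rho>) at_top" by real_asymp
  then have "\<forall>\<^sub>F l in at_top. (1 + M / l) * \<rho> < 1" by (rule order_tendstoD(2)) (rule \<rho>)
  then obtain l where l: "l \<ge> 1" "(1 + M / l) * \<rho> < 1"
    using eventually_happens'[OF _ eventually_conj[OF eventually_ge_at_top[of 1]]] by force
  have "((\<lambda>\<epsilon>. (1 + M / l) * l powr \<epsilon> * \<rho>) \<longlongrightarrow> (1 + M / l) * l powr 0 * \<rho>) (at_right 0)"
    using l by (intro tendsto_intros) auto
  then have "\<forall>\<^sub>F \<epsilon> in at_right 0. (1 + M / l) * l powr \<epsilon> * \<rho> < 1"
    by (rule order_tendstoD(2)) (use l in simp)
  then show ?thesis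
  proof eventually_elim
    case (elim \<epsilon>)
    have "(\<lambda>n. ((1 + M / l) * l powr \<epsilon> * \<rho>) ^ n) \<longlonglongrightarrow> 0"
      using elim M_nonneg l \<rho> by (intro LIMSEQ_realpow_zero) auto
    then show ?case
    proof (rule tendsto_sandwich[OF _ _ tendsto_const, rotated 2])
      show "\<forall>\<^sub>F n in sequentially. (\<Sum>S\<in>small_subsets \<epsilon> n. M ^ card S) * \<rho> ^ n \<le>
          ((1 + M / l) * l powr \<epsilon> * \<rho>) ^ n"
        unfolding power_mult_distrib[of _ \<rho>]
        using \<rho> by (intro always_eventually allI mult_right_mono sum_small_subsets_le M_nonneg l) auto
    qed (use M_nonneg \<rho> in \<open>auto intro!: always_eventually mult_nonneg_nonneg sum_nonneg\<close>)
  qed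
qed

subsection \<open>Elementary estimates\<close>

lemma half_one_plus_exp_le:
  fixes x \<gamma> :: real
  assumes "0 \<le> x" "x \<le> 1 - \<gamma>"
  shows "(1 + exp (- x)) / 2 \<le> exp (- \<gamma> * x / 2)"
proof -
  have "exp (- x) \<le> 1 / (1 + x)"
    using exp_ge_add_one_self[of x] assms by (simp add: exp_minus field_simps)
  also have "\<dots> \<le> 1 - x + x * x" using assms by (simp add: field_simps)
  finally have "(1 + exp (- x)) / 2 \<le> (1 + (1 - x + x * x)) / 2" by simp
  also have "\<dots> = 1 + (- x * (1 - x) / 2)" by (simp add: field_simps)
  also have "\<dots> \<le> exp (- x * (1 - x) / 2)" by (rule exp_ge_add_one_self)
  also have "\<dots> \<le> exp (- \<gamma> * x / 2)"
    using assms mult_left_mono[of \<gamma> "1 - x" x] by (simp add: algebra_simps)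
  finally show ?thesis .
qed

lemma half_one_plus_exp_power_le:
  fixes c \<gamma> :: real and n k :: nat
  defines "x \<equiv> 2 * (c * ln n / n) * k"
  assumes n: "n \<ge> 1" and c_nonneg: "c \<ge> 0" and \<gamma>: "\<gamma> \<ge> 0"
    and k_le: "k \<le> (1 - \<gamma>) * n" and x: "x \<le> 1 - \<gamma>"
  shows "((1 + exp (- x)) / 2) ^ (n - k) \<le> (n powr - (c * \<gamma>\<^sup>2)) ^ k"
proof -
  have x_nonneg: "x \<ge> 0" using n c_nonneg by (simp add: x_def)
  have "(1 - \<gamma>) * n \<le> n" using \<gamma> by (simp add: mult_left_le_one_le algebra_simps)
  then have "k \<le> n" using k_le by linarith
  then have diff_ge: "\<gamma> * n \<le> real (n - k)" using k_le by (simp add: algebra_simps of_nat_diff)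
  have "((1 + exp (- x)) / 2) ^ (n - k) \<le> exp (- \<gamma> * x / 2) ^ (n - k)"
    using x x_nonneg by (intro power_mono half_one_plus_exp_le) (auto simp: add_nonneg_nonneg)
  also have "\<dots> = exp (- ((\<gamma> * x / 2) * real (n - k)))"
    by (subst exp_of_nat_mult[symmetric]) (simp add: mult_ac)
  also have "\<dots> \<le> exp (- ((\<gamma> * x / 2) * (\<gamma> * n)))"
    using diff_ge \<gamma> x_nonneg by (simp add: mult_left_mono)
  also have "(\<gamma> * x / 2) * (\<gamma> * n) = k * (c * \<gamma>\<^sup>2 * ln n)"
    using n by (simp add: x_def power2_eq_square)
  also have "exp (- (k * (c * \<gamma>\<^sup>2 * ln n))) = exp (k * (- (c * \<gamma>\<^sup>2) * ln n))" by simp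
  also have "\<dots> = (n powr - (c * \<gamma>\<^sup>2)) ^ k"
    using n by (subst exp_of_nat_mult) (simp add: powr_def)
  finally show ?thesis .
qed

lemma exp_minus_chord:
  fixes a x :: real
  assumes "0 \<le> a" "a \<le> x"
  shows "exp (- a) \<le> 1 - a / x * (1 - exp (- x))"
  using convex_onD[OF exp_convex, of "a / x" 0 "- x"] assms
  by (cases "x = 0") (simp_all add: algebra_simps)

lemma power_exp_neg_n_ln_n_tendsto:
  fixes M \<kappa> :: real
  assumes "M \<ge> 0" "\<kappa> > 0"
  shows "(\<lambda>n. M ^ n * exp (- \<kappa> * n * ln n)) \<longlonglongrightarrow> 0"
proof (rule tendsto_sandwich[OF _ _ tendsto_const])
  have "(\<lambda>n. M * exp (- \<kappa> * ln (real n))) \<longlonglongrightarrow> 0"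
    using assms by real_asymp
  then have "\<forall>\<^sub>F n in sequentially. M * exp (- \<kappa> * ln (real n)) < 1 / 2"
    by (rule order_tendstoD) simp
  then show "\<forall>\<^sub>F n in sequentially. M ^ n * exp (- \<kappa> * real n * ln (real n)) \<le> (1 / 2) ^ n"
  proof eventually_elim
    case (elim n)
    have "M ^ n * exp (- \<kappa> * real n * ln (real n)) = (M * exp (- \<kappa> * ln (real n))) ^ n"
      by (simp add: power_mult_distrib exp_of_nat_mult[symmetric] mult_ac)
    also have "\<dots> \<le> (1 / 2) ^ n" using elim assms by (intro power_mono) auto
    finally show ?case .
  qed
  show "(\<lambda>n. (1 / 2) ^ n :: real) \<longlonglongrightarrow> 0" by (intro LIMSEQ_realpow_zero) auto
qed (use assms in auto)

lemma one_plus_powr_power_tendsto: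
  fixes M c :: real
  assumes "c > 1"
  shows "(\<lambda>n. (1 + M * n powr - c) ^ n) \<longlonglongrightarrow> 1"
  using assms by real_asymp

subsection \<open>Stray maps\<close>

lemma sum_UN_le:
  fixes f :: "'a \<Rightarrow> real"
  assumes "finite I" "\<And>i. i \<in> I \<Longrightarrow> finite (A i)" "\<And>x. 0 \<le> f x"
  shows "sum f (\<Union>i\<in>I. A i) \<le> (\<Sum>i\<in>I. sum f (A i))"
  using assms(1,2)
proof (induction I rule: finite_induct)
  case (insert i I)
  have "sum f (\<Union>i\<in>insert i I. A i) \<le> sum f (A i) + sum f (\<Union>i\<in>I. A i)"
    using insert assms(3) by (simp add: sum_Un sum_nonneg)
  then show ?case using insert by fastforce
qed simp

lemma sum_PiE_split:
  assumes "S \<subseteq> I"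
  shows "(\<Sum>w\<in>(\<Pi>\<^sub>E i\<in>I. if i \<in> S then A else B). g w) =
    (\<Sum>a\<in>S \<rightarrow>\<^sub>E A. \<Sum>b\<in>(I - S) \<rightarrow>\<^sub>E B. g (\<lambda>i. if i \<in> S then a i else b i))"
  unfolding sum.cartesian_product
proof (rule sum.reindex_bij_witness[of _ "\<lambda>(a, b) i. if i \<in> S then a i else b i"
      "\<lambda>w. (restrict w S, restrict w (I - S))"])
  fix w assume w: "w \<in> (\<Pi>\<^sub>E i\<in>I. if i \<in> S then A else B)"
  have merge: "(\<lambda>i. if i \<in> S then restrict w S i else restrict w (I - S) i) = w"
    using w assms by (auto simp: fun_eq_iff PiE_iff extensional_def)
  then show "(case (restrict w S, restrict w (I - S)) of (a, b) \<Rightarrow> \<lambda>i. if i \<in> S then a i else b i) = w"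
    by simp
  show "(restrict w S, restrict w (I - S)) \<in> (S \<rightarrow>\<^sub>E A) \<times> ((I - S) \<rightarrow>\<^sub>E B)"
    using w assms by (auto simp: PiE_iff extensional_def split: if_splits)
  show "(case (restrict w S, restrict w (I - S)) of (a, b) \<Rightarrow> g (\<lambda>i. if i \<in> S then a i else b i)) = g w"
    using merge by simp
qed (use assms in \<open>auto simp: fun_eq_iff PiE_iff extensional_def\<close>)

definition pair_energy :: "('v \<Rightarrow> 'v \<Rightarrow> real) \<Rightarrow> nat \<Rightarrow> (nat \<Rightarrow> 'v) \<Rightarrow> real" where
  "pair_energy D n w = (\<Sum>i<n. \<Sum>j<n. D (w i) (w j)) / 2"

definition flat :: "'v set \<Rightarrow> ('v \<Rightarrow> 'v \<Rightarrow> real) \<Rightarrow> 'v set \<Rightarrow> bool" where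
  "flat V D U \<longleftrightarrow> U \<subseteq> V \<and> (\<forall>u\<in>U. \<forall>v\<in>U. D u v = 0)"

locale energy_kernel =
  fixes V :: "'v set" and D :: "'v \<Rightarrow> 'v \<Rightarrow> real" and N :: nat
  assumes finite_V: "finite V" and N_pos: "N > 0"
    and D_nonneg: "u \<in> V \<Longrightarrow> v \<in> V \<Longrightarrow> 0 \<le> D u v"
    and D_le: "u \<in> V \<Longrightarrow> v \<in> V \<Longrightarrow> D u v \<le> 2"
    and D_sym: "D u v = D v u"
    and card_flat_le: "flat V D U \<Longrightarrow> card U \<le> N"
    and max_flat_balanced: "flat V D U \<Longrightarrow> card U = N \<Longrightarrow> v \<in> V - U \<Longrightarrow> (\<Sum>u\<in>U. D u v) = N"
begin

definition max_flats :: "'v set set" where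
  "max_flats = {U. flat V D U \<and> card U = N}"

definition stray_maps :: "nat \<Rightarrow> (nat \<Rightarrow> 'v) set" where
  "stray_maps n = {w \<in> {..<n} \<rightarrow>\<^sub>E V. \<nexists>U. U \<in> max_flats \<and> w ` {..<n} \<subseteq> U}"

definition gibbs :: "real \<Rightarrow> nat \<Rightarrow> (nat \<Rightarrow> 'v) \<Rightarrow> real" where
  "gibbs s n w = exp (- s * pair_energy D n w)"

definition maps_leaving :: "nat \<Rightarrow> 'v set \<Rightarrow> nat set \<Rightarrow> (nat \<Rightarrow> 'v) set" where
  "maps_leaving n U S = (\<Pi>\<^sub>E i\<in>{..<n}. if i \<in> S then V - U else U)"

definition heavy_values :: "real \<Rightarrow> nat \<Rightarrow> (nat \<Rightarrow> 'v) \<Rightarrow> 'v set" where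
  "heavy_values \<tau> n w = {v \<in> V. \<tau> * real n \<le> card {i\<in>{..<n}. w i = v}}"

definition conflict_maps :: "real \<Rightarrow> nat \<Rightarrow> (nat \<Rightarrow> 'v) set" where
  "conflict_maps \<tau> n = {w \<in> {..<n} \<rightarrow>\<^sub>E V. \<not> flat V D (heavy_values \<tau> n w)}"

lemma max_flatsD:
  assumes "U \<in> max_flats"
  shows "flat V D U" "U \<subseteq> V" "finite U" "card U = N"
proof -
  show "flat V D U" "card U = N" using assms by (simp_all add: max_flats_def)
  then show "U \<subseteq> V" by (simp add: flat_def)
  then show "finite U" by (rule finite_subset[OF _ finite_V])
qed

lemma finite_max_flats: "finite max_flats"
proof (rule finite_subset)
  show "max_flats \<subseteq> Pow V" using max_flatsD(2) by blast
qed (simp add: finite_V)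

lemma finite_maps: "finite ({..<n::nat} \<rightarrow>\<^sub>E V)"
  by (rule finite_PiE) (auto simp: finite_V)

lemma finite_stray_maps: "finite (stray_maps n)"
  by (rule finite_subset[OF _ finite_maps[of n]]) (auto simp: stray_maps_def)

lemma finite_conflict_maps: "finite (conflict_maps \<tau> n)"
  by (rule finite_subset[OF _ finite_maps[of n]]) (auto simp: conflict_maps_def)

lemma maps_leaving_subset: "U \<subseteq> V \<Longrightarrow> maps_leaving n U S \<subseteq> {..<n} \<rightarrow>\<^sub>E V"
  by (force simp: maps_leaving_def PiE_iff split: if_splits)

lemma finite_maps_leaving: "U \<subseteq> V \<Longrightarrow> finite (maps_leaving n U S)"
  by (rule finite_subset[OF maps_leaving_subset finite_maps])

lemma D_map_nonneg: "w \<in> {..<n} \<rightarrow>\<^sub>E V \<Longrightarrow> i < n \<Longrightarrow> j < n \<Longrightarrow> 0 \<le> D (w i) (w j)"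
  by (rule D_nonneg) auto

lemma pair_energy_nonneg: "w \<in> {..<n} \<rightarrow>\<^sub>E V \<Longrightarrow> pair_energy D n w \<ge> 0"
  by (auto simp: pair_energy_def intro!: sum_nonneg D_map_nonneg[of w n])

lemma gibbs_nonneg: "gibbs s n w \<ge> 0"
  by (simp add: gibbs_def)

lemma gibbs_le_1: "w \<in> {..<n} \<rightarrow>\<^sub>E V \<Longrightarrow> s \<ge> 0 \<Longrightarrow> gibbs s n w \<le> 1"
  by (simp add: gibbs_def pair_energy_nonneg)

lemma pair_energy_ge_cross:
  assumes w: "w \<in> {..<n} \<rightarrow>\<^sub>E V" and S: "S \<subseteq> {..<n}"
  shows "(\<Sum>j\<in>{..<n} - S. \<Sum>i\<in>S. D (w j) (w i)) \<le> pair_energy D n w"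
proof -
  let ?T = "{..<n} - S"
  have split: "(\<Sum>i<n. f i) = sum f S + sum f ?T" for f :: "nat \<Rightarrow> real"
    using S sum.subset_diff[of S "{..<n}" f] by simp
  have "(\<Sum>i<n. \<Sum>j<n. D (w i) (w j)) =
    (\<Sum>i\<in>S. \<Sum>j\<in>S. D (w i) (w j)) + (\<Sum>i\<in>S. \<Sum>j\<in>?T. D (w i) (w j)) +
    ((\<Sum>i\<in>?T. \<Sum>j\<in>S. D (w i) (w j)) + (\<Sum>i\<in>?T. \<Sum>j\<in>?T. D (w i) (w j)))"
    unfolding split by (simp add: sum.distrib)
  moreover have "(\<Sum>i\<in>S. \<Sum>j\<in>?T. D (w i) (w j)) = (\<Sum>i\<in>?T. \<Sum>j\<in>S. D (w i) (w j))"
    by (subst sum.swap) (intro sum.cong refl D_sym)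
  moreover have "(\<Sum>i\<in>S. \<Sum>j\<in>S. D (w i) (w j)) \<ge> 0" "(\<Sum>i\<in>?T. \<Sum>j\<in>?T. D (w i) (w j)) \<ge> 0"
    using D_map_nonneg[OF w] S by (auto intro!: sum_nonneg)
  ultimately show ?thesis by (simp add: pair_energy_def)
qed

lemma sum_exp_max_flat_le:
  fixes s :: real
  assumes U: "U \<in> max_flats" and a: "a \<in> S \<rightarrow> V - U" and s: "s \<ge> 0"
  shows "(\<Sum>t\<in>U. exp (- s * (\<Sum>i\<in>S. D t (a i)))) \<le> N * ((1 + exp (- (2 * s * card S))) / 2)"
proof -
  define x where "x = 2 * s * card S"
  define A where "A t = s * (\<Sum>i\<in>S. D t (a i))" for t
  have A: "0 \<le> A t" "A t \<le> x" if "t \<in> U" for t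
  proof -
    have "D t (a i) \<ge> 0" "D t (a i) \<le> 2" if "i \<in> S" for i
      using D_nonneg D_le max_flatsD(2)[OF U] \<open>t \<in> U\<close> a that by (auto simp: Pi_iff subset_iff)
    then have "(\<Sum>i\<in>S. D t (a i)) \<ge> 0" "(\<Sum>i\<in>S. D t (a i)) \<le> 2 * card S"
      using sum_mono[of S "\<lambda>i. D t (a i)" "\<lambda>_. 2"] by (auto intro!: sum_nonneg)
    then show "0 \<le> A t" "A t \<le> x"
      using s mult_left_mono[of "\<Sum>i\<in>S. D t (a i)" "2 * card S" s] by (auto simp: A_def x_def)
  qed
  have "(\<Sum>t\<in>U. A t) = s * (\<Sum>i\<in>S. \<Sum>t\<in>U. D t (a i))"
    unfolding A_def by (subst sum.swap) (simp add: sum_distrib_left)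
  also have "(\<Sum>i\<in>S. \<Sum>t\<in>U. D t (a i)) = (\<Sum>i\<in>S. real N)"
    using a max_flat_balanced max_flatsD[OF U] by (intro sum.cong) auto
  finally have sum_A: "(\<Sum>t\<in>U. A t) = N * x / 2" by (simp add: x_def)
  have "(\<Sum>t\<in>U. exp (- A t)) \<le> (\<Sum>t\<in>U. 1 - A t / x * (1 - exp (- x)))"
    using A by (intro sum_mono exp_minus_chord) auto
  also have "\<dots> = N - (\<Sum>t\<in>U. A t) / x * (1 - exp (- x))"
    by (simp add: sum_subtractf sum_distrib_right sum_divide_distrib max_flatsD[OF U])
  also have "\<dots> = N * ((1 + exp (- x)) / 2)"
    unfolding sum_A by (cases "x = 0") (simp_all add: field_simps)
  finally show ?thesis by (simp add: A_def x_def)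
qed

text \<open>Only the pairs with one element in \<open>S\<close> and one outside are kept: then the sum over the
  values outside \<open>S\<close> factorises.\<close>

lemma sum_leaving_max_flat_le:
  fixes s :: real
  assumes U: "U \<in> max_flats" and S: "S \<subseteq> {..<n}" and s: "s \<ge> 0"
  shows "(\<Sum>w\<in>maps_leaving n U S. gibbs s n w) \<le>
    real (card V) ^ card S * (N * ((1 + exp (- (2 * s * card S))) / 2)) ^ (n - card S)"
proof -
  let ?T = "{..<n} - S"
  let ?B = "(N * ((1 + exp (- (2 * s * card S))) / 2)) ^ (n - card S)"
  have finS: "finite S" using S finite_subset by blast
  have "(\<Sum>w\<in>maps_leaving n U S. gibbs s n w) \<le>
    (\<Sum>w\<in>maps_leaving n U S. \<Prod>j\<in>?T. exp (- s * (\<Sum>i\<in>S. D (w j) (w i))))"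
  proof (rule sum_mono)
    fix w assume "w \<in> maps_leaving n U S"
    then have w: "w \<in> {..<n} \<rightarrow>\<^sub>E V" using maps_leaving_subset[OF max_flatsD(2)[OF U]] by blast
    have "gibbs s n w \<le> exp (- s * (\<Sum>j\<in>?T. \<Sum>i\<in>S. D (w j) (w i)))"
      using mult_left_mono[OF pair_energy_ge_cross[OF w S] s] by (simp add: gibbs_def)
    then show "gibbs s n w \<le> (\<Prod>j\<in>?T. exp (- s * (\<Sum>i\<in>S. D (w j) (w i))))"
      by (simp add: exp_sum sum_distrib_left flip: sum_negf)
  qed
  also have "\<dots> = (\<Sum>a\<in>S \<rightarrow>\<^sub>E (V - U). \<Sum>b\<in>?T \<rightarrow>\<^sub>E U. \<Prod>j\<in>?T. exp (- s * (\<Sum>i\<in>S. D (b j) (a i))))"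
    unfolding maps_leaving_def by (subst sum_PiE_split[OF S]) (intro sum.cong refl prod.cong, auto)
  also have "\<dots> = (\<Sum>a\<in>S \<rightarrow>\<^sub>E (V - U). \<Prod>j\<in>?T. \<Sum>t\<in>U. exp (- s * (\<Sum>i\<in>S. D t (a i))))"
    using max_flatsD(3)[OF U] by (intro sum.cong refl prod_sum_PiE[symmetric]) auto
  also have "\<dots> = (\<Sum>a\<in>S \<rightarrow>\<^sub>E (V - U). (\<Sum>t\<in>U. exp (- s * (\<Sum>i\<in>S. D t (a i)))) ^ (n - card S))"
    using S finS by (simp add: card_Diff_subset)
  also have "\<dots> \<le> (\<Sum>a\<in>S \<rightarrow>\<^sub>E (V - U). ?B)"
    using U s by (intro sum_mono power_mono sum_exp_max_flat_le) (auto intro: sum_nonneg)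
  also have "\<dots> = real (card (V - U)) ^ card S * ?B" by (simp add: card_PiE finS)
  also have "\<dots> \<le> real (card V) ^ card S * ?B"
    by (intro mult_right_mono power_mono) (auto intro!: card_mono finite_V add_nonneg_nonneg)
  finally show ?thesis .
qed

lemma sum_leaving_small_le:
  assumes S: "S \<subseteq> {..<n}" and U: "U \<subseteq> V" "card U < N" and s: "s \<ge> 0"
  shows "(\<Sum>w\<in>maps_leaving n U S. gibbs s n w) \<le>
    real (card V) ^ card S * (real N - 1) ^ (n - card S)"
proof -
  have finS: "finite S" using S finite_subset by blast
  have "(\<Sum>w\<in>maps_leaving n U S. gibbs s n w) \<le> (\<Sum>w\<in>maps_leaving n U S. 1)"
    using maps_leaving_subset[OF U(1)] s by (intro sum_mono gibbs_le_1) auto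
  also have "\<dots> = real (card (V - U)) ^ card S * real (card U) ^ card ({..<n} - S)"
    unfolding maps_leaving_def by (subst sum_PiE_split[OF S]) (simp add: card_PiE finS)
  also have "\<dots> = real (card (V - U)) ^ card S * real (card U) ^ (n - card S)"
    using S finS by (simp add: card_Diff_subset)
  also have "\<dots> \<le> real (card V) ^ card S * (real N - 1) ^ (n - card S)"
    using U finite_V by (intro mult_mono power_mono) (auto intro!: card_mono)
  finally show ?thesis .
qed

lemma exists_positive_lower_bound: "\<exists>\<delta>>0. \<forall>u\<in>V. \<forall>v\<in>V. D u v \<noteq> 0 \<longrightarrow> \<delta> \<le> D u v"
proof -
  define X where "X = insert 1 {x \<in> (\<lambda>(u, v). D u v) ` (V \<times> V). x \<noteq> 0}"
  have X: "finite X" "X \<noteq> {}" using finite_V by (auto simp: X_def)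
  have "x > 0" if "x \<in> X" for x using that D_nonneg by (force simp: X_def less_le)
  then have "Min X > 0" using X by simp
  moreover have "Min X \<le> D u v" if "u \<in> V" "v \<in> V" "D u v \<noteq> 0" for u v
    using X that by (intro Min_le) (auto simp: X_def)
  ultimately show ?thesis by blast
qed

lemma pair_energy_ge_two_values:
  assumes w: "w \<in> {..<n} \<rightarrow>\<^sub>E V"
  shows "real (card {i\<in>{..<n}. w i = u}) * real (card {i\<in>{..<n}. w i = v}) * D u v / 2 \<le> pair_energy D n w"
proof -
  have "real (card {i\<in>{..<n}. w i = u}) * real (card {i\<in>{..<n}. w i = v}) * D u v =
    (\<Sum>i\<in>{i\<in>{..<n}. w i = u}. \<Sum>j\<in>{i\<in>{..<n}. w i = v}. D (w i) (w j))"
    by simp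
  also have "\<dots> \<le> (\<Sum>i\<in>{i\<in>{..<n}. w i = u}. \<Sum>j<n. D (w i) (w j))"
    using D_map_nonneg[OF w] by (intro sum_mono sum_mono2) auto
  also have "\<dots> \<le> (\<Sum>i<n. \<Sum>j<n. D (w i) (w j))"
    using D_map_nonneg[OF w] by (intro sum_mono2) (auto intro!: sum_nonneg)
  finally show ?thesis by (simp add: pair_energy_def)
qed

lemma pair_energy_ge_conflict:
  assumes \<delta>: "\<delta> \<ge> 0" "\<forall>u\<in>V. \<forall>v\<in>V. D u v \<noteq> 0 \<longrightarrow> \<delta> \<le> D u v" and \<tau>: "\<tau> \<ge> 0"
    and w: "w \<in> conflict_maps \<tau> n"
  shows "(\<tau> * n)\<^sup>2 * \<delta> / 2 \<le> pair_energy D n w"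
proof -
  have wV: "w \<in> {..<n} \<rightarrow>\<^sub>E V" using w by (simp add: conflict_maps_def)
  obtain u v where uv: "u \<in> heavy_values \<tau> n w" "v \<in> heavy_values \<tau> n w" "D u v \<noteq> 0"
    using w by (auto simp: conflict_maps_def flat_def heavy_values_def)
  have "(\<tau> * n)\<^sup>2 * \<delta> / 2 = (\<tau> * n) * (\<tau> * n) * \<delta> / 2" by (simp add: power2_eq_square)
  also have "\<dots> \<le> real (card {i\<in>{..<n}. w i = u}) * real (card {i\<in>{..<n}. w i = v}) * D u v / 2"
    using uv \<delta> \<tau> by (intro divide_right_mono mult_mono) (auto simp: heavy_values_def)
  also have "\<dots> \<le> pair_energy D n w" by (rule pair_energy_ge_two_values[OF wV])
  finally show ?thesis .
qed

lemma sum_conflict_maps_tendsto: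
  assumes c_pos: "c > 0" and \<tau>: "\<tau> > 0"
  shows "(\<lambda>n. (\<Sum>w\<in>conflict_maps \<tau> n. gibbs (c * ln n / n) n w) / real N ^ n) \<longlonglongrightarrow> 0"
proof -
  obtain \<delta> where \<delta>: "\<delta> > 0" "\<forall>u\<in>V. \<forall>v\<in>V. D u v \<noteq> 0 \<longrightarrow> \<delta> \<le> D u v"
    using exists_positive_lower_bound by blast
  define \<kappa> where "\<kappa> = c * \<tau>\<^sup>2 * \<delta> / 2"
  have \<kappa>: "\<kappa> > 0" using c_pos \<tau> \<delta> by (simp add: \<kappa>_def)
  have bound: "(\<Sum>w\<in>conflict_maps \<tau> n. gibbs (c * ln n / n) n w) / real N ^ n \<le>
      real (card V) ^ n * exp (- \<kappa> * n * ln n)" if n: "n \<ge> 1" for n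
  proof -
    have "gibbs (c * ln n / n) n w \<le> exp (- \<kappa> * n * ln n)" if "w \<in> conflict_maps \<tau> n" for w
    proof -
      have "c * ln n / n * ((\<tau> * n)\<^sup>2 * \<delta> / 2) \<le> c * ln n / n * pair_energy D n w"
        using pair_energy_ge_conflict[OF _ \<delta>(2) _ that] \<delta>(1) \<tau> c_pos n by (intro mult_left_mono) auto
      moreover have "c * ln n / n * ((\<tau> * n)\<^sup>2 * \<delta> / 2) = \<kappa> * n * ln n"
        using n by (simp add: \<kappa>_def power2_eq_square)
      ultimately show ?thesis by (simp add: gibbs_def)
    qed
    moreover have "1 \<le> real N ^ n" using N_pos by (intro one_le_power) simp
    ultimately have "(\<Sum>w\<in>conflict_maps \<tau> n. gibbs (c * ln n / n) n w) / real N ^ n \<le>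
        (\<Sum>w\<in>conflict_maps \<tau> n. exp (- \<kappa> * n * ln n)) / 1"
      by (intro frac_le sum_mono sum_nonneg) auto
    also have "\<dots> \<le> (\<Sum>w\<in>{..<n} \<rightarrow>\<^sub>E V. exp (- \<kappa> * n * ln n))"
      unfolding div_by_1 by (rule sum_mono2[OF finite_maps]) (auto simp: conflict_maps_def)
    also have "\<dots> = real (card V) ^ n * exp (- \<kappa> * n * ln n)"
      by (simp add: card_PiE)
    finally show ?thesis .
  qed
  show ?thesis
  proof (rule tendsto_sandwich[OF _ _ tendsto_const])
    show "(\<lambda>n. real (card V) ^ n * exp (- \<kappa> * n * ln n)) \<longlonglongrightarrow> 0"
      by (rule power_exp_neg_n_ln_n_tendsto[OF _ \<kappa>]) simp
    show "\<forall>\<^sub>F n in sequentially. (\<Sum>w\<in>conflict_maps \<tau> n. gibbs (c * ln n / n) n w) / real N ^ n \<le>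
      real (card V) ^ n * exp (- \<kappa> * n * ln n)"
      using eventually_ge_at_top[of 1] by eventually_elim (rule bound)
  qed (auto intro!: always_eventually divide_nonneg_nonneg sum_nonneg gibbs_nonneg)
qed

lemma card_light_positions_le:
  fixes \<tau> :: real
  assumes "w \<in> {..<n} \<rightarrow>\<^sub>E V"
  shows "real (card {i\<in>{..<n}. w i \<notin> heavy_values \<tau> n w}) \<le> card (V - heavy_values \<tau> n w) * (\<tau> * n)"
proof -
  let ?L = "V - heavy_values \<tau> n w"
  have "{i\<in>{..<n}. w i \<notin> heavy_values \<tau> n w} \<subseteq> (\<Union>v\<in>?L. {i\<in>{..<n}. w i = v})"
    using PiE_mem[OF assms] by blast
  then have "card {i\<in>{..<n}. w i \<notin> heavy_values \<tau> n w} \<le> card (\<Union>v\<in>?L. {i\<in>{..<n}. w i = v})"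
    using finite_V by (intro card_mono) auto
  also have "\<dots> \<le> (\<Sum>v\<in>?L. card {i\<in>{..<n}. w i = v})"
    using finite_V by (intro card_UN_le) auto
  finally have "real (card {i\<in>{..<n}. w i \<notin> heavy_values \<tau> n w}) \<le>
      real (\<Sum>v\<in>?L. card {i\<in>{..<n}. w i = v})"
    by (rule of_nat_mono)
  also have "\<dots> = (\<Sum>v\<in>?L. real (card {i\<in>{..<n}. w i = v}))" by (rule of_nat_sum)
  also have "\<dots> \<le> (\<Sum>v\<in>?L. \<tau> * n)"
    by (intro sum_mono) (auto simp: heavy_values_def)
  also have "\<dots> = card ?L * (\<tau> * n)" by simp
  finally show ?thesis .
qed

lemma light_positions_in_small_subsets:
  fixes \<tau> \<epsilon> :: real
  assumes w: "w \<in> {..<n} \<rightarrow>\<^sub>E V" and \<tau>: "\<tau> \<ge> 0" "card V * \<tau> \<le> \<epsilon>"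
  shows "{i\<in>{..<n}. w i \<notin> heavy_values \<tau> n w} \<in> small_subsets \<epsilon> n"
proof -
  have "real (card {i\<in>{..<n}. w i \<notin> heavy_values \<tau> n w}) \<le> card (V - heavy_values \<tau> n w) * (\<tau> * n)"
    by (rule card_light_positions_le[OF w])
  also have "\<dots> \<le> card V * (\<tau> * n)"
    using \<tau> by (intro mult_right_mono) (auto intro!: card_mono finite_V)
  also have "\<dots> \<le> \<epsilon> * n" using mult_right_mono[OF \<tau>(2), of n] by (simp add: mult_ac)
  finally show ?thesis by (auto simp: small_subsets_def)
qed

text \<open>The values that a map takes at a positive proportion of the positions may conflict, be fewer than \<open>N\<close>,
  or form a maximal flat, which a stray map has to leave at a few positions.\<close>

lemma stray_maps_cover:
  fixes \<tau> \<epsilon> :: real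
  assumes \<tau>: "\<tau> \<ge> 0" "card V * \<tau> \<le> \<epsilon>"
  shows "stray_maps n \<subseteq> conflict_maps \<tau> n \<union>
    (\<Union>U\<in>{U. U \<subseteq> V \<and> card U < N}. \<Union>S\<in>small_subsets \<epsilon> n. maps_leaving n U S) \<union>
    (\<Union>U\<in>max_flats. \<Union>S\<in>small_subsets \<epsilon> n - {{}}. maps_leaving n U S)"
proof
  fix w assume w: "w \<in> stray_maps n"
  then have wV: "w \<in> {..<n} \<rightarrow>\<^sub>E V" by (auto simp: stray_maps_def)
  define U where "U = heavy_values \<tau> n w"
  define S where "S = {i\<in>{..<n}. w i \<notin> U}"
  have U_subset: "U \<subseteq> V" by (auto simp: U_def heavy_values_def)
  have S: "S \<in> small_subsets \<epsilon> n"
    unfolding S_def U_def by (rule light_positions_in_small_subsets[OF wV \<tau>])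
  have leaving: "w \<in> maps_leaving n U S" using wV by (auto simp: maps_leaving_def S_def PiE_iff)
  consider "\<not> flat V D U" | "card U < N" | "flat V D U" "card U = N"
    using card_flat_le[of U] by linarith
  then show "w \<in> conflict_maps \<tau> n \<union>
    (\<Union>U\<in>{U. U \<subseteq> V \<and> card U < N}. \<Union>S\<in>small_subsets \<epsilon> n. maps_leaving n U S) \<union>
    (\<Union>U\<in>max_flats. \<Union>S\<in>small_subsets \<epsilon> n - {{}}. maps_leaving n U S)"
  proof cases
    assume "\<not> flat V D U"
    then show ?thesis using wV by (simp add: conflict_maps_def U_def)
  next
    assume "card U < N"
    then show ?thesis using U_subset S leaving by blast
  next
    assume "flat V D U" "card U = N"
    then have U: "U \<in> max_flats" by (simp add: max_flats_def)
    have "S \<noteq> {}"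
    proof
      assume "S = {}"
      then have "w ` {..<n} \<subseteq> U" by (auto simp: S_def)
      then show False using w U by (auto simp: stray_maps_def)
    qed
    then show ?thesis using U S leaving by blast
  qed
qed

lemma sum_small_subsets_leaving_small_le:
  fixes \<rho> :: real
  assumes c_nonneg: "c \<ge> 0" and U: "U \<subseteq> V" "card U < N" and n: "n \<ge> 1"
    and \<rho>: "\<rho> > 0" "real N - 1 \<le> N * \<rho>"
  shows "(\<Sum>S\<in>small_subsets \<epsilon> n. \<Sum>w\<in>maps_leaving n U S. gibbs (c * ln n / n) n w) / real N ^ n \<le>
    (\<Sum>S\<in>small_subsets \<epsilon> n. (card V / (N * \<rho>)) ^ card S) * \<rho> ^ n"
proof -
  let ?M = "card V / (N * \<rho>)"
  have "(\<Sum>w\<in>maps_leaving n U S. gibbs (c * ln n / n) n w) \<le> ?M ^ card S * (N * \<rho>) ^ n"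
    if S: "S \<in> small_subsets \<epsilon> n" for S
  proof -
    have S_bounds: "S \<subseteq> {..<n}" "card S \<le> n"
      using S card_mono[of "{..<n}" S] by (auto simp: small_subsets_def)
    have "(\<Sum>w\<in>maps_leaving n U S. gibbs (c * ln n / n) n w) \<le>
        real (card V) ^ card S * (real N - 1) ^ (n - card S)"
      using c_nonneg n by (intro sum_leaving_small_le S_bounds U) auto
    also have "\<dots> \<le> real (card V) ^ card S * (N * \<rho>) ^ (n - card S)"
      using \<rho> N_pos by (intro mult_left_mono power_mono) auto
    also have "\<dots> = ?M ^ card S * (N * \<rho>) ^ n"
      using \<rho> N_pos S_bounds by (simp add: power_divide power_diff)
    finally show ?thesis .
  qed
  then have "(\<Sum>S\<in>small_subsets \<epsilon> n. \<Sum>w\<in>maps_leaving n U S. gibbs (c * ln n / n) n w) / real N ^ n \<le>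
      (\<Sum>S\<in>small_subsets \<epsilon> n. ?M ^ card S * (N * \<rho>) ^ n) / real N ^ n"
    by (intro divide_right_mono sum_mono) auto
  also have "\<dots> = (\<Sum>S\<in>small_subsets \<epsilon> n. ?M ^ card S) * \<rho> ^ n"
    using N_pos by (simp add: power_mult_distrib flip: sum_distrib_right)
  finally show ?thesis .
qed

lemma sum_leaving_small_tendsto:
  assumes c_pos: "c > 0" and U: "U \<subseteq> V" "card U < N"
  shows "\<forall>\<^sub>F \<epsilon> in at_right 0.
    (\<lambda>n. (\<Sum>S\<in>small_subsets \<epsilon> n. \<Sum>w\<in>maps_leaving n U S. gibbs (c * ln n / n) n w) / real N ^ n) \<longlonglongrightarrow> 0"
proof -
  define \<rho> where "\<rho> = max (1 / 2) ((real N - 1) / N)"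
  have \<rho>: "\<rho> > 0" "\<rho> < 1" "real N - 1 \<le> N * \<rho>"
    using N_pos by (auto simp: \<rho>_def max_def field_simps)
  have M_nonneg: "card V / (N * \<rho>) \<ge> 0" using \<rho> by simp
  show ?thesis
    using sum_small_subsets_tendsto[OF M_nonneg less_imp_le[OF \<rho>(1)] \<rho>(2)]
  proof eventually_elim
    case (elim \<epsilon>)
    show ?case
    proof (rule tendsto_sandwich[OF _ _ tendsto_const elim])
      show "\<forall>\<^sub>F n in sequentially. (\<Sum>S\<in>small_subsets \<epsilon> n. \<Sum>w\<in>maps_leaving n U S.
          gibbs (c * ln n / n) n w) / real N ^ n \<le> (\<Sum>S\<in>small_subsets \<epsilon> n. (card V / (N * \<rho>)) ^ card S) * \<rho> ^ n"
        using eventually_ge_at_top[of 1]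
        by eventually_elim (rule sum_small_subsets_leaving_small_le[OF less_imp_le[OF c_pos] U _ \<rho>(1,3)])
    qed (auto intro!: always_eventually divide_nonneg_nonneg sum_nonneg gibbs_nonneg)
  qed
qed

text \<open>The first term covers the \<open>S\<close> with at most about \<open>n / ln n\<close> elements; for larger \<open>S\<close> every position
  outside \<open>S\<close> contributes a factor bounded away from \<open>1\<close>.\<close>

lemma sum_leaving_max_flat_le_powr:
  fixes \<rho> \<gamma> :: real
  assumes U: "U \<in> max_flats" and n: "n \<ge> 1" and c_nonneg: "c \<ge> 0"
    and S: "S \<subseteq> {..<n}" "card S \<le> (1 - \<gamma>) * n"
    and \<gamma>: "\<gamma> \<ge> 0" and \<rho>: "(1 + exp (- (1 - \<gamma>))) / 2 \<le> \<rho>"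
  shows "(\<Sum>w\<in>maps_leaving n U S. gibbs (c * ln n / n) n w) \<le>
    real N ^ n * ((card V * n powr - (c * \<gamma>\<^sup>2)) ^ card S + (card V / (N * \<rho>)) ^ card S * \<rho> ^ n)"
proof -
  define k where "k = card S"
  define x where "x = 2 * (c * ln n / n) * k"
  have k_le_n: "k \<le> n" using S card_mono[of "{..<n}" S] by (simp add: k_def)
  have "0 < (1 + exp (- (1 - \<gamma>))) / 2" by (simp add: add_pos_pos)
  then have \<rho>_pos: "\<rho> > 0" using \<rho> by (rule less_le_trans)
  have half_nonneg: "(1 + exp (- x)) / 2 \<ge> 0" by (simp add: add_nonneg_nonneg)
  have "(\<Sum>w\<in>maps_leaving n U S. gibbs (c * ln n / n) n w) \<le>
      real (card V) ^ k * (N * ((1 + exp (- x)) / 2)) ^ (n - k)"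
    unfolding k_def x_def using U S n c_nonneg by (intro sum_leaving_max_flat_le) auto
  also have "\<dots> \<le> real N ^ n * ((card V * n powr - (c * \<gamma>\<^sup>2)) ^ k + (card V / (N * \<rho>)) ^ k * \<rho> ^ n)"
  proof (cases "x \<le> 1 - \<gamma>")
    case True
    have "real (card V) ^ k * (N * ((1 + exp (- x)) / 2)) ^ (n - k) =
        real N ^ (n - k) * (real (card V) ^ k * ((1 + exp (- x)) / 2) ^ (n - k))"
      by (simp only: power_mult_distrib mult_ac)
    also have "\<dots> \<le> real N ^ n * (real (card V) ^ k * (n powr - (c * \<gamma>\<^sup>2)) ^ k)"
      using half_one_plus_exp_power_le[OF n c_nonneg \<gamma> S(2)] True N_pos half_nonneg
      by (intro mult_mono mult_left_mono power_increasing) (auto simp: x_def k_def)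
    finally show ?thesis using \<rho>_pos by (simp add: power_mult_distrib distrib_left add_increasing2)
  next
    case False
    then have "(1 + exp (- x)) / 2 \<le> (1 + exp (- (1 - \<gamma>))) / 2" by simp
    then have "(1 + exp (- x)) / 2 \<le> \<rho>" using \<rho> by (rule order.trans)
    then have "real (card V) ^ k * (N * ((1 + exp (- x)) / 2)) ^ (n - k) \<le>
        real (card V) ^ k * (N * \<rho>) ^ (n - k)"
      using half_nonneg by (intro mult_left_mono power_mono) auto
    also have "\<dots> = real N ^ n * ((card V / (N * \<rho>)) ^ k * \<rho> ^ n)"
      using \<rho>_pos N_pos k_le_n by (simp add: power_divide power_diff power_mult_distrib)
    finally show ?thesis by (simp add: distrib_left add_increasing)
  qed
  finally show ?thesis by (simp add: k_def)
qed

lemma sum_small_subsets_leaving_max_flat_le: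
  fixes \<gamma> \<rho> :: real
  assumes c_nonneg: "c \<ge> 0" and U: "U \<in> max_flats" and n: "n \<ge> 1" and \<epsilon>: "\<epsilon> \<le> 1 - \<gamma>"
    and \<gamma>: "\<gamma> \<ge> 0" and \<rho>: "\<rho> > 0" "(1 + exp (- (1 - \<gamma>))) / 2 \<le> \<rho>"
  shows "(\<Sum>S\<in>small_subsets \<epsilon> n - {{}}. \<Sum>w\<in>maps_leaving n U S. gibbs (c * ln n / n) n w) / real N ^ n \<le>
    ((1 + card V * n powr - (c * \<gamma>\<^sup>2)) ^ n - 1) + (\<Sum>S\<in>small_subsets \<epsilon> n. (card V / (N * \<rho>)) ^ card S) * \<rho> ^ n"
proof -
  let ?y = "card V * n powr - (c * \<gamma>\<^sup>2)" and ?M = "card V / (N * \<rho>)"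
  have "(\<Sum>w\<in>maps_leaving n U S. gibbs (c * ln n / n) n w) \<le> real N ^ n * (?y ^ card S + ?M ^ card S * \<rho> ^ n)"
    if S: "S \<in> small_subsets \<epsilon> n" for S
  proof -
    have "card S \<le> (1 - \<gamma>) * n"
      using S mult_right_mono[OF \<epsilon>, of n] by (simp add: small_subsets_def)
    then show ?thesis
      using S by (intro sum_leaving_max_flat_le_powr U n c_nonneg \<gamma> \<rho>) (auto simp: small_subsets_def)
  qed
  then have "(\<Sum>S\<in>small_subsets \<epsilon> n - {{}}. \<Sum>w\<in>maps_leaving n U S. gibbs (c * ln n / n) n w) / real N ^ n \<le>
      (\<Sum>S\<in>small_subsets \<epsilon> n - {{}}. real N ^ n * (?y ^ card S + ?M ^ card S * \<rho> ^ n)) / real N ^ n"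
    by (intro divide_right_mono sum_mono) auto
  also have "\<dots> = (\<Sum>S\<in>small_subsets \<epsilon> n - {{}}. ?y ^ card S) +
      (\<Sum>S\<in>small_subsets \<epsilon> n - {{}}. ?M ^ card S * \<rho> ^ n)"
    using N_pos by (simp add: sum.distrib flip: sum_distrib_left)
  also have "\<dots> \<le> ((1 + ?y) ^ n - 1) + (\<Sum>S\<in>small_subsets \<epsilon> n. ?M ^ card S * \<rho> ^ n)"
    using \<rho>(1) by (intro add_mono sum_small_subsets_nonempty_le sum_mono2 finite_small_subsets) auto
  finally show ?thesis by (simp add: sum_distrib_right)
qed

lemma sum_leaving_max_flat_tendsto:
  assumes c_gt_1: "c > 1" and U: "U \<in> max_flats"
  shows "\<forall>\<^sub>F \<epsilon> in at_right 0.
    (\<lambda>n. (\<Sum>S\<in>small_subsets \<epsilon> n - {{}}. \<Sum>w\<in>maps_leaving n U S. gibbs (c * ln n / n) n w) / real N ^ n)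
      \<longlonglongrightarrow> 0"
proof -
  define \<gamma> where "\<gamma> = sqrt ((1 + 1 / c) / 2)"
  have \<gamma>: "0 \<le> \<gamma>" "\<gamma> < 1" "c * \<gamma>\<^sup>2 > 1"
    using c_gt_1 by (auto simp: \<gamma>_def field_simps)
  define \<rho> where "\<rho> = (1 + exp (- (1 - \<gamma>))) / 2"
  have \<rho>: "0 < \<rho>" "\<rho> < 1" using \<gamma> by (auto simp: \<rho>_def add_pos_pos)
  have M_nonneg: "card V / (N * \<rho>) \<ge> 0" using \<rho> by simp
  have "\<forall>\<^sub>F \<epsilon>::real in at_right 0. \<epsilon> \<le> 1 - \<gamma>"
    using \<gamma> by (auto simp: eventually_at_right_field intro!: exI[of _ "1 - \<gamma>"])
  then show ?thesis
    using sum_small_subsets_tendsto[OF M_nonneg less_imp_le[OF \<rho>(1)] \<rho>(2)]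
  proof eventually_elim
    case (elim \<epsilon>)
    let ?bound = "\<lambda>n. ((1 + card V * real n powr - (c * \<gamma>\<^sup>2)) ^ n - 1) +
      (\<Sum>S\<in>small_subsets \<epsilon> n. (card V / (N * \<rho>)) ^ card S) * \<rho> ^ n"
    have "?bound \<longlonglongrightarrow> (1 - 1) + 0"
      by (intro tendsto_intros one_plus_powr_power_tendsto \<gamma> elim(2))
    then have limit: "?bound \<longlonglongrightarrow> 0" by simp
    show ?case
    proof (rule tendsto_sandwich[OF _ _ tendsto_const limit])
      show "\<forall>\<^sub>F n in sequentially. (\<Sum>S\<in>small_subsets \<epsilon> n - {{}}. \<Sum>w\<in>maps_leaving n U S.
          gibbs (c * ln n / n) n w) / real N ^ n \<le> ?bound n"
        using eventually_ge_at_top[of 1]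
      proof eventually_elim
        case (elim n)
        then show ?case
          using c_gt_1 \<open>\<epsilon> \<le> 1 - \<gamma>\<close> U \<gamma>(1) \<rho>(1)
          by (intro sum_small_subsets_leaving_max_flat_le) (auto simp: \<rho>_def)
      qed
    qed (auto intro!: always_eventually divide_nonneg_nonneg sum_nonneg gibbs_nonneg)
  qed
qed

lemma sum_stray_maps_le:
  fixes \<tau> \<epsilon> :: real
  assumes "\<tau> \<ge> 0" "card V * \<tau> \<le> \<epsilon>"
  shows "(\<Sum>w\<in>stray_maps n. gibbs s n w) \<le> (\<Sum>w\<in>conflict_maps \<tau> n. gibbs s n w) +
    (\<Sum>U\<in>{U. U \<subseteq> V \<and> card U < N}. \<Sum>S\<in>small_subsets \<epsilon> n. \<Sum>w\<in>maps_leaving n U S. gibbs s n w) +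
    (\<Sum>U\<in>max_flats. \<Sum>S\<in>small_subsets \<epsilon> n - {{}}. \<Sum>w\<in>maps_leaving n U S. gibbs s n w)"
proof -
  let ?f = "gibbs s n"
  let ?B = "\<Union>U\<in>{U. U \<subseteq> V \<and> card U < N}. \<Union>S\<in>small_subsets \<epsilon> n. maps_leaving n U S"
  let ?C = "\<Union>U\<in>max_flats. \<Union>S\<in>small_subsets \<epsilon> n - {{}}. maps_leaving n U S"
  have finU: "finite {U. U \<subseteq> V \<and> card U < N}"
    by (rule finite_subset[of _ "Pow V"]) (auto simp: finite_V)
  have finB: "finite ?B" using finU finite_small_subsets finite_maps_leaving by auto
  have finC: "finite ?C"
    using finite_max_flats finite_small_subsets finite_maps_leaving max_flatsD(2) by auto
  have union: "sum ?f (A \<union> B) \<le> sum ?f A + sum ?f B" if "finite A" "finite B" for A B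
    using that gibbs_nonneg by (simp add: sum_Un sum_nonneg)
  have "sum ?f (stray_maps n) \<le> sum ?f (conflict_maps \<tau> n \<union> ?B \<union> ?C)"
    using finite_conflict_maps finB finC gibbs_nonneg
    by (intro sum_mono2 stray_maps_cover[OF assms]) auto
  also have "\<dots> \<le> sum ?f (conflict_maps \<tau> n) + sum ?f ?B + sum ?f ?C"
    using finite_conflict_maps finB finC
    by (intro order.trans[OF union] add_right_mono union) auto
  also have "sum ?f ?B \<le> (\<Sum>U\<in>{U. U \<subseteq> V \<and> card U < N}. \<Sum>S\<in>small_subsets \<epsilon> n. sum ?f (maps_leaving n U S))"
    using finU finite_small_subsets finite_maps_leaving gibbs_nonneg
    by (intro order.trans[OF sum_UN_le] sum_mono sum_UN_le) auto
  also have "sum ?f ?C \<le> (\<Sum>U\<in>max_flats. \<Sum>S\<in>small_subsets \<epsilon> n - {{}}. sum ?f (maps_leaving n U S))"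
    using finite_max_flats finite_small_subsets finite_maps_leaving max_flatsD(2) gibbs_nonneg
    by (intro order.trans[OF sum_UN_le] sum_mono sum_UN_le) auto
  finally show ?thesis by simp
qed

theorem sum_stray_maps_tendsto:
  assumes c_gt_1: "c > 1"
  shows "(\<lambda>n. (\<Sum>w\<in>stray_maps n. gibbs (c * ln n / n) n w) / real N ^ n) \<longlonglongrightarrow> 0"
proof -
  let ?small = "{U. U \<subseteq> V \<and> card U < N}" and ?g = "\<lambda>n. gibbs (c * ln (real n) / real n) n"
  let ?B = "\<lambda>\<epsilon> U n. (\<Sum>S\<in>small_subsets \<epsilon> n. sum (?g n) (maps_leaving n U S)) / real N ^ n"
  let ?C = "\<lambda>\<epsilon> U n. (\<Sum>S\<in>small_subsets \<epsilon> n - {{}}. sum (?g n) (maps_leaving n U S)) / real N ^ n"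
  have finU: "finite ?small" by (rule finite_subset[of _ "Pow V"]) (auto simp: finite_V)
  have "\<forall>\<^sub>F \<epsilon> in at_right 0. \<forall>U\<in>?small. ?B \<epsilon> U \<longlonglongrightarrow> 0"
    using sum_leaving_small_tendsto c_gt_1 by (intro eventually_ball_finite finU) auto
  moreover have "\<forall>\<^sub>F \<epsilon> in at_right 0. \<forall>U\<in>max_flats. ?C \<epsilon> U \<longlonglongrightarrow> 0"
    using sum_leaving_max_flat_tendsto c_gt_1 by (intro eventually_ball_finite finite_max_flats) auto
  moreover have "\<forall>\<^sub>F \<epsilon> in at_right (0::real). \<epsilon> > 0" by (rule eventually_at_right_less)
  ultimately have "\<forall>\<^sub>F \<epsilon> in at_right 0. \<epsilon> > 0 \<and> (\<forall>U\<in>?small. ?B \<epsilon> U \<longlonglongrightarrow> 0) \<and> (\<forall>U\<in>max_flats. ?C \<epsilon> U \<longlonglongrightarrow> 0)"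
    by eventually_elim blast
  then obtain \<epsilon> where \<epsilon>: "\<epsilon> > 0" "\<And>U. U \<in> ?small \<Longrightarrow> ?B \<epsilon> U \<longlonglongrightarrow> 0"
    "\<And>U. U \<in> max_flats \<Longrightarrow> ?C \<epsilon> U \<longlonglongrightarrow> 0"
    using eventually_happens'[of "at_right (0::real)"] by force
  define \<tau> where "\<tau> = \<epsilon> / (card V + 1)"
  have \<tau>: "\<tau> > 0" "card V * \<tau> \<le> \<epsilon>" using \<epsilon>(1) by (auto simp: \<tau>_def field_simps)
  let ?bound = "\<lambda>n. sum (?g n) (conflict_maps \<tau> n) / real N ^ n +
    (\<Sum>U\<in>?small. ?B \<epsilon> U n) + (\<Sum>U\<in>max_flats. ?C \<epsilon> U n)"
  have "?bound \<longlonglongrightarrow> 0 + (\<Sum>U\<in>?small. 0) + (\<Sum>U\<in>max_flats. 0)"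
    using sum_conflict_maps_tendsto[of c \<tau>] c_gt_1 \<tau>(1) by (intro tendsto_add tendsto_sum \<epsilon>) auto
  then have limit: "?bound \<longlonglongrightarrow> 0" by simp
  have "sum (?g n) (stray_maps n) / real N ^ n \<le> ?bound n" for n
  proof -
    have "sum (?g n) (stray_maps n) / real N ^ n \<le> (sum (?g n) (conflict_maps \<tau> n) +
        (\<Sum>U\<in>?small. \<Sum>S\<in>small_subsets \<epsilon> n. sum (?g n) (maps_leaving n U S)) +
        (\<Sum>U\<in>max_flats. \<Sum>S\<in>small_subsets \<epsilon> n - {{}}. sum (?g n) (maps_leaving n U S))) / real N ^ n"
      using \<tau> by (intro divide_right_mono sum_stray_maps_le) auto
    then show ?thesis by (simp add: add_divide_distrib sum_divide_distrib)
  qed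
  then show ?thesis
    by (intro tendsto_sandwich[OF _ _ tendsto_const limit] always_eventually allI)
       (auto intro!: divide_nonneg_nonneg sum_nonneg gibbs_nonneg)
qed

end

section \<open>Cokernels of integer matrices\<close>

abbreviation Zn :: "nat \<Rightarrow> int vec monoid" where "Zn m \<equiv> monoid_vec TYPE(int) m"

lemma comm_group_Zn: "comm_group (Zn m)" by (rule comm_group_vec)

lemma group_Zn: "group (Zn m)"
  using comm_group_Zn by (simp add: comm_group_def)

lemma int_pow_Zn:
  assumes v: "v \<in> carrier_vec m"
  shows "v [^]\<^bsub>Zn m\<^esub> (k::int) = k \<cdot>\<^sub>v v"
proof -
  interpret group_hom integer_group "Zn m" "\<lambda>k. k \<cdot>\<^sub>v v"
    using v by (simp add: group_homI group_Zn hom_def monoid_vec_simps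
        add_smult_distrib_vec)
  show ?thesis using hom_int_pow[of 1 k] v by simp
qed

lemma generate_unit_vecs: "generate (Zn m) (unit_vec m ` {..<m}) = carrier_vec m"
proof -
  interpret comm_group "Zn m" by (rule comm_group_Zn)
  let ?S = "generate (Zn m) (unit_vec m ` {..<m})"
  have S: "subgroup ?S (Zn m)" by (rule generate_is_subgroup) (auto simp: monoid_vec_simps)
  have "v \<in> ?S" if v: "v \<in> carrier_vec m" for v
  proof -
    let ?v = "\<lambda>k. vec m (\<lambda>i. if i < k then v $ i else 0)"
    have "?v k \<in> ?S" if "k \<le> m" for k
      using that
    proof (induction k)
      case 0
      have "?v 0 = \<one>\<^bsub>Zn m\<^esub>" by (auto simp: monoid_vec_simps)
      then show ?case using subgroup.one_closed[OF S] by metis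
    next
      case (Suc k)
      have "?v (Suc k) = ?v k \<otimes>\<^bsub>Zn m\<^esub> ((v $ k) \<cdot>\<^sub>v unit_vec m k)"
        using Suc by (auto simp: monoid_vec_simps less_Suc_eq)
      moreover have "(v $ k) \<cdot>\<^sub>v unit_vec m k \<in> ?S"
        using subgroup_int_pow_closed[OF S generate.incl, of "unit_vec m k" "v $ k"] Suc.prems
        by (simp add: int_pow_Zn)
      ultimately show ?case using Suc subgroup.m_closed[OF S] by simp
    qed
    moreover have "?v m = v" using v by auto
    ultimately show ?thesis using order.refl by metis
  qed
  then show ?thesis using subgroup.subset[OF S] by (auto simp: monoid_vec_simps)
qed

definition mat_image :: "int mat \<Rightarrow> int vec set" where
  "mat_image L = (\<lambda>v. L *\<^sub>v v) ` carrier_vec (dim_col L)"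

definition coset :: "int mat \<Rightarrow> int vec \<Rightarrow> int vec set" where
  "coset L v = mat_image L #>\<^bsub>Zn (dim_row L)\<^esub> v"

lemma cokernel_eq: "cokernel L = Zn (dim_row L) Mod mat_image L"
  by (simp add: cokernel_def mat_image_def)

lemma group_hom_mult_mat_vec: "group_hom (Zn (dim_col L)) (Zn (dim_row L)) (\<lambda>v. L *\<^sub>v v)"
proof -
  have L: "L \<in> carrier_mat (dim_row L) (dim_col L)" by simp
  have "(\<lambda>v. L *\<^sub>v v) \<in> hom (Zn (dim_col L)) (Zn (dim_row L))"
    by (rule homI) (auto simp: monoid_vec_simps mult_add_distrib_mat_vec[OF L] intro: carrier_vecI)
  then show ?thesis by (simp add: group_homI group_Zn)
qed

lemma mat_image_subgroup: "subgroup (mat_image L) (Zn (dim_row L))"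
  using group_hom.img_is_subgroup[OF group_hom_mult_mat_vec] by (simp add: mat_image_def monoid_vec_simps)

lemma normal_mat_image: "mat_image L \<lhd> Zn (dim_row L)"
  by (rule comm_group.subgroup_imp_normal[OF comm_group_Zn mat_image_subgroup])

lemma comm_group_cokernel: "comm_group (cokernel L)"
  unfolding cokernel_eq by (rule comm_group.abelian_FactGroup[OF comm_group_Zn mat_image_subgroup])

lemma group_cokernel: "group (cokernel L)"
  using comm_group_cokernel by (simp add: comm_group_def)

lemma group_hom_coset: "group_hom (Zn (dim_row L)) (cokernel L) (coset L)"
  unfolding cokernel_eq coset_def[abs_def]
  by (rule comm_group.group_hom_Mod[OF comm_group_Zn mat_image_subgroup])

lemma carrier_cokernel: "carrier (cokernel L) = coset L ` carrier_vec (dim_row L)"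
  unfolding cokernel_eq carrier_FactGroup coset_def by (simp add: monoid_vec_simps)

lemma coset_eq_one:
  assumes "v \<in> mat_image L"
  shows "coset L v = \<one>\<^bsub>cokernel L\<^esub>"
  using group.coset_join2[OF group_Zn _ mat_image_subgroup assms]
    subgroup.mem_carrier[OF mat_image_subgroup assms]
  by (simp add: coset_def cokernel_eq)

lemma generate_coset_unit_vecs:
  "generate (cokernel L) ((\<lambda>i. coset L (unit_vec (dim_row L) i)) ` {..<dim_row L}) = carrier (cokernel L)"
proof -
  have "unit_vec (dim_row L) ` {..<dim_row L} \<subseteq> carrier (Zn (dim_row L))"
    by (auto simp: monoid_vec_simps)
  from group_hom.generate_img[OF group_hom_coset this] show ?thesis
    by (simp add: generate_unit_vecs carrier_cokernel image_image)
qed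

lemma mult_mat_unit_vec:
  fixes L :: "'a::semiring_1 mat"
  assumes "j < dim_col L"
  shows "L *\<^sub>v unit_vec (dim_col L) j = col L j"
  using assms by (intro eq_vecI) (auto simp: scalar_prod_right_unit)

lemma col_in_mat_image: "j < dim_col L \<Longrightarrow> col L j \<in> mat_image L"
  by (auto simp: mat_image_def mult_mat_unit_vec[symmetric])

lemma cokernel_exponent:
  assumes L: "L \<in> carrier_mat m m" and x: "x \<in> carrier (cokernel L)"
  shows "x [^]\<^bsub>cokernel L\<^esub> nat \<bar>det L\<bar> = \<one>\<^bsub>cokernel L\<^esub>"
proof -
  interpret coset: group_hom "Zn (dim_row L)" "cokernel L" "coset L" by (rule group_hom_coset)
  have dims: "dim_row L = m" "dim_col L = m" using L by auto
  obtain v where v: "v \<in> carrier_vec m" "x = coset L v" using x dims by (auto simp: carrier_cokernel)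
  define d where "d = int (nat \<bar>det L\<bar>)"
  have d_eq: "d = sgn (det L) * det L" using abs_sgn[of "det L"] by (simp add: d_def mult.commute)
  have "L *\<^sub>v (adj_mat L *\<^sub>v (sgn (det L) \<cdot>\<^sub>v v)) = (L * adj_mat L) *\<^sub>v (sgn (det L) \<cdot>\<^sub>v v)"
    using assoc_mult_mat_vec[OF L adj_mat(1)[OF L], of "sgn (det L) \<cdot>\<^sub>v v"] v by simp
  also have "\<dots> = d \<cdot>\<^sub>v v" unfolding adj_mat(2)[OF L] d_eq using v by (intro eq_vecI) auto
  finally have "d \<cdot>\<^sub>v v \<in> mat_image L"
    using v adj_mat(1)[OF L] dims
    by (auto simp: mat_image_def intro!: image_eqI[of _ _ "adj_mat L *\<^sub>v (sgn (det L) \<cdot>\<^sub>v v)"])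
  then have "coset L (d \<cdot>\<^sub>v v) = \<one>\<^bsub>cokernel L\<^esub>" by (rule coset_eq_one)
  moreover have "x [^]\<^bsub>cokernel L\<^esub> d = coset L (d \<cdot>\<^sub>v v)"
    using coset.hom_int_pow[of v d] int_pow_Zn[of v m d] v dims by (simp add: monoid_vec_simps)
  ultimately show ?thesis by (simp add: d_def int_pow_int)
qed

definition coker_homs :: "('a, 'b) monoid_scheme \<Rightarrow> int mat \<Rightarrow> (nat \<Rightarrow> 'a) set" where
  "coker_homs G L = {f \<in> {..<dim_row L} \<rightarrow>\<^sub>E carrier G.
     \<forall>j<dim_col L. (\<Otimes>\<^bsub>G\<^esub>i\<in>{..<dim_row L}. f i [^]\<^bsub>G\<^esub> (L $$ (i, j))) = \<one>\<^bsub>G\<^esub>}"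

definition coker_surs :: "('a, 'b) monoid_scheme \<Rightarrow> int mat \<Rightarrow> (nat \<Rightarrow> 'a) set" where
  "coker_surs G L = {f \<in> coker_homs G L. generate G (f ` {..<dim_row L}) = carrier G}"

definition tuple_hom :: "('a, 'b) monoid_scheme \<Rightarrow> nat \<Rightarrow> (nat \<Rightarrow> 'a) \<Rightarrow> int vec \<Rightarrow> 'a" where
  "tuple_hom G m f v = (\<Otimes>\<^bsub>G\<^esub>i\<in>{..<m}. f i [^]\<^bsub>G\<^esub> (v $ i))"

definition hom_tuple :: "int mat \<Rightarrow> (int vec set \<Rightarrow> 'a) \<Rightarrow> nat \<Rightarrow> 'a" where
  "hom_tuple L \<phi> = (\<lambda>i\<in>{..<dim_row L}. \<phi> (coset L (unit_vec (dim_row L) i)))"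

lemma coker_homs_subset: "coker_homs G L \<subseteq> {..<dim_row L} \<rightarrow>\<^sub>E carrier G"
  by (auto simp: coker_homs_def)

context comm_group
begin

lemma group_hom_tuple_hom:
  assumes f: "f \<in> {..<m} \<rightarrow> carrier G"
  shows "group_hom (Zn m) G (tuple_hom G m f)"
proof -
  have "tuple_hom G m f \<in> hom (Zn m) G"
  proof (rule homI)
    fix u v assume uv: "u \<in> carrier (Zn m)" "v \<in> carrier (Zn m)"
    have "tuple_hom G m f (u \<otimes>\<^bsub>Zn m\<^esub> v) = (\<Otimes>i\<in>{..<m}. f i [^] (u $ i) \<otimes> f i [^] (v $ i))"
      unfolding tuple_hom_def
      by (intro finprod_cong') (use uv f in \<open>auto simp: monoid_vec_simps int_pow_mult Pi_iff\<close>)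
    also have "\<dots> = tuple_hom G m f u \<otimes> tuple_hom G m f v"
      unfolding tuple_hom_def by (intro finprod_multf) (use f in auto)
    finally show "tuple_hom G m f (u \<otimes>\<^bsub>Zn m\<^esub> v) = tuple_hom G m f u \<otimes> tuple_hom G m f v" .
  qed (use f in \<open>auto simp: tuple_hom_def intro!: finprod_closed\<close>)
  then show ?thesis by (simp add: group_homI group_Zn is_group)
qed

lemma tuple_hom_unit_vec:
  assumes f: "f \<in> {..<m} \<rightarrow> carrier G" and i: "i < m"
  shows "tuple_hom G m f (unit_vec m i) = f i"
proof -
  have "tuple_hom G m f (unit_vec m i) = (\<Otimes>j\<in>{..<m}. if i = j then f j else \<one>)"
    unfolding tuple_hom_def by (intro finprod_cong') (use f i in \<open>auto simp: Pi_iff\<close>)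
  also have "\<dots> = f i" using f i by (intro finprod_singleton) auto
  finally show ?thesis .
qed

lemma coker_homs_iff_tuple_hom_col:
  assumes "f \<in> {..<dim_row L} \<rightarrow>\<^sub>E carrier G"
  shows "f \<in> coker_homs G L \<longleftrightarrow> (\<forall>j<dim_col L. tuple_hom G (dim_row L) f (col L j) = \<one>)"
proof -
  have "tuple_hom G (dim_row L) f (col L j) = (\<Otimes>i\<in>{..<dim_row L}. f i [^] (L $$ (i, j)))"
    if "j < dim_col L" for j
    unfolding tuple_hom_def by (intro finprod_cong') (use assms that in \<open>auto simp: PiE_iff\<close>)
  then show ?thesis using assms by (auto simp: coker_homs_def)
qed

lemma tuple_hom_mat_image:
  assumes f: "f \<in> coker_homs G L" and r: "r \<in> mat_image L"
  shows "tuple_hom G (dim_row L) f r = \<one>"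
proof -
  let ?k = "dim_col L"
  have fE: "f \<in> {..<dim_row L} \<rightarrow>\<^sub>E carrier G" using f coker_homs_subset by blast
  then have "group_hom (Zn (dim_row L)) G (tuple_hom G (dim_row L) f)"
    by (intro group_hom_tuple_hom) auto
  from Group.hom_compose[OF group_hom.homh[OF group_hom_mult_mat_vec] group_hom.homh[OF this]]
  interpret group_hom "Zn ?k" G "tuple_hom G (dim_row L) f \<circ> (\<lambda>v. L *\<^sub>v v)"
    by (rule group_homI[OF group_Zn is_group])
  obtain v where v: "v \<in> generate (Zn ?k) (unit_vec ?k ` {..<?k})" "r = L *\<^sub>v v"
    using r unfolding mat_image_def generate_unit_vecs by blast
  have "(tuple_hom G (dim_row L) f \<circ> (\<lambda>v. L *\<^sub>v v)) v = \<one>"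
  proof (rule hom_eq_one_on_generate[OF _ _ v(1)])
    fix s :: "int vec" assume "s \<in> unit_vec ?k ` {..<?k}"
    then show "(tuple_hom G (dim_row L) f \<circ> (\<lambda>v. L *\<^sub>v v)) s = \<one>"
      using f coker_homs_iff_tuple_hom_col[OF fE] by (auto simp: mult_mat_unit_vec)
  qed (auto simp: monoid_vec_simps)
  then show ?thesis using v(2) by simp
qed

lemma group_hom_lift_cokernel:
  assumes "\<phi> \<in> Hom (cokernel L) G"
  shows "group_hom (Zn (dim_row L)) G (\<phi> \<circ> coset L)"
  using assms
  by (intro group_homI group_Zn is_group Group.hom_compose[OF group_hom.homh[OF group_hom_coset]])
     (simp add: Hom_def)

lemma hom_tuple_in_PiE:
  assumes "\<phi> \<in> Hom (cokernel L) G"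
  shows "hom_tuple L \<phi> \<in> {..<dim_row L} \<rightarrow>\<^sub>E carrier G"
  using group_hom.hom_closed[OF group_hom_lift_cokernel[OF assms]]
  by (auto simp: hom_tuple_def monoid_vec_simps)

lemma tuple_hom_hom_tuple:
  assumes \<phi>: "\<phi> \<in> Hom (cokernel L) G" and v: "v \<in> carrier_vec (dim_row L)"
  shows "tuple_hom G (dim_row L) (hom_tuple L \<phi>) v = \<phi> (coset L v)"
proof -
  let ?m = "dim_row L"
  have f: "hom_tuple L \<phi> \<in> {..<?m} \<rightarrow> carrier G" using hom_tuple_in_PiE[OF \<phi>] by auto
  have "tuple_hom G ?m (hom_tuple L \<phi>) v = (\<phi> \<circ> coset L) v"
  proof (rule group_hom.hom_eq_on_generate[OF group_hom_tuple_hom[OF f] group_hom_lift_cokernel[OF \<phi>]])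
    show "v \<in> generate (Zn ?m) (unit_vec ?m ` {..<?m})" using v by (simp add: generate_unit_vecs)
  qed (use f in \<open>auto simp: monoid_vec_simps tuple_hom_unit_vec\<close>, simp add: hom_tuple_def)
  then show ?thesis by simp
qed

lemma hom_tuple_in_coker_homs:
  assumes \<phi>: "\<phi> \<in> Hom (cokernel L) G"
  shows "hom_tuple L \<phi> \<in> coker_homs G L"
proof -
  have "\<phi> \<one>\<^bsub>cokernel L\<^esub> = \<one>"
    using \<phi> by (intro hom_one[OF _ group_cokernel is_group]) (simp add: Hom_def)
  then have "tuple_hom G (dim_row L) (hom_tuple L \<phi>) (col L j) = \<one>" if "j < dim_col L" for j
    using tuple_hom_hom_tuple[OF \<phi>] coset_eq_one[OF col_in_mat_image[OF that]] by simp
  then show ?thesis using coker_homs_iff_tuple_hom_col[OF hom_tuple_in_PiE[OF \<phi>]] by blast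
qed

lemma hom_tuple_onto_coker_homs:
  assumes f: "f \<in> coker_homs G L"
  obtains \<phi> where "\<phi> \<in> Hom (cokernel L) G" "hom_tuple L \<phi> = f"
proof -
  let ?m = "dim_row L"
  have fE: "f \<in> {..<?m} \<rightarrow>\<^sub>E carrier G" using f coker_homs_subset by blast
  then have fG: "f \<in> {..<?m} \<rightarrow> carrier G" by auto
  interpret f: group_hom "Zn ?m" G "tuple_hom G ?m f" by (rule group_hom_tuple_hom[OF fG])
  have "mat_image L \<subseteq> kernel (Zn ?m) G (tuple_hom G ?m f)"
    using tuple_hom_mat_image[OF f] subgroup.subset[OF mat_image_subgroup] by (auto simp: kernel_def)
  then obtain g where g: "g \<in> hom (cokernel L) G"
    "\<And>v. v \<in> carrier (Zn ?m) \<Longrightarrow> g (mat_image L #>\<^bsub>Zn ?m\<^esub> v) = tuple_hom G ?m f v"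
    using f.FactGroup_universal_kernel[OF normal_mat_image] unfolding cokernel_eq by blast
  let ?\<phi> = "restrict g (carrier (cokernel L))"
  have \<phi>: "?\<phi> \<in> Hom (cokernel L) G"
    by (rule restrict_in_Hom[OF group_cokernel g(1)])
  moreover have "hom_tuple L ?\<phi> = f"
  proof (rule PiE_ext[OF hom_tuple_in_PiE[OF \<phi>] fE])
    fix i assume i: "i \<in> {..<?m}"
    then have "g (coset L (unit_vec ?m i)) = f i"
      using g(2)[of "unit_vec ?m i"] tuple_hom_unit_vec[OF fG] by (simp add: coset_def monoid_vec_simps)
    then show "hom_tuple L ?\<phi> i = f i" using i by (simp add: hom_tuple_def carrier_cokernel)
  qed
  ultimately show ?thesis by (rule that)
qed

lemma bij_betw_hom_tuple: "bij_betw (hom_tuple L) (Hom (cokernel L) G) (coker_homs G L)"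
proof (rule bij_betw_imageI)
  show "inj_on (hom_tuple L) (Hom (cokernel L) G)"
  proof (rule inj_onI)
    fix \<phi> \<psi> assume \<phi>: "\<phi> \<in> Hom (cokernel L) G" and \<psi>: "\<psi> \<in> Hom (cokernel L) G"
      and eq: "hom_tuple L \<phi> = hom_tuple L \<psi>"
    show "\<phi> = \<psi>"
    proof (rule Hom_eqI[OF \<phi> \<psi>])
      fix x assume "x \<in> carrier (cokernel L)"
      then show "\<phi> x = \<psi> x"
        using tuple_hom_hom_tuple[OF \<phi>] tuple_hom_hom_tuple[OF \<psi>] eq by (auto simp: carrier_cokernel)
    qed
  qed
  show "hom_tuple L ` Hom (cokernel L) G = coker_homs G L"
    using hom_tuple_in_coker_homs hom_tuple_onto_coker_homs by (auto simp: image_iff) metis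
qed

lemma card_Hom_cokernel: "card (Hom (cokernel L) G) = card (coker_homs G L)"
  by (rule bij_betw_same_card[OF bij_betw_hom_tuple])

lemma card_Sur_cokernel: "card (Sur (cokernel L) G) = card (coker_surs G L)"
proof -
  have "generate G (hom_tuple L \<phi> ` {..<dim_row L}) = \<phi> ` carrier (cokernel L)"
    if \<phi>: "\<phi> \<in> Hom (cokernel L) G" for \<phi>
  proof -
    let ?e = "\<lambda>i. coset L (unit_vec (dim_row L) i)"
    interpret \<phi>: group_hom "cokernel L" G \<phi>
      using \<phi> by (intro group_homI group_cokernel is_group) (simp add: Hom_def)
    have "hom_tuple L \<phi> ` {..<dim_row L} = \<phi> ` ?e ` {..<dim_row L}"
      by (simp add: hom_tuple_def image_image)
    also have "generate G \<dots> = \<phi> ` generate (cokernel L) (?e ` {..<dim_row L})"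
      by (rule \<phi>.generate_img) (auto simp: carrier_cokernel)
    finally show ?thesis by (simp add: generate_coset_unit_vecs)
  qed
  then have "bij_betw (hom_tuple L) (Sur (cokernel L) G) (coker_surs G L)"
    unfolding Sur_eq coker_surs_def by (intro bij_betw_Collect[OF bij_betw_hom_tuple]) auto
  then show ?thesis by (rule bij_betw_same_card)
qed

end

lemma (in finite_comm_group) finite_coker_homs: "finite (coker_homs G L)"
  by (rule finite_subset[OF coker_homs_subset]) (intro finite_PiE finite_carrier finite_lessThan)

section \<open>Random graphs and character sums\<close>

subsection \<open>Edges and expectations\<close>

definition neighbours :: "nat set set \<Rightarrow> nat \<Rightarrow> nat \<Rightarrow> nat set" where
  "neighbours E n j = {i\<in>{..<n}. i \<noteq> j \<and> {i, j} \<in> E}"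

lemma finite_possible_edges: "finite (possible_edges n)"
  by (rule finite_subset[of _ "Pow {..<n}"]) (auto simp: possible_edges_def)

lemma possible_edgesE:
  assumes "e \<in> possible_edges n"
  obtains a b where "a < b" "b < n" "e = {a, b}" "Min e = a" "Max e = b"
proof -
  from assms obtain x y where xy: "e = {x, y}" "x \<noteq> y" "x < n" "y < n"
    by (auto simp: possible_edges_def card_2_iff)
  show ?thesis
  proof (cases "x < y")
    case True
    then show ?thesis using that[of x y] xy by simp
  next
    case False
    then show ?thesis using that[of y x] xy by (simp add: insert_commute)
  qed
qed

lemma (in comm_monoid_set) ordered_pairs_eq_edges:
  assumes E: "E \<subseteq> possible_edges n"
  shows "F (\<lambda>j. F (T j) (neighbours E n j)) {..<n} =
    F (\<lambda>e. T (Min e) (Max e) \<^bold>* T (Max e) (Min e)) E"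
proof -
  let ?S = "SIGMA j:{..<n}. neighbours E n j"
  have finE: "finite E" using E finite_possible_edges finite_subset by blast
  have "F (\<lambda>j. F (T j) (neighbours E n j)) {..<n} = F (\<lambda>(j, i). T j i) ?S"
    by (rule Sigma) (auto simp: neighbours_def)
  also have "\<dots> = F (\<lambda>e. F (\<lambda>(j, i). T j i) {x \<in> ?S. {fst x, snd x} = e}) E"
    by (rule group[symmetric]) (auto simp: finE insert_commute neighbours_def)
  also have "\<dots> = F (\<lambda>e. T (Min e) (Max e) \<^bold>* T (Max e) (Min e)) E"
  proof (rule cong[OF refl])
    fix e assume e: "e \<in> E"
    then obtain a b where ab: "a < b" "b < n" "e = {a, b}" "Min e = a" "Max e = b"
      using E possible_edgesE by blast
    have "{x \<in> ?S. {fst x, snd x} = e} = {(a, b), (b, a)}"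
      using ab e by (auto simp: doubleton_eq_iff insert_commute neighbours_def)
    then show "F (\<lambda>(j, i). T j i) {x \<in> ?S. {fst x, snd x} = e} = T (Min e) (Max e) \<^bold>* T (Max e) (Min e)"
      using ab by simp
  qed
  finally show ?thesis .
qed

lemma card_incident_edges:
  assumes E: "E \<subseteq> possible_edges n"
  shows "card {e \<in> E. j \<in> e} = card (neighbours E n j)"
proof -
  have "bij_betw (\<lambda>i. {i, j}) (neighbours E n j) {e \<in> E. j \<in> e}"
  proof (rule bij_betw_imageI)
    show "inj_on (\<lambda>i. {i, j}) (neighbours E n j)"
      by (auto simp: inj_on_def doubleton_eq_iff)
    show "(\<lambda>i. {i, j}) ` neighbours E n j = {e \<in> E. j \<in> e}"
    proof (intro equalityI subsetI)
      fix e assume e: "e \<in> {e \<in> E. j \<in> e}"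
      then obtain x y where "e = {x, y}" "x \<noteq> y" "x < n" "y < n"
        using E by (auto simp: possible_edges_def card_2_iff)
      then obtain i where "e = {i, j}" "i \<noteq> j" "i < n"
        using e by (metis insert_commute insertE mem_Collect_eq singletonD)
      then show "e \<in> (\<lambda>i. {i, j}) ` neighbours E n j" using e by (auto simp: neighbours_def)
    qed (auto simp: neighbours_def)
  qed
  then show ?thesis by (simp add: bij_betw_same_card)
qed

lemma expectation_erdos_renyi:
  fixes F :: "nat set set \<Rightarrow> 'b::{banach, second_countable_topology}"
  assumes q: "0 \<le> q" "q \<le> 1"
  shows "measure_pmf.expectation (erdos_renyi n q) F =
    (\<Sum>E\<in>Pow (possible_edges n). (q ^ card E * (1 - q) ^ card (possible_edges n - E)) *\<^sub>R F E)"
proof -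
  let ?P = "possible_edges n"
  let ?X = "PiE_dflt ?P False (\<lambda>_. UNIV)"
  have fin: "finite ?P" by (rule finite_possible_edges)
  have "measure_pmf.expectation (erdos_renyi n q) F =
    measure_pmf.expectation (Pi_pmf ?P False (\<lambda>_. bernoulli_pmf q)) (\<lambda>b. F {e \<in> ?P. b e})"
    by (simp add: erdos_renyi_def)
  also have "\<dots> = (\<Sum>b\<in>?X. pmf (Pi_pmf ?P False (\<lambda>_. bernoulli_pmf q)) b *\<^sub>R F {e \<in> ?P. b e})"
  proof (rule integral_measure_pmf)
    show "finite ?X" using fin by (intro finite_PiE_dflt) auto
  next
    fix b assume "b \<in> set_pmf (Pi_pmf ?P False (\<lambda>_. bernoulli_pmf q))"
    then show "b \<in> ?X" using set_Pi_pmf_subset'[OF fin] by (fastforce simp: PiE_dflt_def)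
  qed
  also have "\<dots> = (\<Sum>E\<in>Pow ?P. (q ^ card E * (1 - q) ^ card (?P - E)) *\<^sub>R F E)"
  proof (rule sum.reindex_bij_witness[of _ "\<lambda>E e. e \<in> E" "\<lambda>b. {e \<in> ?P. b e}"])
    fix b assume b: "b \<in> ?X"
    have "pmf (Pi_pmf ?P False (\<lambda>_. bernoulli_pmf q)) b = (\<Prod>e\<in>?P. pmf (bernoulli_pmf q) (b e))"
      using b fin by (intro pmf_Pi') (auto simp: PiE_dflt_def)
    also have "\<dots> = (\<Prod>e\<in>?P. if b e then q else 1 - q)"
      using q by (intro prod.cong) auto
    also have "\<dots> = q ^ card {e \<in> ?P. b e} * (1 - q) ^ card (?P - {e \<in> ?P. b e})"
      using fin by (simp add: prod.If_cases Int_def set_diff_eq) (metis (mono_tags, lifting) Collect_cong)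
    finally show "(q ^ card {e \<in> ?P. b e} * (1 - q) ^ card (?P - {e \<in> ?P. b e})) *\<^sub>R F {e \<in> ?P. b e} =
      pmf (Pi_pmf ?P False (\<lambda>_. bernoulli_pmf q)) b *\<^sub>R F {e \<in> ?P. b e}" by simp
  qed (auto simp: PiE_dflt_def fun_eq_iff)
  finally show ?thesis .
qed

lemma expectation_erdos_renyi_prod:
  fixes k :: "nat set \<Rightarrow> complex"
  assumes q: "0 \<le> q" "q \<le> 1"
  shows "measure_pmf.expectation (erdos_renyi n q) (\<lambda>E. \<Prod>e\<in>E. k e) =
    (\<Prod>e\<in>possible_edges n. of_real (1 - q) + of_real q * k e)"
proof -
  let ?P = "possible_edges n"
  have "(\<Prod>e\<in>?P. of_real (1 - q) + of_real q * k e) = (\<Prod>e\<in>?P. complex_of_real q * k e + (1 - q))"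
    by (intro prod.cong) auto
  also have "\<dots> = (\<Sum>E\<in>Pow ?P. (\<Prod>e\<in>E. complex_of_real q * k e) * (\<Prod>e\<in>?P - E. 1 - complex_of_real q))"
    by (subst prod_add[OF finite_possible_edges]) simp
  also have "\<dots> = (\<Sum>E\<in>Pow ?P. (q ^ card E * (1 - q) ^ card (?P - E)) *\<^sub>R (\<Prod>e\<in>E. k e))"
    by (intro sum.cong refl) (simp add: prod.distrib scaleR_conv_of_real)
  finally show ?thesis by (simp add: expectation_erdos_renyi[OF q])
qed

lemma set_pmf_erdos_renyi: "set_pmf (erdos_renyi n q) \<subseteq> Pow (possible_edges n)"
  by (auto simp: erdos_renyi_def)

lemma integrable_erdos_renyi:
  fixes f :: "nat set set \<Rightarrow> 'b::{banach, second_countable_topology}"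
  shows "integrable (measure_pmf (erdos_renyi n q)) f"
  by (rule integrable_measure_pmf_finite, rule finite_subset[OF set_pmf_erdos_renyi])
     (simp add: finite_possible_edges)

lemma expectation_erdos_renyi_mono:
  fixes f g :: "nat set set \<Rightarrow> real"
  assumes "\<And>E. E \<subseteq> possible_edges n \<Longrightarrow> f E \<le> g E"
  shows "measure_pmf.expectation (erdos_renyi n q) f \<le> measure_pmf.expectation (erdos_renyi n q) g"
  by (rule integral_mono_AE[OF integrable_erdos_renyi integrable_erdos_renyi])
     (use assms set_pmf_erdos_renyi in \<open>force intro!: AE_pmfI\<close>)

lemma expectation_erdos_renyi_cong:
  assumes "\<And>E. E \<subseteq> possible_edges n \<Longrightarrow> f E = g E"
  shows "measure_pmf.expectation (erdos_renyi n q) f = measure_pmf.expectation (erdos_renyi n q) g"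
  by (rule Bochner_Integration.integral_cong_AE)
     (use assms set_pmf_erdos_renyi in \<open>force intro!: AE_pmfI\<close>)+

lemma pair_energy_eq_sum_edges:
  assumes sym: "\<And>u v. D u v = D v u" and diag: "\<And>i. i < n \<Longrightarrow> D (w i) (w i) = 0"
  shows "pair_energy D n w = (\<Sum>e\<in>possible_edges n. D (w (Min e)) (w (Max e)))"
proof -
  let ?P = "possible_edges n"
  have "(\<Sum>i<n. D (w j) (w i)) = (\<Sum>i\<in>neighbours ?P n j. D (w j) (w i))" if j: "j < n" for j
  proof -
    have "neighbours ?P n j = {..<n} - {j}"
      using j by (auto simp: neighbours_def possible_edges_def)
    then show ?thesis using diag[OF j] j by (simp add: sum.remove[of _ j])
  qed
  then have "(\<Sum>j<n. \<Sum>i<n. D (w j) (w i)) = (\<Sum>j<n. \<Sum>i\<in>neighbours ?P n j. D (w j) (w i))"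
    by (rule sum.cong[OF refl]) simp
  also have "\<dots> = (\<Sum>e\<in>?P. D (w (Min e)) (w (Max e)) + D (w (Max e)) (w (Min e)))"
    by (rule sum.ordered_pairs_eq_edges) simp
  also have "\<dots> = (\<Sum>e\<in>?P. 2 * D (w (Min e)) (w (Max e)))"
    by (intro sum.cong refl) (metis sym mult_2)
  finally show ?thesis by (simp add: pair_energy_def flip: sum_distrib_left)
qed

subsection \<open>Weights of phase maps\<close>

definition edge_kernel :: "(nat \<Rightarrow> 'a \<times> ('a \<Rightarrow> complex)) \<Rightarrow> nat set \<Rightarrow> complex" where
  "edge_kernel w e = phase_kernel (w (Min e)) (w (Max e))"

definition graph_weight :: "real \<Rightarrow> nat \<Rightarrow> (nat \<Rightarrow> 'a \<times> ('a \<Rightarrow> complex)) \<Rightarrow> complex" where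
  "graph_weight q n w = (\<Prod>e\<in>possible_edges n. of_real (1 - q) + of_real q * edge_kernel w e)"

definition phase_dist :: "'a \<times> ('a \<Rightarrow> complex) \<Rightarrow> 'a \<times> ('a \<Rightarrow> complex) \<Rightarrow> real" where
  "phase_dist u v = 1 - Re (phase_kernel u v)"

lemma phase_dist_commute: "phase_dist u v = phase_dist v u"
  unfolding phase_dist_def by (subst phase_kernel_commute) (rule refl)

lemma phase_dist_refl: "u \<in> phase_space G \<Longrightarrow> phase_dist u u = 0"
  by (simp add: phase_dist_def phase_kernel_refl)

lemma phase_dist_eq_0_iff:
  assumes "u \<in> phase_space G" "v \<in> phase_space G"
  shows "phase_dist u v = 0 \<longleftrightarrow> phase_kernel u v = 1"
proof
  assume "phase_dist u v = 0"
  moreover from this have "(Im (phase_kernel u v))\<^sup>2 = 0"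
    using norm_phase_kernel[OF assms] by (simp add: phase_dist_def cmod_def)
  ultimately show "phase_kernel u v = 1" by (simp add: phase_dist_def complex_eq_iff)
qed (simp add: phase_dist_def)

lemma norm_convex_combination_le:
  fixes k :: complex and q :: real
  assumes "norm k = 1"
  shows "norm (of_real (1 - q) + of_real q * k) \<le> exp (- (q * (1 - q)) * (1 - Re k))"
proof -
  have norm_sq: "(Re k)\<^sup>2 + (Im k)\<^sup>2 = 1" using assms by (simp add: cmod_def)
  have "(norm (of_real (1 - q) + of_real q * k))\<^sup>2 = (1 - q + q * Re k)\<^sup>2 + (q * Im k)\<^sup>2"
    by (simp add: cmod_power2)
  also have "\<dots> = (1 - q)\<^sup>2 + 2 * (1 - q) * q * Re k + q\<^sup>2 * ((Re k)\<^sup>2 + (Im k)\<^sup>2)"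
    by (simp add: power2_eq_square algebra_simps)
  also have "\<dots> = 1 + (- (2 * (q * (1 - q)) * (1 - Re k)))"
    unfolding norm_sq by (simp add: power2_eq_square algebra_simps)
  also have "\<dots> \<le> exp (- (2 * (q * (1 - q)) * (1 - Re k)))" by (rule exp_ge_add_one_self)
  also have "\<dots> = (exp (- (q * (1 - q)) * (1 - Re k)))\<^sup>2"
    using exp_double[of "- (q * (1 - q)) * (1 - Re k)"] by (simp add: algebra_simps)
  finally show ?thesis by (rule power2_le_imp_le) simp
qed

lemma norm_graph_weight_le:
  assumes w: "w \<in> {..<n} \<rightarrow>\<^sub>E phase_space G"
  shows "norm (graph_weight q n w) \<le> exp (- (q * (1 - q)) * pair_energy phase_dist n w)"
proof -
  let ?P = "possible_edges n"
  have wV: "w i \<in> phase_space G" if "i < n" for i using w that by auto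
  have "norm (of_real (1 - q) + of_real q * edge_kernel w e) \<le>
      exp (- (q * (1 - q)) * phase_dist (w (Min e)) (w (Max e)))" if "e \<in> ?P" for e
  proof -
    have "Min e < n" "Max e < n" using that by (auto elim!: possible_edgesE)
    then have "norm (edge_kernel w e) = 1" using norm_phase_kernel wV unfolding edge_kernel_def by blast
    from norm_convex_combination_le[OF this] show ?thesis by (simp add: edge_kernel_def phase_dist_def)
  qed
  then have "norm (graph_weight q n w) \<le>
      (\<Prod>e\<in>?P. exp (- (q * (1 - q)) * phase_dist (w (Min e)) (w (Max e))))"
    unfolding graph_weight_def prod_norm[symmetric] by (intro prod_mono) auto
  also have "\<dots> = exp (- (q * (1 - q)) * (\<Sum>e\<in>?P. phase_dist (w (Min e)) (w (Max e))))"
    by (simp add: exp_sum finite_possible_edges sum_distrib_left flip: sum_negf)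
  also have "(\<Sum>e\<in>?P. phase_dist (w (Min e)) (w (Max e))) = pair_energy phase_dist n w"
    using phase_dist_commute phase_dist_refl[OF wV] by (intro pair_energy_eq_sum_edges[symmetric])
  finally show ?thesis .
qed

lemma graph_weight_isotropic:
  assumes "isotropic (w ` {..<n})"
  shows "graph_weight q n w = 1"
  unfolding graph_weight_def
proof (rule prod.neutral, rule ballI)
  fix e assume "e \<in> possible_edges n"
  then have "edge_kernel w e = 1"
    using assms by (auto simp: edge_kernel_def isotropic_def elim!: possible_edgesE)
  then show "of_real (1 - q) + of_real q * edge_kernel w e = 1" by simp
qed

subsection \<open>The moments as character sums\<close>

definition rooted :: "nat \<Rightarrow> 'v set \<Rightarrow> 'v \<Rightarrow> (nat \<Rightarrow> 'v) set" where
  "rooted m A r = {w \<in> {..<Suc m} \<rightarrow>\<^sub>E A. w m = r}"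

lemma bij_betw_rooted:
  assumes "r \<in> A"
  shows "bij_betw (\<lambda>g. g(m := r)) ({..<m} \<rightarrow>\<^sub>E A) (rooted m A r)"
proof (rule bij_betw_imageI)
  have inj: "inj_on (\<lambda>(y, g). g(m := y)) (A \<times> ({..<m} \<rightarrow>\<^sub>E A))" by (rule inj_combinator) simp
  show "inj_on (\<lambda>g. g(m := r)) ({..<m} \<rightarrow>\<^sub>E A)"
  proof (rule inj_onI)
    show "g = g'" if "g \<in> {..<m} \<rightarrow>\<^sub>E A" "g' \<in> {..<m} \<rightarrow>\<^sub>E A" "g(m := r) = g'(m := r)" for g g'
      using inj_onD[OF inj, of "(r, g)" "(r, g')"] that assms by simp
  qed
  have "w \<in> (\<lambda>g. g(m := r)) ` ({..<m} \<rightarrow>\<^sub>E A)" if "w \<in> rooted m A r" for w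
  proof -
    have "w \<in> insert m {..<m} \<rightarrow>\<^sub>E A" using that by (simp add: rooted_def lessThan_Suc)
    then obtain y g where "g \<in> {..<m} \<rightarrow>\<^sub>E A" "w = g(m := y)"
      unfolding PiE_insert_eq by (elim imageE) auto
    then show ?thesis using that by (auto simp: rooted_def)
  qed
  moreover have "g(m := r) \<in> rooted m A r" if "g \<in> {..<m} \<rightarrow>\<^sub>E A" for g
    using PiE_fun_upd[of r "\<lambda>_. A" m g "{..<m}"] that assms by (simp add: rooted_def lessThan_Suc)
  ultimately show "(\<lambda>g. g(m := r)) ` ({..<m} \<rightarrow>\<^sub>E A) = rooted m A r" by blast
qed

lemma bij_betw_PiE_Times:
  "bij_betw (\<lambda>(f, g). \<lambda>i\<in>I. (f i, g i)) ((I \<rightarrow>\<^sub>E A) \<times> (I \<rightarrow>\<^sub>E B)) (I \<rightarrow>\<^sub>E A \<times> B)"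
proof (rule bij_betwI[of _ _ _ "\<lambda>w. (\<lambda>i\<in>I. fst (w i), \<lambda>i\<in>I. snd (w i))"])
  show "(\<lambda>i\<in>I. fst ((case x of (f, g) \<Rightarrow> \<lambda>i\<in>I. (f i, g i)) i),
      \<lambda>i\<in>I. snd ((case x of (f, g) \<Rightarrow> \<lambda>i\<in>I. (f i, g i)) i)) = x"
    if "x \<in> (I \<rightarrow>\<^sub>E A) \<times> (I \<rightarrow>\<^sub>E B)" for x
    using that by (auto simp: fun_eq_iff PiE_iff extensional_def)
qed (auto simp: fun_eq_iff PiE_iff extensional_def mem_Times_iff)

lemma finite_rooted: "finite A \<Longrightarrow> finite (rooted m A r)"
  by (rule finite_subset[of _ "{..<Suc m} \<rightarrow>\<^sub>E A"]) (auto simp: rooted_def intro: finite_PiE)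

lemma reduced_laplacian_carrier: "reduced_laplacian n E \<in> carrier_mat (n - 1) (n - 1)"
  by (rule carrier_matI) (simp_all add: reduced_laplacian_def laplacian_def mat_delete_def)

lemmas dim_reduced_laplacian [simp] = carrier_matD[OF reduced_laplacian_carrier]

lemma reduced_laplacian_entry:
  assumes "i < m" "j < m"
  shows "reduced_laplacian (Suc m) E $$ (i, j) =
    (if i = j then int (card {e \<in> E. i \<in> e}) else if {i, j} \<in> E then - 1 else 0)"
  using assms by (simp add: reduced_laplacian_def laplacian_def mat_delete_def)

context comm_group
begin

abbreviation phase_root :: "'a \<times> ('a \<Rightarrow> complex)" where
  "phase_root \<equiv> (\<one>, trivial_character G)"

abbreviation rooted_maps :: "nat \<Rightarrow> (nat \<Rightarrow> 'a \<times> ('a \<Rightarrow> complex)) set" where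
  "rooted_maps m \<equiv> rooted m (phase_space G) phase_root"

lemma phase_root_in_phase_space: "phase_root \<in> phase_space G"
  by (simp add: phase_space_def)

definition phase_map :: "nat \<Rightarrow> (nat \<Rightarrow> 'a) \<Rightarrow> (nat \<Rightarrow> 'a \<Rightarrow> complex) \<Rightarrow> nat \<Rightarrow> 'a \<times> ('a \<Rightarrow> complex)" where
  "phase_map m f C = (\<lambda>i\<in>{..<m}. (f i, C i))(m := phase_root)"

lemma phase_map_in_rooted_maps:
  assumes "f \<in> {..<m} \<rightarrow>\<^sub>E carrier G" "C \<in> {..<m} \<rightarrow>\<^sub>E characters G"
  shows "phase_map m f C \<in> rooted_maps m"
  using assms phase_root_in_phase_space
  by (auto simp: phase_map_def rooted_def PiE_iff extensional_def phase_space_def less_Suc_eq)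

lemma sum_rooted_maps:
  "(\<Sum>w\<in>rooted_maps m. F w) =
    (\<Sum>f\<in>{..<m} \<rightarrow>\<^sub>E carrier G. \<Sum>C\<in>{..<m} \<rightarrow>\<^sub>E characters G. F (phase_map m f C))"
proof -
  have "(\<Sum>w\<in>rooted_maps m. F w) = (\<Sum>g\<in>{..<m} \<rightarrow>\<^sub>E phase_space G. F (g(m := phase_root)))"
    by (rule sum.reindex_bij_betw[OF bij_betw_rooted[OF phase_root_in_phase_space], symmetric])
  also have "\<dots> = (\<Sum>(f, C)\<in>({..<m} \<rightarrow>\<^sub>E carrier G) \<times> ({..<m} \<rightarrow>\<^sub>E characters G).
      F (phase_map m f C))"
    unfolding phase_map_def phase_space_def sum.reindex_bij_betw[OF bij_betw_PiE_Times, symmetric]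
    by (simp add: case_prod_unfold)
  finally show ?thesis by (simp add: sum.cartesian_product)
qed

lemma rooted_mapsD:
  assumes "w \<in> rooted_maps m"
  shows "i < Suc m \<Longrightarrow> w i \<in> phase_space G"
    and "i < Suc m \<Longrightarrow> fst (w i) \<in> carrier G"
    and "i < Suc m \<Longrightarrow> snd (w i) \<in> characters G"
    and "fst (w m) = \<one>" "snd (w m) = trivial_character G"
proof -
  show wi: "w i \<in> phase_space G" if "i < Suc m"
    using assms that by (auto simp: rooted_def)
  show "fst (w i) \<in> carrier G" "snd (w i) \<in> characters G" if "i < Suc m"
    using phase_spaceD[OF wi[OF that]] by auto
qed (use assms in \<open>auto simp: rooted_def\<close>)

lemma character_laplacian_column:
  assumes E: "E \<subseteq> possible_edges (Suc m)" and w: "w \<in> rooted_maps m" and j: "j < m"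
  shows "snd (w j) (\<Otimes>i\<in>{..<m}. fst (w i) [^] (reduced_laplacian (Suc m) E $$ (i, j))) =
    (\<Prod>i\<in>neighbours E (Suc m) j. snd (w j) (fst (w j)) * cnj (snd (w j) (fst (w i))))"
proof -
  let ?n = "Suc m"
  let ?L = "\<lambda>i. if i = j then int (card {e \<in> E. j \<in> e}) else if {i, j} \<in> E then - 1 else 0"
  define C where "C i = snd (w j) (fst (w i))" for i
  have \<xi>: "snd (w j) \<in> characters G" using rooted_mapsD(3)[OF w] j by simp
  have "snd (w j) (\<Otimes>i\<in>{..<m}. fst (w i) [^] (reduced_laplacian ?n E $$ (i, j))) =
    (\<Prod>i<m. C i powi (reduced_laplacian ?n E $$ (i, j)))"
    using rooted_mapsD(2)[OF w] \<xi>
    by (subst character_finprod) (auto simp: character_int_pow C_def)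
  also have "\<dots> = (\<Prod>i<m. C i powi ?L i)"
    using j by (intro prod.cong refl) (auto simp: reduced_laplacian_entry)
  also have "\<dots> = (\<Prod>i<?n. C i powi ?L i)"
    using \<xi> by (simp add: C_def rooted_mapsD(4)[OF w])
  also have "\<dots> = C j powi (int (card {e \<in> E. j \<in> e})) * (\<Prod>i\<in>{..<?n} - {j}. C i powi ?L i)"
    using j by (subst prod.remove[of _ j]) auto
  also have "(\<Prod>i\<in>{..<?n} - {j}. C i powi ?L i) = (\<Prod>i\<in>neighbours E ?n j. cnj (C i))"
    using characters_cnj_eq_inverse[OF \<xi> rooted_mapsD(2)[OF w]]
    by (intro prod.mono_neutral_cong_right) (auto simp: C_def power_int_minus neighbours_def)
  finally show ?thesis by (simp add: C_def prod.distrib card_incident_edges[OF E])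
qed

lemma prod_character_laplacian_columns:
  assumes E: "E \<subseteq> possible_edges (Suc m)" and w: "w \<in> rooted_maps m"
  shows "(\<Prod>j<m. snd (w j) (\<Otimes>i\<in>{..<m}. fst (w i) [^] (reduced_laplacian (Suc m) E $$ (i, j)))) =
    (\<Prod>e\<in>E. edge_kernel w e)"
proof -
  define T where "T j i = snd (w j) (fst (w j)) * cnj (snd (w j) (fst (w i)))" for i j
  have "(\<Prod>j<m. snd (w j) (\<Otimes>i\<in>{..<m}. fst (w i) [^] (reduced_laplacian (Suc m) E $$ (i, j)))) =
      (\<Prod>j<m. \<Prod>i\<in>neighbours E (Suc m) j. T j i)"
    by (intro prod.cong refl) (simp add: character_laplacian_column[OF E w] T_def)
  also have "\<dots> = (\<Prod>j<Suc m. \<Prod>i\<in>neighbours E (Suc m) j. T j i)"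
  proof -
    have "(\<Prod>i\<in>neighbours E (Suc m) m. T m i) = 1"
      using rooted_mapsD[OF w]
      by (intro prod.neutral) (auto simp: T_def trivial_character_def neighbours_def)
    then show ?thesis by simp
  qed
  also have "\<dots> = (\<Prod>e\<in>E. T (Min e) (Max e) * T (Max e) (Min e))"
    by (rule prod.ordered_pairs_eq_edges[OF E])
  also have "\<dots> = (\<Prod>e\<in>E. edge_kernel w e)"
    by (intro prod.cong refl) (simp add: T_def edge_kernel_def phase_kernel_def mult_ac)
  finally show ?thesis .
qed

lemma prod_characters_laplacian:
  assumes E: "E \<subseteq> possible_edges (Suc m)"
    and f: "f \<in> {..<m} \<rightarrow>\<^sub>E carrier G" and C: "C \<in> {..<m} \<rightarrow>\<^sub>E characters G"
  shows "(\<Prod>j<m. C j (\<Otimes>i\<in>{..<m}. f i [^] (reduced_laplacian (Suc m) E $$ (i, j)))) =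
    (\<Prod>e\<in>E. edge_kernel (phase_map m f C) e)"
  unfolding prod_character_laplacian_columns[OF E phase_map_in_rooted_maps[OF f C], symmetric]
proof (intro prod.cong refl)
  fix j assume j: "j \<in> {..<m}"
  have "(\<Otimes>i\<in>{..<m}. f i [^] (reduced_laplacian (Suc m) E $$ (i, j))) =
      (\<Otimes>i\<in>{..<m}. fst (phase_map m f C i) [^] (reduced_laplacian (Suc m) E $$ (i, j)))"
    by (intro finprod_cong') (use f in \<open>auto simp: PiE_iff phase_map_def\<close>)
  then show "C j (\<Otimes>i\<in>{..<m}. f i [^] (reduced_laplacian (Suc m) E $$ (i, j))) =
      snd (phase_map m f C j)
        (\<Otimes>i\<in>{..<m}. fst (phase_map m f C i) [^] (reduced_laplacian (Suc m) E $$ (i, j)))"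
    using j by (simp add: phase_map_def)
qed

end

context finite_comm_group
begin

lemma finite_rooted_maps: "finite (rooted_maps m)"
  by (rule finite_rooted[OF finite_phase_space])

lemma indicator_fourier:
  assumes h: "h \<in> {..<m} \<rightarrow> carrier G"
  shows "(if \<forall>j<m. h j = \<one> then 1 else 0) =
    (\<Sum>C\<in>{..<m} \<rightarrow>\<^sub>E characters G. \<Prod>j<m. C j (h j)) / of_nat (order G) ^ m"
proof -
  have "(\<Sum>C\<in>{..<m} \<rightarrow>\<^sub>E characters G. \<Prod>j<m. C j (h j)) = (\<Prod>j<m. \<Sum>\<xi>\<in>characters G. \<xi> (h j))"
    by (rule prod_sum_PiE[symmetric]) (auto simp: finite_characters)
  also have "\<dots> = (\<Prod>j<m. if h j = \<one> then of_nat (order G) else 0)"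
    using h by (intro prod.cong refl) (auto simp: sum_characters Pi_iff)
  also have "\<dots> = (if \<forall>j<m. h j = \<one> then of_nat (order G) ^ m else 0)"
    by (auto intro: prod_zero)
  finally show ?thesis using order_pos by simp
qed

lemma card_coker_homs_fourier:
  assumes E: "E \<subseteq> possible_edges (Suc m)"
  shows "of_nat (card {f \<in> coker_homs G (reduced_laplacian (Suc m) E). Pr (f ` {..<m})}) =
    (\<Sum>w\<in>{w \<in> rooted_maps m. Pr (fst ` w ` {..<m})}. \<Prod>e\<in>E. edge_kernel w e) / of_nat (order G) ^ m"
proof -
  let ?Q = "{..<m} \<rightarrow>\<^sub>E carrier G" and ?C = "{..<m} \<rightarrow>\<^sub>E characters G"
  define h where "h f j = (\<Otimes>i\<in>{..<m}. f i [^] (reduced_laplacian (Suc m) E $$ (i, j)))" for f j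
  define F where "F w = (if Pr (fst ` w ` {..<m}) then \<Prod>e\<in>E. edge_kernel w e else 0)"
    for w :: "nat \<Rightarrow> 'a \<times> ('a \<Rightarrow> complex)"
  have phase_map: "(if Pr (f ` {..<m}) then \<Prod>j<m. C j (h f j) else 0) = F (phase_map m f C)"
    if f: "f \<in> ?Q" and C: "C \<in> ?C" for f C
  proof -
    have "fst ` phase_map m f C ` {..<m} = f ` {..<m}" by (force simp: image_image phase_map_def)
    then show ?thesis by (simp only: F_def h_def prod_characters_laplacian[OF E f C])
  qed
  have "{f \<in> coker_homs G (reduced_laplacian (Suc m) E). Pr (f ` {..<m})} =
      {f \<in> ?Q. Pr (f ` {..<m}) \<and> (\<forall>j<m. h f j = \<one>)}"
    by (auto simp: coker_homs_def h_def)
  also have "of_nat (card \<dots>) = (\<Sum>f\<in>?Q. if Pr (f ` {..<m}) \<and> (\<forall>j<m. h f j = \<one>) then 1 else 0 :: complex)"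
    by (simp add: sum.If_cases Int_def finite_PiE finite_carrier)
  also have "\<dots> = (\<Sum>f\<in>?Q. if Pr (f ` {..<m}) then (\<Sum>C\<in>?C. \<Prod>j<m. C j (h f j)) / of_nat (order G) ^ m else 0)"
    by (intro sum.cong refl, subst indicator_fourier[symmetric])
       (auto simp: h_def PiE_iff intro!: finprod_closed)
  also have "\<dots> = (\<Sum>f\<in>?Q. \<Sum>C\<in>?C. if Pr (f ` {..<m}) then \<Prod>j<m. C j (h f j) else 0) / of_nat (order G) ^ m"
    unfolding sum_divide_distrib by (intro sum.cong refl) auto
  also have "\<dots> = (\<Sum>w\<in>rooted_maps m. F w) / of_nat (order G) ^ m"
    by (simp add: sum_rooted_maps phase_map)
  also have "(\<Sum>w\<in>rooted_maps m. F w) = (\<Sum>w\<in>{w \<in> rooted_maps m. Pr (fst ` w ` {..<m})}. \<Prod>e\<in>E. edge_kernel w e)"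
    unfolding F_def by (rule sum.inter_filter[symmetric, OF finite_rooted_maps])
  finally show ?thesis .
qed

theorem moment_fourier:
  assumes q: "0 \<le> q" "q \<le> 1"
  shows "complex_of_real (measure_pmf.expectation (erdos_renyi (Suc m) q)
      (\<lambda>E. real (card {f \<in> coker_homs G (reduced_laplacian (Suc m) E). Pr (f ` {..<m})}))) =
    (\<Sum>w\<in>{w \<in> rooted_maps m. Pr (fst ` w ` {..<m})}. graph_weight q (Suc m) w) / of_nat (order G) ^ m"
proof -
  let ?E = "measure_pmf.expectation (erdos_renyi (Suc m) q) :: _ \<Rightarrow> complex"
  let ?W = "{w \<in> rooted_maps m. Pr (fst ` w ` {..<m})}" and ?N = "complex_of_nat (order G) ^ m"
  let ?card = "\<lambda>E. real (card {f \<in> coker_homs G (reduced_laplacian (Suc m) E). Pr (f ` {..<m})})"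
  have "complex_of_real (measure_pmf.expectation (erdos_renyi (Suc m) q) ?card) =
      ?E (\<lambda>E. complex_of_real (?card E))"
    by (rule integral_of_real[OF integrable_erdos_renyi, symmetric])
  also have "\<dots> = ?E (\<lambda>E. (\<Sum>w\<in>?W. \<Prod>e\<in>E. edge_kernel w e) / ?N)"
    by (rule expectation_erdos_renyi_cong) (simp add: card_coker_homs_fourier)
  also have "\<dots> = (\<Sum>w\<in>?W. ?E (\<lambda>E. \<Prod>e\<in>E. edge_kernel w e)) / ?N"
    by (simp add: integrable_erdos_renyi Bochner_Integration.integral_sum)
  finally show ?thesis by (simp add: expectation_erdos_renyi_prod[OF q] graph_weight_def)
qed

end

section \<open>The limit of the moments\<close>

context finite_comm_group
begin

lemma flat_phase_space_iff: "flat (phase_space G) phase_dist U \<longleftrightarrow> U \<subseteq> phase_space G \<and> isotropic U"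
proof (cases "U \<subseteq> phase_space G")
  case True
  then have "phase_dist u v = 0 \<longleftrightarrow> phase_kernel u v = 1" if "u \<in> U" "v \<in> U" for u v
    using phase_dist_eq_0_iff[of u G v] that by blast
  then show ?thesis using True by (simp add: flat_def isotropic_def)
qed (simp add: flat_def)

sublocale energy: energy_kernel "phase_space G" phase_dist "order G"
proof
  show "finite (phase_space G)" by (rule finite_phase_space)
  show "order G > 0" by (rule order_pos)
  show "phase_dist u v = phase_dist v u" for u v by (rule phase_dist_commute)
  fix u v assume "u \<in> phase_space G" "v \<in> phase_space G"
  then have "\<bar>Re (phase_kernel u v)\<bar> \<le> 1"
    using abs_Re_le_cmod[of "phase_kernel u v"] norm_phase_kernel by metis
  then show "0 \<le> phase_dist u v" "phase_dist u v \<le> 2" by (auto simp: phase_dist_def)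
next
  fix U assume flat: "flat (phase_space G) phase_dist U"
  then show "card U \<le> order G" by (auto simp: flat_phase_space_iff intro: card_isotropic_le)
  fix v assume card: "card U = order G" and v: "v \<in> phase_space G - U"
  have "(\<Sum>u\<in>U. phase_dist u v) = card U - Re (\<Sum>u\<in>U. phase_kernel u v)"
    by (simp add: phase_dist_def sum_subtractf)
  also have "(\<Sum>u\<in>U. phase_kernel u v) = 0"
    using flat card v by (intro sum_phase_kernel_maximal_isotropic) (auto simp: flat_phase_space_iff)
  finally show "(\<Sum>u\<in>U. phase_dist u v) = real (order G)" using card by simp
qed

definition stray_mass :: "real \<Rightarrow> nat \<Rightarrow> real" where
  "stray_mass s n = (\<Sum>w\<in>energy.stray_maps n. energy.gibbs s n w) / real (order G) ^ n"

lemma stray_mass_tendsto: "c > 1 \<Longrightarrow> (\<lambda>n. stray_mass (c * ln n / n) n) \<longlonglongrightarrow> 0"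
  unfolding stray_mass_def by (rule energy.sum_stray_maps_tendsto)

lemma graph_weight_not_stray:
  assumes "w \<in> {..<n} \<rightarrow>\<^sub>E phase_space G" "w \<notin> energy.stray_maps n"
  shows "graph_weight q n w = 1"
proof -
  obtain U where U: "U \<in> energy.max_flats" "w ` {..<n} \<subseteq> U"
    using assms unfolding energy.stray_maps_def by blast
  have "isotropic U" using energy.max_flatsD(1)[OF U(1)] by (simp add: flat_phase_space_iff)
  then have "isotropic (w ` {..<n})" by (rule isotropic_subset[OF _ U(2)])
  then show ?thesis by (rule graph_weight_isotropic)
qed

lemma norm_sum_graph_weight_stray_le:
  assumes W: "W \<subseteq> energy.stray_maps n" and s: "s \<le> q * (1 - q)"
  shows "norm (\<Sum>w\<in>W. graph_weight q n w) \<le> real (order G) ^ n * stray_mass s n"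
proof -
  have "norm (graph_weight q n w) \<le> energy.gibbs s n w" if "w \<in> W" for w
  proof -
    have w: "w \<in> {..<n} \<rightarrow>\<^sub>E phase_space G" using subsetD[OF W that] by (simp add: energy.stray_maps_def)
    have "norm (graph_weight q n w) \<le> exp (- (q * (1 - q)) * pair_energy phase_dist n w)"
      by (rule norm_graph_weight_le[OF w])
    also have "\<dots> \<le> energy.gibbs s n w"
      using mult_right_mono[OF s energy.pair_energy_nonneg[OF w]] by (simp add: energy.gibbs_def)
    finally show ?thesis .
  qed
  then have "norm (\<Sum>w\<in>W. graph_weight q n w) \<le> (\<Sum>w\<in>W. energy.gibbs s n w)"
    by (rule sum_norm_le)
  also have "\<dots> \<le> (\<Sum>w\<in>energy.stray_maps n. energy.gibbs s n w)"
    by (rule sum_mono2[OF energy.finite_stray_maps W energy.gibbs_nonneg])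
  also have "\<dots> = real (order G) ^ n * stray_mass s n"
    using order_pos by (simp add: stray_mass_def)
  finally show ?thesis .
qed

theorem moment_approximation:
  assumes q: "0 \<le> q" "q \<le> 1" and s: "s \<le> q * (1 - q)"
  shows "\<bar>measure_pmf.expectation (erdos_renyi (Suc m) q)
      (\<lambda>E. real (card {f \<in> coker_homs G (reduced_laplacian (Suc m) E). Pr (f ` {..<m})}))
    - card ({w \<in> rooted_maps m. Pr (fst ` w ` {..<m})} - energy.stray_maps (Suc m)) / real (order G) ^ m\<bar>
    \<le> order G * stray_mass s (Suc m)"
proof -
  let ?E = "measure_pmf.expectation (erdos_renyi (Suc m) q)
      (\<lambda>E. real (card {f \<in> coker_homs G (reduced_laplacian (Suc m) E). Pr (f ` {..<m})}))"
  let ?W = "{w \<in> rooted_maps m. Pr (fst ` w ` {..<m})}" and ?S = "energy.stray_maps (Suc m)"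
  let ?N = "order G" and ?g = "graph_weight q (Suc m)"
  have finW: "finite ?W" using finite_rooted_maps by simp
  have "sum ?g (?W - ?S) = (\<Sum>w\<in>?W - ?S. 1)"
    by (intro sum.cong refl graph_weight_not_stray) (auto simp: rooted_def)
  then have "sum ?g ?W = of_nat (card (?W - ?S)) + sum ?g (?W \<inter> ?S)"
    using sum.Int_Diff[OF finW, of ?g ?S] by simp
  then have eq: "complex_of_real (?E - card (?W - ?S) / real ?N ^ m) = sum ?g (?W \<inter> ?S) / of_nat ?N ^ m"
    by (simp add: moment_fourier[OF q] add_divide_distrib)
  have "\<bar>?E - card (?W - ?S) / real ?N ^ m\<bar> = norm (complex_of_real (?E - card (?W - ?S) / real ?N ^ m))"
    by (simp only: norm_of_real)
  also have "\<dots> = norm (sum ?g (?W \<inter> ?S)) / real ?N ^ m"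
    unfolding eq by (simp add: norm_divide norm_power)
  also have "\<dots> \<le> (real ?N ^ Suc m * stray_mass s (Suc m)) / real ?N ^ m"
    by (intro divide_right_mono norm_sum_graph_weight_stray_le s) auto
  also have "\<dots> = ?N * stray_mass s (Suc m)" using order_pos by simp
  finally show ?thesis .
qed

end

subsection \<open>Counting the maps into maximal flats\<close>

lemma card_nonsurjective_PiE_le:
  assumes "finite I" "finite A"
  shows "card {g \<in> I \<rightarrow>\<^sub>E A. g ` I \<noteq> A} \<le> card A * (card A - 1) ^ card I"
proof -
  have "{g \<in> I \<rightarrow>\<^sub>E A. g ` I \<noteq> A} \<subseteq> (\<Union>x\<in>A. I \<rightarrow>\<^sub>E (A - {x}))"
  proof
    fix g assume g: "g \<in> {g \<in> I \<rightarrow>\<^sub>E A. g ` I \<noteq> A}"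
    then obtain x where "x \<in> A" "x \<notin> g ` I" by blast
    then show "g \<in> (\<Union>x\<in>A. I \<rightarrow>\<^sub>E (A - {x}))"
      using g by (intro UN_I[of x]) (auto simp: PiE_iff)
  qed
  then have "card {g \<in> I \<rightarrow>\<^sub>E A. g ` I \<noteq> A} \<le> card (\<Union>x\<in>A. I \<rightarrow>\<^sub>E (A - {x}))"
    using assms by (intro card_mono) (auto intro!: finite_PiE)
  also have "\<dots> \<le> (\<Sum>x\<in>A. card (I \<rightarrow>\<^sub>E (A - {x})))" by (rule card_UN_le[OF assms(2)])
  also have "\<dots> = card A * (card A - 1) ^ card I" using assms by (simp add: card_PiE)
  finally show ?thesis .
qed

lemma power_ratio_tendsto:
  fixes x :: "nat \<Rightarrow> real" and L K :: real and N :: nat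
  assumes N_pos: "N > 0" and close: "\<And>m. \<bar>x m - L * N ^ m\<bar> \<le> K * real (N - 1) ^ m"
  shows "(\<lambda>m. x m / N ^ m) \<longlonglongrightarrow> L"
proof (rule LIM_zero_cancel, rule Lim_null_comparison)
  have "\<bar>x m / N ^ m - L\<bar> \<le> K * (real (N - 1) / N) ^ m" for m
  proof -
    have "x m / N ^ m - L = (x m - L * N ^ m) / N ^ m" using N_pos by (simp add: field_simps)
    then have "\<bar>x m / N ^ m - L\<bar> = \<bar>x m - L * N ^ m\<bar> / N ^ m" by simp
    also have "\<dots> \<le> K * real (N - 1) ^ m / N ^ m" by (intro divide_right_mono close) simp
    finally show ?thesis by (simp add: power_divide)
  qed
  then show "\<forall>\<^sub>F m in sequentially. norm (x m / N ^ m - L) \<le> K * (real (N - 1) / N) ^ m" by simp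
  have "(\<lambda>m. K * (real (N - 1) / N) ^ m) \<longlonglongrightarrow> K * 0"
    using N_pos by (intro tendsto_mult tendsto_const LIMSEQ_realpow_zero) auto
  then show "(\<lambda>m. K * (real (N - 1) / N) ^ m) \<longlonglongrightarrow> 0" by simp
qed

lemma (in group) generate_insert_one:
  assumes "A \<subseteq> carrier G"
  shows "generate G (insert \<one> A) = generate G A"
proof
  show "generate G A \<subseteq> generate G (insert \<one> A)" by (intro mono_generate) auto
  show "generate G (insert \<one> A) \<subseteq> generate G A"
    using generate.one generate_is_subgroup[OF assms]
    by (intro generate_subgroup_incl) (auto intro: generate.incl generate.one)
qed

context finite_comm_group
begin

definition rooted_surjections :: "nat \<Rightarrow> (nat \<Rightarrow> 'a) set" where
  "rooted_surjections m = {f \<in> rooted m (carrier G) \<one>. f ` {..<Suc m} = carrier G}"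

definition generating_maps :: "nat \<Rightarrow> (nat \<Rightarrow> 'a \<times> ('a \<Rightarrow> complex)) set" where
  "generating_maps m = {w \<in> rooted_maps m. generate G (fst ` w ` {..<m}) = carrier G}"

definition main_maps :: "nat \<Rightarrow> (nat \<Rightarrow> 'a \<times> ('a \<Rightarrow> complex)) set" where
  "main_maps m = {w \<in> rooted_maps m. fst ` w ` {..<Suc m} = carrier G \<and> isotropic (w ` {..<Suc m})}"

definition graph_map :: "nat \<Rightarrow> (nat \<Rightarrow> 'a) \<times> ('a \<Rightarrow> 'a \<Rightarrow> complex) \<Rightarrow> nat \<Rightarrow> 'a \<times> ('a \<Rightarrow> complex)" where
  "graph_map m = (\<lambda>(f, b). \<lambda>i\<in>{..<Suc m}. (f i, b (f i)))"

lemma graph_map_in_main_maps: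
  assumes f: "f \<in> rooted_surjections m" and b: "b \<in> alt_bichars G"
  shows "graph_map m (f, b) \<in> main_maps m"
proof -
  have fG: "f i \<in> carrier G" if "i < Suc m" for i
    using f that by (auto simp: rooted_surjections_def rooted_def)
  have "graph_map m (f, b) \<in> rooted_maps m"
    using f fG alt_bicharsD(1)[OF b] alt_bichars_one[OF b]
    by (auto simp: graph_map_def rooted_def phase_space_def rooted_surjections_def)
  moreover have "graph_map m (f, b) ` {..<Suc m} = (\<lambda>x. (x, b x)) ` f ` {..<Suc m}"
    by (auto simp: graph_map_def image_image)
  then have image: "graph_map m (f, b) ` {..<Suc m} = (\<lambda>x. (x, b x)) ` carrier G"
    using f by (simp only: rooted_surjections_def mem_Collect_eq)
  moreover have "fst ` graph_map m (f, b) ` {..<Suc m} = carrier G"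
    unfolding image by (simp add: image_image)
  ultimately show ?thesis
    using alt_bichars_graph_isotropic[OF b] unfolding main_maps_def by simp
qed

lemma main_maps_eq_graph_map:
  assumes w: "w \<in> main_maps m"
  obtains f b where "f \<in> rooted_surjections m" "b \<in> alt_bichars G" "graph_map m (f, b) = w"
proof -
  let ?U = "w ` {..<Suc m}" and ?f = "\<lambda>i\<in>{..<Suc m}. fst (w i)"
  have r: "w \<in> rooted_maps m" and onto: "fst ` ?U = carrier G" and iso: "isotropic ?U"
    using w by (auto simp: main_maps_def)
  have "w m = phase_root" using r by (simp add: rooted_def)
  then have "phase_root \<in> ?U" by (metis imageI lessI lessThan_iff)
  moreover have "?U \<subseteq> phase_space G" using rooted_mapsD(1)[OF r] by auto
  ultimately obtain b where b: "b \<in> alt_bichars G" "\<And>u. u \<in> ?U \<Longrightarrow> snd u = b (fst u)"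
    using isotropic_eq_alt_bichars_graph iso onto by metis
  have "?f \<in> rooted_surjections m"
    using onto rooted_mapsD[OF r] by (auto simp: rooted_surjections_def rooted_def image_image)
  moreover have "graph_map m (?f, b) = w"
  proof
    show "graph_map m (?f, b) i = w i" for i
    proof (cases "i < Suc m")
      case True
      then show ?thesis using b(2)[of "w i"] by (simp add: graph_map_def prod_eq_iff)
    next
      case False
      then show ?thesis using r by (auto simp: graph_map_def rooted_def PiE_iff extensional_def)
    qed
  qed
  ultimately show ?thesis using that b(1) by blast
qed

lemma inj_on_graph_map: "inj_on (graph_map m) (rooted_surjections m \<times> alt_bichars G)"
proof (rule inj_onI, clarify)
  fix f b f' b'
  assume f: "f \<in> rooted_surjections m" "f' \<in> rooted_surjections m"
    and b: "b \<in> alt_bichars G" "b' \<in> alt_bichars G" and eq: "graph_map m (f, b) = graph_map m (f', b')"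
  have eq_at: "f i = f' i" "b (f i) = b' (f' i)" if "i < Suc m" for i
    using fun_cong[OF eq, of i] that by (auto simp: graph_map_def)
  have "f = f'"
    by (rule PiE_ext[of f "{..<Suc m}" "\<lambda>_. carrier G" f'])
       (use f eq_at in \<open>auto simp: rooted_surjections_def rooted_def\<close>)
  moreover have "b x = b' x" if "x \<in> carrier G" for x
  proof -
    have "x \<in> f ` {..<Suc m}" using that f(1) by (simp add: rooted_surjections_def)
    then obtain i where "i < Suc m" "x = f i" by blast
    then show ?thesis using eq_at[of i] by metis
  qed
  then have "b = b'" by (rule alt_bichars_eqI[OF b])
  ultimately show "f = f' \<and> b = b'" by simp
qed

lemma card_main_maps: "card (main_maps m) = card (rooted_surjections m) * card (alt_bichars G)"
proof -
  have "graph_map m ` (rooted_surjections m \<times> alt_bichars G) = main_maps m"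
    using graph_map_in_main_maps main_maps_eq_graph_map by (auto simp: image_iff) metis
  then show ?thesis
    using card_image[OF inj_on_graph_map, of m] by (simp add: card_cartesian_product)
qed

lemma card_rooted_surjections:
  "card (rooted_surjections m) \<le> order G ^ m"
  "order G ^ m \<le> card (rooted_surjections m) + order G * (order G - 1) ^ m"
proof -
  let ?R = "rooted m (carrier G) \<one>" and ?S = "rooted_surjections m"
  let ?X = "{g \<in> {..<m} \<rightarrow>\<^sub>E carrier G. g ` {..<m} \<noteq> carrier G}"
  have finR: "finite ?R" by (rule finite_rooted[OF finite_carrier])
  have S: "?S \<subseteq> ?R" by (auto simp: rooted_surjections_def)
  note bij = bij_betw_rooted[OF one_closed, of m]
  have card_R: "card ?R = order G ^ m"
    using bij_betw_same_card[OF bij] by (simp add: card_PiE order_def)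
  show "card ?S \<le> order G ^ m" using card_mono[OF finR S] by (simp add: card_R)
  have finX: "finite ?X" using finite_carrier by (simp add: finite_PiE)
  have "?R - ?S \<subseteq> (\<lambda>g. g(m := \<one>)) ` ?X"
  proof
    fix f assume f: "f \<in> ?R - ?S"
    then obtain g where g: "g \<in> {..<m} \<rightarrow>\<^sub>E carrier G" "f = g(m := \<one>)"
      using bij_betw_imp_surj_on[OF bij] by blast
    have "g ` {..<m} \<subseteq> f ` {..<Suc m}" using g(2) by (auto simp: lessThan_Suc)
    moreover have "f ` {..<Suc m} \<subseteq> carrier G" "f ` {..<Suc m} \<noteq> carrier G"
      using f by (auto simp: rooted_surjections_def rooted_def)
    ultimately have "g \<in> ?X" using g(1) by auto
    then show "f \<in> (\<lambda>g. g(m := \<one>)) ` ?X" using g(2) by blast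
  qed
  then have "card (?R - ?S) \<le> card ?X"
    using finX card_mono[of "(\<lambda>g. g(m := \<one>)) ` ?X" "?R - ?S"] card_image_le[OF finX, of "\<lambda>g. g(m := \<one>)"] by simp
  also have "\<dots> \<le> order G * (order G - 1) ^ m"
    using card_nonsurjective_PiE_le[of "{..<m}" "carrier G"] finite_carrier by (simp add: order_def)
  finally show "order G ^ m \<le> card ?S + order G * (order G - 1) ^ m"
    using card_Diff_subset[OF finite_subset[OF S finR] S] by (simp add: card_R)
qed

lemma rooted_image:
  assumes w: "w \<in> rooted_maps m"
  shows "fst ` w ` {..<Suc m} = insert \<one> (fst ` w ` {..<m})"
    and "fst ` w ` {..<m} \<subseteq> carrier G"
    and "generate G (fst ` w ` {..<Suc m}) = generate G (fst ` w ` {..<m})"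
proof -
  show insert: "fst ` w ` {..<Suc m} = insert \<one> (fst ` w ` {..<m})"
    using rooted_mapsD(4)[OF w] by (simp add: lessThan_Suc)
  show sub: "fst ` w ` {..<m} \<subseteq> carrier G" using rooted_mapsD(2)[OF w] by auto
  show "generate G (fst ` w ` {..<Suc m}) = generate G (fst ` w ` {..<m})"
    unfolding insert by (rule generate_insert_one[OF sub])
qed

lemma main_maps_subset: "main_maps m \<subseteq> generating_maps m - energy.stray_maps (Suc m)"
proof
  fix w assume "w \<in> main_maps m"
  then have r: "w \<in> rooted_maps m" and onto: "fst ` w ` {..<Suc m} = carrier G"
    and iso: "isotropic (w ` {..<Suc m})" by (auto simp: main_maps_def)
  have flat: "flat (phase_space G) phase_dist (w ` {..<Suc m})"
    using rooted_mapsD(1)[OF r] iso by (auto simp: flat_phase_space_iff)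
  have "order G \<le> card (w ` {..<Suc m})"
    unfolding order_def onto[symmetric] by (rule card_image_le) simp
  then have "card (w ` {..<Suc m}) = order G"
    using energy.card_flat_le[OF flat] by (rule order.antisym[rotated])
  then have "w ` {..<Suc m} \<in> energy.max_flats"
    using flat unfolding energy.max_flats_def by blast
  then have "w \<notin> energy.stray_maps (Suc m)" by (auto simp: energy.stray_maps_def)
  moreover have "generate G (fst ` w ` {..<m}) = carrier G"
    using rooted_image(3)[OF r] onto generate_subgroup[OF subgroup_self] by simp
  ultimately show "w \<in> generating_maps m - energy.stray_maps (Suc m)"
    using r by (simp add: generating_maps_def)
qed

lemma generating_not_main_subset:
  "generating_maps m - energy.stray_maps (Suc m) - main_maps m \<subseteq>
    (\<Union>U\<in>energy.max_flats. {w \<in> {..<Suc m} \<rightarrow>\<^sub>E U. w ` {..<Suc m} \<noteq> U})"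
proof
  fix w assume w: "w \<in> generating_maps m - energy.stray_maps (Suc m) - main_maps m"
  then have r: "w \<in> rooted_maps m" and gen: "generate G (fst ` w ` {..<m}) = carrier G"
    by (auto simp: generating_maps_def)
  have wV: "w \<in> {..<Suc m} \<rightarrow>\<^sub>E phase_space G" using r by (simp add: rooted_def)
  obtain U where U: "U \<in> energy.max_flats" "w ` {..<Suc m} \<subseteq> U"
    using w wV by (auto simp: energy.stray_maps_def)
  have iso: "U \<subseteq> phase_space G" "isotropic U"
    using energy.max_flatsD(1)[OF U(1)] by (simp_all add: flat_phase_space_iff)
  have "w ` {..<Suc m} \<noteq> U"
  proof
    assume eq: "w ` {..<Suc m} = U"
    have "fst ` U = carrier G"
      using maximal_isotropic_onto[OF iso energy.max_flatsD(4)[OF U(1)]] rooted_image[OF r] gen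
      unfolding eq by simp
    then have "w \<in> main_maps m" using r iso(2) eq by (simp add: main_maps_def)
    then show False using w by blast
  qed
  moreover have "w \<in> {..<Suc m} \<rightarrow>\<^sub>E U" using U(2) wV by (auto simp: PiE_iff)
  ultimately show "w \<in> (\<Union>U\<in>energy.max_flats. {w \<in> {..<Suc m} \<rightarrow>\<^sub>E U. w ` {..<Suc m} \<noteq> U})"
    using U(1) by blast
qed

lemma card_generating_not_stray_le:
  "card (generating_maps m - energy.stray_maps (Suc m)) \<le>
    card (main_maps m) + card energy.max_flats * (order G * (order G - 1) ^ Suc m)"
proof -
  let ?G = "generating_maps m - energy.stray_maps (Suc m)"
  let ?X = "\<lambda>U. {w \<in> {..<Suc m} \<rightarrow>\<^sub>E U. w ` {..<Suc m} \<noteq> U}"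
  have finX: "finite (?X U)" if "U \<in> energy.max_flats" for U
    using energy.max_flatsD(3)[OF that] by (simp add: finite_PiE)
  have "card (?G - main_maps m) \<le> card (\<Union>U\<in>energy.max_flats. ?X U)"
    using finX energy.finite_max_flats by (intro card_mono generating_not_main_subset) auto
  also have "\<dots> \<le> (\<Sum>U\<in>energy.max_flats. card (?X U))"
    by (rule card_UN_le[OF energy.finite_max_flats])
  also have "\<dots> \<le> (\<Sum>U\<in>energy.max_flats. order G * (order G - 1) ^ Suc m)"
  proof (rule sum_mono)
    fix U assume U: "U \<in> energy.max_flats"
    show "card (?X U) \<le> order G * (order G - 1) ^ Suc m"
      using card_nonsurjective_PiE_le[of "{..<Suc m}" U] energy.max_flatsD(3,4)[OF U] by simp
  qed
  finally have "card (?G - main_maps m) \<le> card energy.max_flats * (order G * (order G - 1) ^ Suc m)" by simp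
  moreover have finG: "finite ?G" using finite_rooted_maps by (simp add: generating_maps_def)
  have "card ?G = card (main_maps m) + card (?G - main_maps m)"
    using card_Diff_subset[OF finite_subset[OF main_maps_subset finG] main_maps_subset]
      card_mono[OF finG main_maps_subset] by simp
  ultimately show ?thesis by simp
qed

lemma generating_maps_ratio_tendsto:
  "(\<lambda>m. card (generating_maps m - energy.stray_maps (Suc m)) / real (order G) ^ m)
    \<longlonglongrightarrow> card (alt_bichars G)"
  unfolding of_nat_power[symmetric]
proof (rule power_ratio_tendsto[OF order_pos])
  let ?N = "order G" and ?A = "card (alt_bichars G)" and ?M = "card energy.max_flats"
  fix m
  let ?g = "card (generating_maps m - energy.stray_maps (Suc m))" and ?s = "card (rooted_surjections m)"
  have "finite (generating_maps m - energy.stray_maps (Suc m))"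
    using finite_rooted_maps by (simp add: generating_maps_def)
  then have lower: "?s * ?A \<le> ?g"
    unfolding card_main_maps[symmetric] by (rule card_mono[OF _ main_maps_subset])
  have upper: "?g \<le> ?s * ?A + ?M * (?N * (?N - 1) ^ Suc m)"
    using card_generating_not_stray_le by (simp add: card_main_maps)
  define P where "P = ?M * (?N * (?N - 1) ^ Suc m)"
  define Q where "Q = ?A * (?N * (?N - 1) ^ m)"
  have "?A * ?N ^ m \<le> ?A * (?s + ?N * (?N - 1) ^ m)" "?s * ?A \<le> ?N ^ m * ?A"
    by (rule mult_le_mono2[OF card_rooted_surjections(2)], rule mult_le_mono1[OF card_rooted_surjections(1)])
  with lower upper have "?g \<le> ?A * ?N ^ m + P" "?A * ?N ^ m \<le> ?g + Q"
    by (simp_all only: P_def[symmetric] Q_def[symmetric] add_mult_distrib2 mult.commute[of _ ?A])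
  then have "real ?g \<le> real (?A * ?N ^ m) + P" "real (?A * ?N ^ m) \<le> real ?g + Q"
    by (simp_all only: of_nat_le_iff flip: of_nat_add)
  then have "\<bar>real ?g - real ?A * real (?N ^ m)\<bar> \<le> real P + real Q" by simp
  also have "\<dots> = (real ?M * ?N * real (?N - 1) + real ?A * ?N) * real (?N - 1) ^ m"
    by (simp only: P_def Q_def of_nat_mult of_nat_power power_Suc distrib_right distrib_left mult_ac)
  finally show "\<bar>real ?g - real ?A * real (?N ^ m)\<bar> \<le>
      (real ?M * ?N * real (?N - 1) + real ?A * ?N) * real (?N - 1) ^ m" .
qed

lemma card_not_stray_le:
  "card (rooted_maps m - energy.stray_maps (Suc m)) \<le> card energy.max_flats * order G ^ Suc m"
proof -
  have "rooted_maps m - energy.stray_maps (Suc m) \<subseteq> (\<Union>U\<in>energy.max_flats. {..<Suc m} \<rightarrow>\<^sub>E U)"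
  proof
    fix w assume w: "w \<in> rooted_maps m - energy.stray_maps (Suc m)"
    then have wV: "w \<in> {..<Suc m} \<rightarrow>\<^sub>E phase_space G" by (simp add: rooted_def)
    then obtain U where "U \<in> energy.max_flats" "w ` {..<Suc m} \<subseteq> U"
      using w by (auto simp: energy.stray_maps_def)
    then show "w \<in> (\<Union>U\<in>energy.max_flats. {..<Suc m} \<rightarrow>\<^sub>E U)"
      using wV by (intro UN_I[of U]) (auto simp: PiE_iff)
  qed
  then have "card (rooted_maps m - energy.stray_maps (Suc m)) \<le> card (\<Union>U\<in>energy.max_flats. {..<Suc m} \<rightarrow>\<^sub>E U)"
    using energy.finite_max_flats energy.max_flatsD(3) by (intro card_mono) (auto intro!: finite_PiE)
  also have "\<dots> \<le> (\<Sum>U\<in>energy.max_flats. card ({..<Suc m} \<rightarrow>\<^sub>E U))"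
    by (rule card_UN_le[OF energy.finite_max_flats])
  also have "\<dots> = card energy.max_flats * order G ^ Suc m"
    by (simp add: card_PiE energy.max_flatsD(4))
  finally show ?thesis .
qed

end

subsection \<open>Convergence and boundedness\<close>

abbreviation expected_surs :: "('a, 'b) monoid_scheme \<Rightarrow> nat \<Rightarrow> real \<Rightarrow> real" where
  "expected_surs G n q \<equiv> measure_pmf.expectation (erdos_renyi n q)
     (\<lambda>E. real (card (coker_surs G (reduced_laplacian n E))))"

abbreviation expected_homs :: "('a, 'b) monoid_scheme \<Rightarrow> nat \<Rightarrow> real \<Rightarrow> real" where
  "expected_homs G n q \<equiv> measure_pmf.expectation (erdos_renyi n q)
     (\<lambda>E. real (card (coker_homs G (reduced_laplacian n E))))"

definition supercritical :: "real \<Rightarrow> (nat \<Rightarrow> real) \<Rightarrow> bool" where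
  "supercritical c q \<longleftrightarrow> c > 1 \<and>
     (\<forall>\<^sub>F n in sequentially. 0 \<le> q n \<and> q n \<le> 1 \<and> c * ln n / n \<le> q n * (1 - q n))"

context finite_comm_group
begin

lemma supercritical_stray_mass_tendsto:
  assumes "supercritical c q"
  shows "(\<lambda>m. order G * stray_mass (c * ln (Suc m) / Suc m) (Suc m)) \<longlonglongrightarrow> 0"
  using assms LIMSEQ_Suc[OF tendsto_mult_right_zero[OF stray_mass_tendsto]]
  by (simp add: supercritical_def)

lemma supercritical_eventually_Suc:
  assumes "supercritical c q"
  shows "\<forall>\<^sub>F m in sequentially. 0 \<le> q (Suc m) \<and> q (Suc m) \<le> 1 \<and>
    c * ln (Suc m) / Suc m \<le> q (Suc m) * (1 - q (Suc m))"
  using assms unfolding supercritical_def by (subst eventually_sequentially_Suc) auto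

theorem expected_surs_tendsto:
  assumes q: "supercritical c q"
  shows "(\<lambda>n. expected_surs G n (q n)) \<longlonglongrightarrow> card (alt_bichars G)"
proof (rule LIMSEQ_imp_Suc, rule Lim_transform[OF generating_maps_ratio_tendsto], rule Lim_null_comparison)
  show "\<forall>\<^sub>F m in sequentially. norm (expected_surs G (Suc m) (q (Suc m)) -
      card (generating_maps m - energy.stray_maps (Suc m)) / real (order G) ^ m) \<le>
      order G * stray_mass (c * ln (Suc m) / Suc m) (Suc m)"
    using supercritical_eventually_Suc[OF q]
  proof eventually_elim
    case (elim m)
    then show ?case
      using moment_approximation[of "q (Suc m)" _ m "\<lambda>A. generate G A = carrier G"]
      by (simp add: coker_surs_def generating_maps_def)
  qed
qed (rule supercritical_stray_mass_tendsto[OF q])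

theorem expected_homs_bounded:
  assumes q: "supercritical c q"
  shows "\<exists>B. \<forall>\<^sub>F n in sequentially. expected_homs G n (q n) \<le> B"
proof -
  let ?B = "1 + card energy.max_flats * order G"
  have "\<forall>\<^sub>F m in sequentially. order G * stray_mass (c * ln (Suc m) / Suc m) (Suc m) < 1"
    using supercritical_stray_mass_tendsto[OF q] by (rule order_tendstoD) simp
  then have "\<forall>\<^sub>F m in sequentially. expected_homs G (Suc m) (q (Suc m)) \<le> ?B"
    using supercritical_eventually_Suc[OF q]
  proof eventually_elim
    case (elim m)
    have "real (card (rooted_maps m - energy.stray_maps (Suc m))) \<le>
        real (card energy.max_flats * order G ^ Suc m)"
      by (intro of_nat_mono card_not_stray_le)
    then have "card (rooted_maps m - energy.stray_maps (Suc m)) / real (order G) ^ m \<le>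
        card energy.max_flats * order G"
      using order_pos by (simp add: divide_le_eq mult_ac)
    moreover have "\<bar>expected_homs G (Suc m) (q (Suc m)) -
        card (rooted_maps m - energy.stray_maps (Suc m)) / real (order G) ^ m\<bar> \<le>
        order G * stray_mass (c * ln (Suc m) / Suc m) (Suc m)"
      using moment_approximation[of "q (Suc m)" _ m "\<lambda>_. True"] elim(2) by simp
    ultimately show ?case using elim(1) by simp
  qed
  then have "\<forall>\<^sub>F n in sequentially. expected_homs G n (q n) \<le> ?B"
    by (subst (asm) eventually_sequentially_Suc)
  then show ?thesis by blast
qed

end

section \<open>The exterior square\<close>

subsection \<open>Generators and torsion\<close>

lemma (in comm_group) generate_insert_subset:
  assumes "x \<in> carrier G" "S \<subseteq> carrier G"
  shows "generate G (insert x S) \<subseteq> generate G {x} <#> generate G S"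
proof (rule generate_subgroup_incl)
  show "subgroup (generate G {x} <#> generate G S) G"
    using assms by (intro mult_subgroups generate_is_subgroup) auto
  have product: "a \<otimes> b \<in> generate G {x} <#> generate G S" if "a \<in> generate G {x}" "b \<in> generate G S" for a b
    using that by (auto simp: set_mult_def)
  have "x \<in> generate G {x} <#> generate G S"
    using product[OF generate.incl generate.one, of x] assms by simp
  moreover have "s \<in> generate G {x} <#> generate G S" if "s \<in> S" for s
    using product[OF generate.one generate.incl[OF that]] assms that by auto
  ultimately show "insert x S \<subseteq> generate G {x} <#> generate G S" by blast
qed

lemma (in comm_group) finite_generate_torsion:
  assumes "finite S" "S \<subseteq> carrier G" "n > (0::nat)" "\<And>x. x \<in> S \<Longrightarrow> x [^] n = \<one>"
  shows "finite (generate G S)"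
  using assms
proof (induction S rule: finite_induct)
  case empty
  then show ?case by (simp add: generate_empty)
next
  case (insert x S)
  have x: "x \<in> carrier G" and S: "S \<subseteq> carrier G" using insert.prems by auto
  have "finite (generate G {x})"
    using finite_cyclic_subgroup[OF x] insert.prems x by (auto simp: carrier_subgroup_generated)
  moreover have "finite (generate G S)" using insert by auto
  ultimately have "finite ((\<lambda>(a, b). a \<otimes> b) ` (generate G {x} \<times> generate G S))" by blast
  then show ?case
    by (rule finite_subset[rotated]) (use generate_insert_subset[OF x S] in \<open>auto simp: set_mult_def\<close>)
qed

lemma generate_frag_of:
  "generate (free_Abelian_group S) (frag_of ` S) = carrier (free_Abelian_group S)"
proof -
  let ?F = "free_Abelian_group S"
  have gen: "subgroup (generate ?F (frag_of ` S)) ?F"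
    by (rule group.generate_is_subgroup) auto
  have "u \<in> generate ?F (frag_of ` S)" if "Poly_Mapping.keys u \<subseteq> S" for u
  proof (rule free_Abelian_group_induct[OF that])
    show "0 \<in> generate ?F (frag_of ` S)" using subgroup.one_closed[OF gen] by simp
    show "x - y \<in> generate ?F (frag_of ` S)"
      if "Poly_Mapping.keys y \<subseteq> S" "x \<in> generate ?F (frag_of ` S)" "y \<in> generate ?F (frag_of ` S)" for x y
      using subgroup.m_closed[OF gen that(2) subgroup.m_inv_closed[OF gen that(3)]] that(1) by simp
  qed (auto intro: generate.incl)
  then show ?thesis using subgroup.subset[OF gen] by auto
qed

lemma (in comm_group) hom_diff_eq_one_iff:
  assumes h: "h \<in> hom (free_Abelian_group S) G"
    and abc: "a \<in> carrier (free_Abelian_group S)" "b \<in> carrier (free_Abelian_group S)"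
      "c \<in> carrier (free_Abelian_group S)"
  shows "h (a - b - c) = \<one> \<longleftrightarrow> h a = h b \<otimes> h c"
proof -
  have closed: "Poly_Mapping.keys (a - b - c) \<subseteq> S" "Poly_Mapping.keys (b + c) \<subseteq> S"
    using abc keys_diff[of "a - b" c] keys_diff[of a b] keys_add[of b c]
    unfolding carrier_free_Abelian_group_iff by blast+
  note hG = hom_in_carrier[OF h]
  have "h a = h ((a - b - c) \<otimes>\<^bsub>free_Abelian_group S\<^esub> (b \<otimes>\<^bsub>free_Abelian_group S\<^esub> c))" by simp
  also have "\<dots> = h (a - b - c) \<otimes> (h b \<otimes> h c)"
    using closed abc hom_mult[OF h, of "a - b - c" "b + c"] hom_mult[OF h, of b c] by simp
  finally show ?thesis using hG[of b] hG[of c] hG[of "a - b - c"] abc closed(1) by simp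
qed

subsection \<open>Wedges\<close>

context comm_group
begin

abbreviation pair_group :: "('a \<times> 'a \<Rightarrow>\<^sub>0 int) monoid" where
  "pair_group \<equiv> free_Abelian_group (carrier G \<times> carrier G)"

abbreviation tensor_square :: "('a \<times> 'a \<Rightarrow>\<^sub>0 int) set monoid" where
  "tensor_square \<equiv> tensor_group G G"

definition tensor_relators :: "('a \<times> 'a \<Rightarrow>\<^sub>0 int) set" where
  "tensor_relators = {frag_of (x \<otimes> x', y) - frag_of (x, y) - frag_of (x', y) | x x' y.
         x \<in> carrier G \<and> x' \<in> carrier G \<and> y \<in> carrier G} \<union>
      {frag_of (x, y \<otimes> y') - frag_of (x, y) - frag_of (x, y') | x y y'.
         x \<in> carrier G \<and> y \<in> carrier G \<and> y' \<in> carrier G}"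

definition tensor_diagonal :: "('a \<times> 'a \<Rightarrow>\<^sub>0 int) set set" where
  "tensor_diagonal = generate tensor_square {pure_tensor G G x x | x. x \<in> carrier G}"

lemma tensor_relators_carrier: "tensor_relators \<subseteq> carrier pair_group"
proof -
  have "a - b \<in> carrier pair_group" if "a \<in> carrier pair_group" "b \<in> carrier pair_group" for a b
    using that keys_diff[of a b] by auto
  then show ?thesis
    unfolding tensor_relators_def by (auto simp del: carrier_free_Abelian_group_iff)
qed

lemma tensor_relations_eq: "tensor_relations G G = generate pair_group tensor_relators"
  by (simp add: tensor_relations_def tensor_relators_def)

lemma tensor_relations_subgroup: "subgroup (tensor_relations G G) pair_group"
  unfolding tensor_relations_eq by (rule group.generate_is_subgroup[OF _ tensor_relators_carrier]) simp

lemma group_hom_to_tensor_square: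
  "group_hom pair_group tensor_square (\<lambda>u. tensor_relations G G #>\<^bsub>pair_group\<^esub> u)"
  unfolding tensor_group_def
  by (rule comm_group.group_hom_Mod[OF abelian_free_Abelian_group tensor_relations_subgroup])

lemma comm_group_tensor_square: "comm_group tensor_square"
  unfolding tensor_group_def
  by (rule comm_group.abelian_FactGroup[OF abelian_free_Abelian_group tensor_relations_subgroup])

lemma pure_tensor_carrier:
  "x \<in> carrier G \<Longrightarrow> y \<in> carrier G \<Longrightarrow> pure_tensor G G x y \<in> carrier tensor_square"
  unfolding pure_tensor_def by (rule group_hom.hom_closed[OF group_hom_to_tensor_square]) simp

lemma tensor_diagonal_subgroup: "subgroup tensor_diagonal tensor_square"
  unfolding tensor_diagonal_def using comm_group_tensor_square pure_tensor_carrier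
  by (intro group.generate_is_subgroup) (auto simp: comm_group_def)

lemma exterior_square_eq: "exterior_square G = tensor_square Mod tensor_diagonal"
  by (simp add: exterior_square_def tensor_diagonal_def)

lemma group_hom_to_exterior_square:
  "group_hom tensor_square (exterior_square G) (\<lambda>t. tensor_diagonal #>\<^bsub>tensor_square\<^esub> t)"
  unfolding exterior_square_eq
  by (rule comm_group.group_hom_Mod[OF comm_group_tensor_square tensor_diagonal_subgroup])

lemma comm_group_exterior_square: "comm_group (exterior_square G)"
  unfolding exterior_square_eq
  by (rule comm_group.abelian_FactGroup[OF comm_group_tensor_square tensor_diagonal_subgroup])

definition wedge_hom :: "('a \<times> 'a \<Rightarrow>\<^sub>0 int) \<Rightarrow> ('a \<times> 'a \<Rightarrow>\<^sub>0 int) set set" where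
  "wedge_hom u = tensor_diagonal #>\<^bsub>tensor_square\<^esub> (tensor_relations G G #>\<^bsub>pair_group\<^esub> u)"

definition wedge :: "'a \<Rightarrow> 'a \<Rightarrow> ('a \<times> 'a \<Rightarrow>\<^sub>0 int) set set" where
  "wedge x y = wedge_hom (frag_of (x, y))"

lemma group_hom_wedge_hom: "group_hom pair_group (exterior_square G) wedge_hom"
proof -
  interpret T: group_hom pair_group tensor_square "\<lambda>u. tensor_relations G G #>\<^bsub>pair_group\<^esub> u"
    by (rule group_hom_to_tensor_square)
  interpret W: group_hom tensor_square "exterior_square G" "\<lambda>t. tensor_diagonal #>\<^bsub>tensor_square\<^esub> t"
    by (rule group_hom_to_exterior_square)
  show ?thesis
    using Group.hom_compose[OF T.homh W.homh]
    by (simp add: group_homI W.H.is_group comp_def wedge_hom_def[abs_def])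
qed

lemma generate_wedges:
  "generate (exterior_square G) ((\<lambda>(x, y). wedge x y) ` (carrier G \<times> carrier G)) =
    carrier (exterior_square G)"
proof -
  interpret group_hom pair_group "exterior_square G" wedge_hom by (rule group_hom_wedge_hom)
  have "(\<lambda>(x, y). wedge x y) ` (carrier G \<times> carrier G) = wedge_hom ` frag_of ` (carrier G \<times> carrier G)"
    by (auto simp: wedge_def image_iff)
  moreover have "wedge_hom ` carrier pair_group = carrier (exterior_square G)"
    by (simp add: exterior_square_eq tensor_group_def carrier_FactGroup wedge_hom_def[abs_def] image_image)
  moreover have "frag_of ` (carrier G \<times> carrier G) \<subseteq> carrier pair_group" by auto
  ultimately show ?thesis using generate_img by (simp only: generate_frag_of)
qed

lemma wedge_carrier: "x \<in> carrier G \<Longrightarrow> y \<in> carrier G \<Longrightarrow> wedge x y \<in> carrier (exterior_square G)"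
  unfolding wedge_def by (rule group_hom.hom_closed[OF group_hom_wedge_hom]) simp

lemma wedge_hom_relator:
  assumes "r \<in> tensor_relators"
  shows "wedge_hom r = \<one>\<^bsub>exterior_square G\<^esub>"
proof -
  have "r \<in> tensor_relations G G" unfolding tensor_relations_eq by (rule generate.incl[OF assms])
  then have "tensor_relations G G #>\<^bsub>pair_group\<^esub> r = \<one>\<^bsub>tensor_square\<^esub>"
    using group.coset_join2[OF _ _ tensor_relations_subgroup, of r] tensor_relators_carrier assms
    by (simp add: tensor_group_def subset_iff)
  then show ?thesis
    using group_hom.hom_one[OF group_hom_to_exterior_square] by (simp add: wedge_hom_def)
qed

lemma wedge_self:
  assumes x: "x \<in> carrier G"
  shows "wedge x x = \<one>\<^bsub>exterior_square G\<^esub>"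
proof -
  have "pure_tensor G G x x \<in> tensor_diagonal"
    unfolding tensor_diagonal_def by (rule generate.incl) (use x in auto)
  then have "tensor_diagonal #>\<^bsub>tensor_square\<^esub> pure_tensor G G x x = tensor_diagonal"
    using group.coset_join2[OF _ _ tensor_diagonal_subgroup] comm_group_tensor_square
      pure_tensor_carrier[OF x x] by (simp add: comm_group_def)
  then show ?thesis by (simp add: wedge_def wedge_hom_def pure_tensor_def exterior_square_eq)
qed

lemma wedge_mult:
  assumes "x \<in> carrier G" "y \<in> carrier G" "z \<in> carrier G"
  shows "wedge (x \<otimes> y) z = wedge x z \<otimes>\<^bsub>exterior_square G\<^esub> wedge y z"
    and "wedge z (x \<otimes> y) = wedge z x \<otimes>\<^bsub>exterior_square G\<^esub> wedge z y"
proof -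
  note split = comm_group.hom_diff_eq_one_iff[OF comm_group_exterior_square
      group_hom.homh[OF group_hom_wedge_hom]]
  have "frag_of (x \<otimes> y, z) - frag_of (x, z) - frag_of (y, z) \<in> tensor_relators"
    unfolding tensor_relators_def using assms by blast
  from wedge_hom_relator[OF this]
  show "wedge (x \<otimes> y) z = wedge x z \<otimes>\<^bsub>exterior_square G\<^esub> wedge y z"
    unfolding wedge_def using assms by (subst (asm) split) auto
  have "frag_of (z, x \<otimes> y) - frag_of (z, x) - frag_of (z, y) \<in> tensor_relators"
    unfolding tensor_relators_def using assms by blast
  from wedge_hom_relator[OF this]
  show "wedge z (x \<otimes> y) = wedge z x \<otimes>\<^bsub>exterior_square G\<^esub> wedge z y"
    unfolding wedge_def using assms by (subst (asm) split) auto
qed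

lemma wedge_pow:
  assumes "x \<in> carrier G" "y \<in> carrier G"
  shows "wedge (x [^] (n::nat)) y = wedge x y [^]\<^bsub>exterior_square G\<^esub> n"
proof -
  interpret W: comm_group "exterior_square G" by (rule comm_group_exterior_square)
  have "(\<lambda>x. wedge x y) \<in> hom G (exterior_square G)"
    using assms(2) by (auto simp: hom_def wedge_carrier wedge_mult)
  then interpret group_hom G "exterior_square G" "\<lambda>x. wedge x y"
    by (simp add: group_homI is_group W.is_group)
  show ?thesis by (rule hom_nat_pow[OF assms(1)])
qed

subsection \<open>The universal property\<close>

lemma pair_group_hom_eq_one_on_relations:
  assumes B: "comm_group B" and h: "h \<in> hom pair_group B"
    and left: "\<And>x x' y. x \<in> carrier G \<Longrightarrow> x' \<in> carrier G \<Longrightarrow> y \<in> carrier G \<Longrightarrow>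
      h (frag_of (x \<otimes> x', y)) = h (frag_of (x, y)) \<otimes>\<^bsub>B\<^esub> h (frag_of (x', y))"
    and right: "\<And>x y y'. x \<in> carrier G \<Longrightarrow> y \<in> carrier G \<Longrightarrow> y' \<in> carrier G \<Longrightarrow>
      h (frag_of (x, y \<otimes> y')) = h (frag_of (x, y)) \<otimes>\<^bsub>B\<^esub> h (frag_of (x, y'))"
    and r: "r \<in> tensor_relations G G"
  shows "h r = \<one>\<^bsub>B\<^esub>"
proof -
  interpret B: comm_group B by (rule B)
  interpret h: group_hom pair_group B h
    using h by (simp add: group_homI B.is_group)
  show ?thesis
  proof (rule h.hom_eq_one_on_generate[OF tensor_relators_carrier _ r[unfolded tensor_relations_eq]])
    fix s assume "s \<in> tensor_relators"
    then show "h s = \<one>\<^bsub>B\<^esub>"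
      unfolding tensor_relators_def by (auto simp: B.hom_diff_eq_one_iff[OF h] left right)
  qed
qed

theorem exterior_square_lift:
  assumes B: "comm_group B"
    and closed: "\<And>x y. x \<in> carrier G \<Longrightarrow> y \<in> carrier G \<Longrightarrow> b x y \<in> carrier B"
    and left: "\<And>x x' y. x \<in> carrier G \<Longrightarrow> x' \<in> carrier G \<Longrightarrow> y \<in> carrier G \<Longrightarrow>
      b (x \<otimes> x') y = b x y \<otimes>\<^bsub>B\<^esub> b x' y"
    and right: "\<And>x y y'. x \<in> carrier G \<Longrightarrow> y \<in> carrier G \<Longrightarrow> y' \<in> carrier G \<Longrightarrow>
      b x (y \<otimes> y') = b x y \<otimes>\<^bsub>B\<^esub> b x y'"
    and alt: "\<And>x. x \<in> carrier G \<Longrightarrow> b x x = \<one>\<^bsub>B\<^esub>"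
  obtains h where "h \<in> hom (exterior_square G) B"
    "\<And>x y. x \<in> carrier G \<Longrightarrow> y \<in> carrier G \<Longrightarrow> h (wedge x y) = b x y"
proof -
  interpret B: comm_group B by (rule B)
  have "(\<lambda>(x, y). b x y) ` (carrier G \<times> carrier G) \<subseteq> carrier B" using closed by auto
  then obtain h0 where h0: "h0 \<in> hom pair_group B"
    "\<And>p. p \<in> carrier G \<times> carrier G \<Longrightarrow> h0 (frag_of p) = (\<lambda>(x, y). b x y) p"
    using B.free_Abelian_group_universal by blast
  interpret h0: group_hom pair_group B h0
    using h0(1) by (simp add: group_homI B.is_group)
  have "tensor_relations G G \<subseteq> kernel pair_group B h0"
    using pair_group_hom_eq_one_on_relations[OF B h0(1)] subgroup.subset[OF tensor_relations_subgroup]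
    by (auto simp: kernel_def h0(2) left right simp del: carrier_free_Abelian_group_iff)
  then obtain h1 where h1: "h1 \<in> hom tensor_square B"
    "\<And>u. u \<in> carrier pair_group \<Longrightarrow> h1 (tensor_relations G G #>\<^bsub>pair_group\<^esub> u) = h0 u"
    using h0.FactGroup_universal_kernel[OF comm_group.subgroup_imp_normal[OF
        abelian_free_Abelian_group tensor_relations_subgroup]] unfolding tensor_group_def by metis
  interpret h1: group_hom tensor_square B h1
    using h1(1) comm_group_tensor_square
    by (simp add: group_homI B.is_group comm_group_def)
  have h1_pure: "h1 (pure_tensor G G x y) = b x y" if "x \<in> carrier G" "y \<in> carrier G" for x y
    using h1(2)[of "frag_of (x, y)"] h0(2)[of "(x, y)"] that by (simp add: pure_tensor_def)
  have "h1 t = \<one>\<^bsub>B\<^esub>" if "t \<in> tensor_diagonal" for t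
    by (rule h1.hom_eq_one_on_generate[OF _ _ that[unfolded tensor_diagonal_def]])
       (auto simp: pure_tensor_carrier h1_pure alt)
  then have "tensor_diagonal \<subseteq> kernel tensor_square B h1"
    using subgroup.subset[OF tensor_diagonal_subgroup] by (auto simp: kernel_def)
  then obtain h2 where h2: "h2 \<in> hom (exterior_square G) B"
    "\<And>t. t \<in> carrier tensor_square \<Longrightarrow> h2 (tensor_diagonal #>\<^bsub>tensor_square\<^esub> t) = h1 t"
    using h1.FactGroup_universal_kernel[OF comm_group.subgroup_imp_normal[OF
        comm_group_tensor_square tensor_diagonal_subgroup]] unfolding exterior_square_eq by metis
  have "h2 (wedge x y) = b x y" if "x \<in> carrier G" "y \<in> carrier G" for x y
    using h2(2)[OF pure_tensor_carrier[OF that]] h1_pure[OF that]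
    by (simp add: wedge_def wedge_hom_def pure_tensor_def)
  with h2(1) show ?thesis by (rule that)
qed

subsection \<open>Characters of the exterior square\<close>

definition wedge_bichar :: "(('a \<times> 'a \<Rightarrow>\<^sub>0 int) set set \<Rightarrow> complex) \<Rightarrow> 'a \<Rightarrow> 'a \<Rightarrow> complex" where
  "wedge_bichar \<xi> = (\<lambda>x\<in>carrier G. \<lambda>y\<in>carrier G. \<xi> (wedge x y))"

lemma wedge_bichar_in_alt_bichars:
  assumes \<xi>: "\<xi> \<in> characters (exterior_square G)"
  shows "wedge_bichar \<xi> \<in> alt_bichars G"
proof -
  interpret W: comm_group "exterior_square G" by (rule comm_group_exterior_square)
  have "wedge_bichar \<xi> x \<in> characters G" if "x \<in> carrier G" for x
    unfolding wedge_bichar_def using that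
    by (intro charactersI) (auto simp: charactersD[OF \<xi>] wedge_carrier wedge_mult)
  then show ?thesis
    by (auto simp: alt_bichars_def wedge_bichar_def charactersD[OF \<xi>] wedge_carrier wedge_mult
        wedge_self W.character_one[OF \<xi>])
qed

lemma inj_on_wedge_bichar: "inj_on wedge_bichar (characters (exterior_square G))"
proof (rule inj_onI)
  interpret W: comm_group "exterior_square G" by (rule comm_group_exterior_square)
  fix \<xi> \<xi>' assume \<xi>: "\<xi> \<in> characters (exterior_square G)" "\<xi>' \<in> characters (exterior_square G)"
    and eq: "wedge_bichar \<xi> = wedge_bichar \<xi>'"
  show "\<xi> = \<xi>'"
  proof (rule characters_eqI[OF \<xi>])
    fix w assume "w \<in> carrier (exterior_square G)"
    then show "\<xi> w = \<xi>' w"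
      unfolding generate_wedges[symmetric]
    proof (rule group_hom.hom_eq_on_generate[OF \<xi>[THEN W.character_group_hom], rotated -1])
      show "(\<lambda>(x, y). wedge x y) ` (carrier G \<times> carrier G) \<subseteq> carrier (exterior_square G)"
        using wedge_carrier by auto
      fix s assume "s \<in> (\<lambda>(x, y). wedge x y) ` (carrier G \<times> carrier G)"
      then obtain x y where xy: "x \<in> carrier G" "y \<in> carrier G" "s = wedge x y" by auto
      show "\<xi> s = \<xi>' s" using fun_cong[OF fun_cong[OF eq, of x], of y] xy by (simp add: wedge_bichar_def)
    qed
  qed
qed

lemma alt_bichars_eq_wedge_bichar:
  assumes b: "b \<in> alt_bichars G"
  obtains \<xi> where "\<xi> \<in> characters (exterior_square G)" "wedge_bichar \<xi> = b"
proof -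
  interpret W: comm_group "exterior_square G" by (rule comm_group_exterior_square)
  note b_char = alt_bicharsD(1)[OF b]
  obtain h where h: "h \<in> hom (exterior_square G) circle_group"
    "\<And>x y. x \<in> carrier G \<Longrightarrow> y \<in> carrier G \<Longrightarrow> h (wedge x y) = b x y"
  proof (rule exterior_square_lift[OF comm_group_circle_group, of b])
    show "b x y \<in> carrier circle_group" if "x \<in> carrier G" "y \<in> carrier G" for x y
      using charactersD(1)[OF b_char[OF that(1)] that(2)] by simp
    show "b (x \<otimes> x') y = b x y \<otimes>\<^bsub>circle_group\<^esub> b x' y"
      if "x \<in> carrier G" "x' \<in> carrier G" "y \<in> carrier G" for x x' y
      using alt_bicharsD(2)[OF b that] by simp
    show "b x (y \<otimes> y') = b x y \<otimes>\<^bsub>circle_group\<^esub> b x y'"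
      if "x \<in> carrier G" "y \<in> carrier G" "y' \<in> carrier G" for x y y'
      using charactersD(2)[OF b_char[OF that(1)] that(2,3)] by simp
    show "b x x = \<one>\<^bsub>circle_group\<^esub>" if "x \<in> carrier G" for x
      using alt_bicharsD(3)[OF b that] by simp
  qed blast
  let ?\<xi> = "restrict h (carrier (exterior_square G))"
  have \<xi>: "?\<xi> \<in> characters (exterior_square G)"
    unfolding characters_def by (rule restrict_in_Hom[OF W.is_group h(1)])
  moreover have "wedge_bichar ?\<xi> = b"
  proof (rule alt_bichars_eqI[OF wedge_bichar_in_alt_bichars[OF \<xi>] b])
    fix x assume x: "x \<in> carrier G"
    show "wedge_bichar ?\<xi> x = b x"
    proof (rule characters_eqI[OF alt_bicharsD(1)[OF wedge_bichar_in_alt_bichars[OF \<xi>] x] b_char[OF x]])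
      show "wedge_bichar ?\<xi> x y = b x y" if "y \<in> carrier G" for y
        using h(2)[OF x that] wedge_carrier[OF x that] x that by (simp add: wedge_bichar_def)
    qed
  qed
  ultimately show ?thesis by (rule that)
qed

end

context finite_comm_group
begin

lemma finite_comm_group_exterior_square: "finite_comm_group (exterior_square G)"
proof -
  interpret W: comm_group "exterior_square G" by (rule comm_group_exterior_square)
  let ?wedges = "(\<lambda>(x, y). wedge x y) ` (carrier G \<times> carrier G)"
  have "finite (generate (exterior_square G) ?wedges)"
  proof (rule W.finite_generate_torsion[OF _ _ order_pos])
    fix w assume "w \<in> ?wedges"
    then obtain x y where xy: "x \<in> carrier G" "y \<in> carrier G" "w = wedge x y" by auto
    have "w [^]\<^bsub>exterior_square G\<^esub> order G = wedge \<one> y"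
      using wedge_pow[OF xy(1,2), of "order G"] xy pow_order_eq_1[OF xy(1)] by simp
    also have "\<dots> = \<one>\<^bsub>exterior_square G\<^esub>" using wedge_pow[OF xy(1,2), of 0] by simp
    finally show "w [^]\<^bsub>exterior_square G\<^esub> order G = \<one>\<^bsub>exterior_square G\<^esub>" .
  qed (use finite_carrier wedge_carrier in auto)
  then show ?thesis
    unfolding generate_wedges
    by (simp add: finite_comm_groupI comm_group_exterior_square)
qed

theorem card_alt_bichars: "card (alt_bichars G) = card (carrier (exterior_square G))"
proof -
  have "wedge_bichar ` characters (exterior_square G) = alt_bichars G"
    using wedge_bichar_in_alt_bichars alt_bichars_eq_wedge_bichar by (auto simp: image_iff) metis
  then have "card (alt_bichars G) = card (characters (exterior_square G))"
    using card_image[OF inj_on_wedge_bichar] by simp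
  then show ?thesis
    using finite_comm_group.card_characters[OF finite_comm_group_exterior_square] by (simp add: order_def)
qed

end

section \<open>Surjections from Sylow parts\<close>

lemma (in group) int_pow_cong:
  assumes x: "x \<in> carrier G" "x [^] (q::nat) = \<one>" and kl: "[k = l] (mod int q)"
  shows "x [^] (k::int) = x [^] l"
proof -
  have "int (ord x) dvd int q" using x pow_eq_id by simp
  also have "int q dvd l - k" using kl by (simp add: cong_iff_dvd_diff dvd_diff_commute)
  finally show ?thesis using int_pow_eq[OF x(1)] by simp
qed

lemma (in group) pow_cong_one:
  assumes x: "x \<in> carrier G" "x [^] (q::nat) = \<one>" and u: "[u = 1] (mod q)"
  shows "x [^] u = x"
proof -
  have "[int u = 1] (mod int q)" using u by (metis cong_int_iff of_nat_1)
  from int_pow_cong[OF x this] show ?thesis using x by (simp add: int_pow_int)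
qed

lemma sylow_part_eq: "sylow_part p S = S\<lparr>carrier := carrier (sylow_part p S)\<rparr>"
  by (simp add: sylow_part_def)

lemma (in group) carrier_sylow_part:
  assumes "prime p"
  shows "carrier (sylow_part p G) = {x \<in> carrier G. \<exists>j. x [^] (p ^ j) = \<one>}"
proof -
  have "(\<exists>j. ord x = p ^ j) \<longleftrightarrow> (\<exists>j. x [^] (p ^ j) = \<one>)" if x: "x \<in> carrier G" for x
    using divides_primepow_nat[OF assms] pow_eq_id[OF x] by (metis dvd_refl)
  then show ?thesis by (auto simp: sylow_part_def)
qed

lemma (in comm_group) sylow_part_subgroup:
  assumes p: "prime p"
  shows "subgroup (carrier (sylow_part p G)) G"
proof (rule subgroupI)
  note carrier = carrier_sylow_part[OF p]
  show "carrier (sylow_part p G) \<subseteq> carrier G" by (auto simp: carrier)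
  show "carrier (sylow_part p G) \<noteq> {}" by (auto simp: carrier intro!: exI[of _ \<one>])
  show "inv a \<in> carrier (sylow_part p G)" if "a \<in> carrier (sylow_part p G)" for a
    using that by (auto simp: carrier nat_pow_inv intro!: exI)
  show "a \<otimes> b \<in> carrier (sylow_part p G)"
    if "a \<in> carrier (sylow_part p G)" "b \<in> carrier (sylow_part p G)" for a b
  proof -
    from that obtain i j where ab: "a \<in> carrier G" "b \<in> carrier G"
      and ij: "a [^] (p ^ i) = \<one>" "b [^] (p ^ j) = \<one>" by (auto simp: carrier)
    have "p ^ i dvd p ^ (i + j)" "p ^ j dvd p ^ (i + j)" by (simp_all add: le_imp_power_dvd)
    then have "a [^] (p ^ (i + j)) = \<one>" "b [^] (p ^ (i + j)) = \<one>"
      using ij ab dvd_trans unfolding pow_eq_id[OF ab(1)] pow_eq_id[OF ab(2)] by blast+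
    then have "(a \<otimes> b) [^] (p ^ (i + j)) = \<one>" using ab by (simp add: nat_pow_distrib)
    then show ?thesis using ab by (auto simp: carrier)
  qed
qed

subsection \<open>Groups of finite exponent\<close>

lemma exists_p_part_exponent:
  assumes p: "prime p" and D: "D > (0::nat)"
  obtains u where "D dvd u * p ^ multiplicity p D" "[u = 1] (mod p ^ (multiplicity p D + k))"
proof -
  have "\<not> is_unit p" using p by auto
  then obtain m where m: "D = p ^ multiplicity p D * m" "\<not> p dvd m"
    using multiplicity_decompose'[of D p] D by (metis gr_implies_not0)
  have coprime: "coprime m (p ^ (multiplicity p D + k))"
    using prime_imp_coprime[OF p m(2)] by (simp add: coprime_commute)
  obtain t where "[m * t = 1] (mod p ^ (multiplicity p D + k))"
    using cong_solve_coprime_nat[OF coprime] by auto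
  moreover have "D dvd m * t * p ^ multiplicity p D"
    by (subst m(1)) (simp add: mult_ac)
  ultimately show ?thesis using that by blast
qed

lemma bij_betw_Hom_retract:
  assumes S: "group S" and P: "subgroup P S"
    and \<rho>: "\<rho> \<in> hom S S" "\<And>x. x \<in> carrier S \<Longrightarrow> \<rho> x \<in> P" "\<And>x. x \<in> P \<Longrightarrow> \<rho> x = x"
    and factors: "\<And>f x. f \<in> hom S G \<Longrightarrow> x \<in> carrier S \<Longrightarrow> f (\<rho> x) = f x"
  shows "bij_betw (\<lambda>f. restrict f P) (Hom S G) (Hom (S\<lparr>carrier := P\<rparr>) G)"
proof (rule bij_betwI[of _ _ _ "\<lambda>h. \<lambda>x\<in>carrier S. h (\<rho> x)"])
  interpret S: group S by (rule S)
  interpret P: subgroup P S by (rule P)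
  show "(\<lambda>f. restrict f P) \<in> Hom S G \<rightarrow> Hom (S\<lparr>carrier := P\<rparr>) G"
    using S.restrict_subgroup_in_Hom[OF P] by (auto simp: Hom_def)
  show "(\<lambda>h. \<lambda>x\<in>carrier S. h (\<rho> x)) \<in> Hom (S\<lparr>carrier := P\<rparr>) G \<rightarrow> Hom S G"
  proof
    fix h assume "h \<in> Hom (S\<lparr>carrier := P\<rparr>) G"
    then show "(\<lambda>x\<in>carrier S. h (\<rho> x)) \<in> Hom S G"
      using \<rho>(1,2) by (simp add: Hom_def hom_def Pi_iff)
  qed
  show "(\<lambda>x\<in>carrier S. restrict f P (\<rho> x)) = f" if "f \<in> Hom S G" for f
  proof (rule extensionalityI[of _ "carrier S"])
    show "f \<in> extensional (carrier S)" using that by (simp add: Hom_def)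
    have "f \<in> hom S G" using that by (simp add: Hom_def)
    then show "(\<lambda>x\<in>carrier S. restrict f P (\<rho> x)) x = f x" if "x \<in> carrier S" for x
      using \<rho>(2) factors that by simp
  qed simp
  show "restrict (\<lambda>x\<in>carrier S. h (\<rho> x)) P = h" if "h \<in> Hom (S\<lparr>carrier := P\<rparr>) G" for h
  proof (rule extensionalityI[of _ P])
    show "h \<in> extensional P" using that by (simp add: Hom_def)
    show "restrict (\<lambda>x\<in>carrier S. h (\<rho> x)) P x = h x" if "x \<in> P" for x
      using \<rho>(3) P.mem_carrier that by simp
  qed (rule restrict_extensional)
qed

lemma card_Sur_retract:
  assumes "group S" and P: "subgroup P S"
    and \<rho>: "\<rho> \<in> hom S S" "\<And>x. x \<in> carrier S \<Longrightarrow> \<rho> x \<in> P" "\<And>x. x \<in> P \<Longrightarrow> \<rho> x = x"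
    and factors: "\<And>f x. f \<in> hom S G \<Longrightarrow> x \<in> carrier S \<Longrightarrow> f (\<rho> x) = f x"
  shows "card (Sur (S\<lparr>carrier := P\<rparr>) G) = card (Sur S G)"
proof -
  have "P = \<rho> ` carrier S"
  proof (intro equalityI subsetI)
    show "x \<in> \<rho> ` carrier S" if "x \<in> P" for x
      using \<rho>(3)[OF that] subgroup.mem_carrier[OF P that] by (intro image_eqI[of x \<rho> x]) simp_all
  qed (use \<rho>(2) in blast)
  then have "f ` P = f ` carrier S" if "f \<in> Hom S G" for f
    using factors[of f] that by (simp add: image_image Hom_def cong: image_cong)
  then have "bij_betw (\<lambda>f. restrict f P) (Sur S G) (Sur (S\<lparr>carrier := P\<rparr>) G)"
    unfolding Sur_eq by (intro bij_betw_Collect[OF bij_betw_Hom_retract[OF assms]]) auto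
  then show ?thesis by (simp add: bij_betw_same_card)
qed

lemma (in group) pow_in_sylow_part:
  assumes p: "prime p" and x: "x \<in> carrier G" "x [^] D = \<one>" and u: "D dvd u * p ^ a"
  shows "x [^] u \<in> carrier (sylow_part p G)"
proof -
  obtain t where "u * p ^ a = D * t" using u by (rule dvdE)
  then have "(x [^] u) [^] (p ^ a) = (x [^] D) [^] t"
    by (simp only: nat_pow_pow[OF x(1)])
  also have "\<dots> = \<one>" using x(2) by simp
  finally show ?thesis using x(1) unfolding carrier_sylow_part[OF p] by blast
qed

lemma (in group) pow_eq_self_of_sylow_part:
  assumes p: "prime p" and D: "D > 0" "x [^] D = \<one>" and x: "x \<in> carrier (sylow_part p G)"
    and u: "[u = 1] (mod p ^ multiplicity p D)"
  shows "x [^] u = x"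
proof -
  obtain j where xG: "x \<in> carrier G" and "x [^] (p ^ j) = \<one>"
    using x unfolding carrier_sylow_part[OF p] by blast
  then have "ord x dvd p ^ j" using pow_eq_id[OF xG, of "p ^ j"] by simp
  then obtain i where i: "ord x = p ^ i" unfolding divides_primepow_nat[OF p] by blast
  have "ord x dvd D" by (rule pow_eq_id[THEN iffD1, OF xG D(2)])
  moreover have "D \<noteq> 0" "\<not> is_unit p" using D(1) p not_prime_unit by blast+
  ultimately have "i \<le> multiplicity p D" unfolding i by (rule multiplicity_geI[rotated 2])
  then have "p ^ i dvd p ^ multiplicity p D" by (rule le_imp_power_dvd)
  then have "x [^] (p ^ multiplicity p D) = \<one>" unfolding pow_eq_id[OF xG] i .
  then show ?thesis by (rule pow_cong_one[OF xG _ u])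
qed

lemma card_Sur_sylow_part:
  assumes p: "prime p" and S: "comm_group S" and G: "group G" and order: "order G = p ^ k"
    and D: "D > (0::nat)" "\<And>x. x \<in> carrier S \<Longrightarrow> x [^]\<^bsub>S\<^esub> D = \<one>\<^bsub>S\<^esub>"
  shows "card (Sur (sylow_part p S) G) = card (Sur S G)"
proof -
  interpret S: comm_group S by (rule S)
  interpret G: group G by (rule G)
  let ?a = "multiplicity p D" and ?P = "carrier (sylow_part p S)"
  have P: "subgroup ?P S" by (rule S.sylow_part_subgroup[OF p])
  obtain u where u: "D dvd u * p ^ ?a" "[u = 1] (mod p ^ (?a + k))"
    using exists_p_part_exponent[OF p D(1)] by blast
  have u_a: "[u = 1] (mod p ^ ?a)" and u_k: "[u = 1] (mod p ^ k)"
    by (rule cong_dvd_modulus_nat[OF u(2)], rule le_imp_power_dvd, simp)+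
  have "card (Sur (S\<lparr>carrier := ?P\<rparr>) G) = card (Sur S G)"
  proof (rule card_Sur_retract[OF S.is_group P, of "\<lambda>x. x [^]\<^bsub>S\<^esub> u"])
    show "(\<lambda>x. x [^]\<^bsub>S\<^esub> u) \<in> hom S S" by (rule homI) (simp_all add: S.nat_pow_distrib)
    show "x [^]\<^bsub>S\<^esub> u \<in> ?P" if "x \<in> carrier S" for x
      by (rule S.pow_in_sylow_part[OF p that D(2)[OF that] u(1)])
    show "x [^]\<^bsub>S\<^esub> u = x" if "x \<in> ?P" for x
      by (rule S.pow_eq_self_of_sylow_part[OF p D(1) D(2)[OF subgroup.mem_carrier[OF P that]] that u_a])
    fix f x assume f: "f \<in> hom S G" and x: "x \<in> carrier S"
    interpret f: group_hom S G f by (rule group_homI[OF S.is_group G.is_group f])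
    have "f (x [^]\<^bsub>S\<^esub> u) = f x [^]\<^bsub>G\<^esub> u" by (rule f.hom_nat_pow[OF x])
    also have "\<dots> = f x"
      using G.pow_cong_one[OF f.hom_closed[OF x] _ u_k] G.pow_order_eq_1[OF f.hom_closed[OF x]]
      by (simp add: order)
    finally show "f (x [^]\<^bsub>S\<^esub> u) = f x" .
  qed
  then show ?thesis unfolding sylow_part_eq[symmetric] .
qed

subsection \<open>Homomorphisms from pure subgroups\<close>

definition roots_unity_group :: "nat \<Rightarrow> complex monoid" where
  "roots_unity_group n = circle_group\<lparr>carrier := {z. norm z = 1 \<and> z ^ n = 1}\<rparr>"

lemma finite_comm_group_roots_unity_group:
  assumes "n > 0"
  shows "finite_comm_group (roots_unity_group n)"
proof -
  have "subgroup {z. norm z = 1 \<and> z ^ n = 1} circle_group"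
  proof (rule circle.subgroupI)
    show "{z::complex. norm z = 1 \<and> z ^ n = 1} \<noteq> {}" using norm_one power_one by blast
    show "inv\<^bsub>circle_group\<^esub> z \<in> {z. norm z = 1 \<and> z ^ n = 1}" if "z \<in> {z. norm z = 1 \<and> z ^ n = 1}" for z
      using that complex_cnj_power[of z n] by simp
  qed (auto simp: norm_mult power_mult_distrib)
  moreover have "finite {z::complex. norm z = 1 \<and> z ^ n = 1}"
    using finite_roots_unity[of n, where 'a = complex] assms by simp
  ultimately show ?thesis
    unfolding roots_unity_group_def
    by (simp add: finite_comm_groupI circle.comm_group_subgroup)
qed

lemma in_Hom_roots_unity_group_iff:
  "\<xi> \<in> Hom S (roots_unity_group n) \<longleftrightarrow> \<xi> \<in> characters S \<and> (\<forall>x\<in>carrier S. \<xi> x ^ n = 1)"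
  by (auto simp: characters_def Hom_def hom_def roots_unity_group_def)

lemma (in comm_group) character_extend_along:
  assumes F: "finite F" "F \<subseteq> carrier G" "generate G F = carrier G"
    and f: "group_hom A G f" and k: "group_hom A circle_group k"
    and kernels: "kernel A G f \<subseteq> kernel A circle_group k"
  obtains \<phi> where "\<phi> \<in> characters G" "\<And>x. x \<in> carrier A \<Longrightarrow> \<phi> (f x) = k x"
proof -
  let ?K = "f ` carrier A"
  obtain \<psi> where \<psi>: "\<psi> \<in> characters (G\<lparr>carrier := ?K\<rparr>)" "\<And>x. x \<in> carrier A \<Longrightarrow> \<psi> (f x) = k x"
    using character_on_image[OF f k kernels] by blast
  have K: "subgroup ?K G" by (rule group_hom.img_is_subgroup[OF f])
  have "generate G (?K \<union> F) = carrier G"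
    using mono_generate[of F "?K \<union> F"] generate_incl[of "?K \<union> F"] F subgroup.subset[OF K] by blast
  then obtain \<phi> where "\<phi> \<in> characters G" "\<And>h. h \<in> ?K \<Longrightarrow> \<phi> h = \<psi> h"
    using character_extend[OF F(1,2) K _ \<psi>(1)] by blast
  then show ?thesis using that \<psi>(2) by simp
qed

lemma (in comm_group) pure_subgroup_character_extend:
  assumes F: "finite F" "F \<subseteq> carrier G" "generate G F = carrier G"
    and P: "subgroup P G" and pure: "\<And>y. y \<in> carrier G \<Longrightarrow> y [^] n \<in> P \<Longrightarrow> y \<in> P"
    and \<psi>: "\<psi> \<in> Hom (G\<lparr>carrier := P\<rparr>) (roots_unity_group n)"
  obtains \<phi> where "\<phi> \<in> Hom G (roots_unity_group n)" "\<And>x. x \<in> P \<Longrightarrow> \<phi> x = \<psi> x"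
proof -
  interpret P: subgroup P G by (rule P)
  interpret GP: group "G\<lparr>carrier := P\<rparr>" by (rule subgroup_imp_group[OF P])
  have \<psi>_char: "\<psi> \<in> characters (G\<lparr>carrier := P\<rparr>)" and \<psi>_pow: "\<And>x. x \<in> P \<Longrightarrow> \<psi> x ^ n = 1"
    using \<psi> by (auto simp: in_Hom_roots_unity_group_iff)
  have \<psi>_mult: "\<psi> (x \<otimes> y) = \<psi> x * \<psi> y" if "x \<in> P" "y \<in> P" for x y
    using charactersD(2)[OF \<psi>_char] that by simp
  let ?A = "(G\<lparr>carrier := P\<rparr>) \<times>\<times> G"
  let ?f = "\<lambda>(x, y). x \<otimes> y [^] n" and ?k = "\<lambda>(x, y::'a). \<psi> x"
  have A: "group ?A" by (rule DirProd_group) (simp_all add: GP.is_group is_group)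
  have "?f \<in> hom ?A G" by (auto simp: hom_def nat_pow_distrib m_ac)
  then have f: "group_hom ?A G ?f"
    using A by (simp add: group_homI is_group)
  have "?k \<in> hom ?A circle_group"
    using charactersD(1)[OF \<psi>_char] by (auto simp: hom_def \<psi>_mult)
  then have k: "group_hom ?A circle_group ?k"
    using A by (simp add: group_homI circle.is_group)
  have kernels: "kernel ?A G ?f \<subseteq> kernel ?A circle_group ?k"
  proof (rule subsetI, clarsimp simp: kernel_def)
    fix x y assume x: "x \<in> P" and y: "y \<in> carrier G" and one: "x \<otimes> y [^] n = \<one>"
    have inv: "y [^] n = inv x" using x y one by (metis P.mem_carrier inv_unique' m_comm nat_pow_closed)
    then have yP: "y \<in> P" using pure[OF y] x by simp
    have "\<psi> (y [^] n) = 1"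
      using GP.character_pow[OF \<psi>_char, of y n] \<psi>_pow[OF yP] yP by (simp add: nat_pow_consistent[symmetric])
    moreover have "\<psi> (x \<otimes> y [^] n) = 1" using one GP.character_one[OF \<psi>_char] by simp
    ultimately show "\<psi> x = 1" using \<psi>_mult[OF x, of "y [^] n"] inv x by simp
  qed
  obtain \<phi> where \<phi>: "\<phi> \<in> characters G" and \<phi>_f: "\<And>z. z \<in> carrier ?A \<Longrightarrow> \<phi> (?f z) = ?k z"
    using character_extend_along[OF F f k kernels] by blast
  have \<phi>_mult: "\<phi> (x \<otimes> y [^] n) = \<psi> x" if "x \<in> P" "y \<in> carrier G" for x y
    using \<phi>_f[of "(x, y)"] that by simp
  have "\<phi> y ^ n = 1" if "y \<in> carrier G" for y
    using \<phi>_mult[OF P.one_closed that] character_pow[OF \<phi> that, of n] GP.character_one[OF \<psi>_char] that by simp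
  then have "\<phi> \<in> Hom G (roots_unity_group n)" using \<phi> by (simp add: in_Hom_roots_unity_group_iff)
  moreover have "\<phi> x = \<psi> x" if "x \<in> P" for x using \<phi>_mult[OF that one_closed] that by simp
  ultimately show ?thesis by (rule that)
qed

lemma (in comm_group) pure_subgroup_dual_extend:
  assumes F: "finite F" "F \<subseteq> carrier G" "generate G F = carrier G"
    and P: "subgroup P G" and pure: "\<And>y. y \<in> carrier G \<Longrightarrow> y [^] order K \<in> P \<Longrightarrow> y \<in> P"
    and K: "finite_comm_group K" and f: "f \<in> Hom (G\<lparr>carrier := P\<rparr>) K" and \<xi>: "\<xi> \<in> characters K"
  shows "\<exists>\<phi>. \<phi> \<in> Hom G (roots_unity_group (order K)) \<and> (\<forall>x\<in>P. \<phi> x = \<xi> (f x))"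
proof -
  interpret K: finite_comm_group K by (rule K)
  have f_closed: "f x \<in> carrier K" if "x \<in> P" for x using f that by (auto simp: Hom_def hom_def)
  have f_mult: "f (x \<otimes> y) = f x \<otimes>\<^bsub>K\<^esub> f y" if "x \<in> P" "y \<in> P" for x y
    using f that by (simp add: Hom_def hom_def)
  have "\<xi> (f x) ^ order K = 1" if "x \<in> P" for x
    using K.character_pow[OF \<xi> f_closed[OF that], of "order K"]
      K.pow_order_eq_1[OF f_closed[OF that]] K.character_one[OF \<xi>] by simp
  moreover have "(\<lambda>x\<in>P. \<xi> (f x)) \<in> characters (G\<lparr>carrier := P\<rparr>)"
    by (rule charactersI) (auto simp: f_closed f_mult charactersD[OF \<xi>] subgroup.m_closed[OF P])
  ultimately have "(\<lambda>x\<in>P. \<xi> (f x)) \<in> Hom (G\<lparr>carrier := P\<rparr>) (roots_unity_group (order K))"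
    by (simp add: in_Hom_roots_unity_group_iff)
  then obtain \<phi> where "\<phi> \<in> Hom G (roots_unity_group (order K))"
    "\<And>x. x \<in> P \<Longrightarrow> \<phi> x = (\<lambda>x\<in>P. \<xi> (f x)) x"
    using pure_subgroup_character_extend[OF F P pure] by blast
  then show ?thesis by auto
qed

lemma card_Hom_pure_subgroup_le:
  fixes S :: "('a, 'b) monoid_scheme" and G :: "('c, 'd) monoid_scheme"
  assumes S: "comm_group S" and F: "finite F" "F \<subseteq> carrier S" "generate S F = carrier S"
    and P: "subgroup P S" and G: "finite_comm_group G"
    and pure: "\<And>y. y \<in> carrier S \<Longrightarrow> y [^]\<^bsub>S\<^esub> order G \<in> P \<Longrightarrow> y \<in> P"
    and fin: "finite (Hom S (roots_unity_group (order G)))"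
  shows "finite (Hom (S\<lparr>carrier := P\<rparr>) G)"
    "card (Hom (S\<lparr>carrier := P\<rparr>) G) \<le> card (Hom S (roots_unity_group (order G))) ^ order G"
proof -
  interpret S: comm_group S by (rule S)
  interpret G: finite_comm_group G by (rule G)
  let ?T = "Hom S (roots_unity_group (order G))" and ?H = "Hom (S\<lparr>carrier := P\<rparr>) G"
  define ext where "ext f \<xi> = (SOME \<phi>. \<phi> \<in> ?T \<and> (\<forall>x\<in>P. \<phi> x = \<xi> (f x)))"
    for f :: "'a \<Rightarrow> 'c" and \<xi>
  have ext: "ext f \<xi> \<in> ?T \<and> (\<forall>x\<in>P. ext f \<xi> x = \<xi> (f x))"
    if f: "f \<in> ?H" and \<xi>: "\<xi> \<in> characters G" for f \<xi>
  proof -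
    have "\<exists>\<phi>. \<phi> \<in> ?T \<and> (\<forall>x\<in>P. \<phi> x = \<xi> (f x))"
      by (rule S.pure_subgroup_dual_extend[OF F P _ G f \<xi>]) (rule pure)
    then show ?thesis unfolding ext_def by (rule someI_ex)
  qed
  define \<Phi> where "\<Phi> f = restrict (ext f) (characters G)" for f
  have into: "\<Phi> ` ?H \<subseteq> characters G \<rightarrow>\<^sub>E ?T" using ext by (auto simp: \<Phi>_def)
  have inj: "inj_on \<Phi> ?H"
  proof (rule inj_onI)
    fix f g assume f: "f \<in> ?H" and g: "g \<in> ?H" and eq: "\<Phi> f = \<Phi> g"
    show "f = g"
    proof (rule Hom_eqI[OF f g])
      fix x assume x: "x \<in> carrier (S\<lparr>carrier := P\<rparr>)"
      show "f x = g x"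
      proof (rule G.characters_separate)
        show "f x \<in> carrier G" "g x \<in> carrier G" using f g x by (auto simp: Hom_def hom_def)
        show "\<xi> (f x) = \<xi> (g x)" if \<xi>: "\<xi> \<in> characters G" for \<xi>
          using fun_cong[OF eq, of \<xi>] ext[OF f \<xi>] ext[OF g \<xi>] x \<xi> by (simp add: \<Phi>_def)
      qed
    qed
  qed
  have finT: "finite (characters G \<rightarrow>\<^sub>E ?T)" using fin G.finite_characters by (intro finite_PiE) auto
  show "finite ?H" by (rule finite_imageD[OF finite_subset[OF into finT] inj])
  show "card ?H \<le> card ?T ^ order G"
    using card_inj_on_le[OF inj into finT] by (simp add: card_PiE G.finite_characters G.card_characters)
qed

lemma finite_comm_group_product_group:
  assumes "finite_comm_group G" "finite I"
  shows "finite_comm_group (product_group I (\<lambda>_. G))"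
proof -
  interpret finite_comm_group G by fact
  have "comm_group (product_group I (\<lambda>_. G))"
    by (rule group.group_comm_groupI) (auto intro!: restrict_ext simp: m_comm PiE_iff)
  then show ?thesis
    using assms(2) finite_carrier
    by (simp add: finite_comm_groupI finite_PiE)
qed

lemma card_Hom_power_le:
  assumes "group S" "finite (Hom S (product_group {..<r} (\<lambda>_. G)))"
  shows "card (Hom S G) ^ r \<le> card (Hom S (product_group {..<r} (\<lambda>_. G)))"
proof -
  interpret S: group S by fact
  let ?\<Phi> = "\<lambda>F. \<lambda>x\<in>carrier S. \<lambda>s\<in>{..<r}. F s x"
  have "inj_on ?\<Phi> ({..<r} \<rightarrow>\<^sub>E Hom S G)"
  proof (rule inj_onI)
    fix F F' assume F: "F \<in> {..<r} \<rightarrow>\<^sub>E Hom S G" and F': "F' \<in> {..<r} \<rightarrow>\<^sub>E Hom S G"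
      and eq: "?\<Phi> F = ?\<Phi> F'"
    show "F = F'"
    proof (rule PiE_ext[OF F F'])
      fix s assume s: "s \<in> {..<r}"
      show "F s = F' s"
      proof (rule Hom_eqI[OF PiE_mem[OF F s] PiE_mem[OF F' s]])
        show "F s x = F' s x" if "x \<in> carrier S" for x
          using fun_cong[OF fun_cong[OF eq, of x], of s] s that by simp
      qed
    qed
  qed
  moreover have "?\<Phi> F \<in> Hom S (product_group {..<r} (\<lambda>_. G))" if F: "F \<in> {..<r} \<rightarrow>\<^sub>E Hom S G" for F
  proof -
    have "F s \<in> hom S G" if "s < r" for s using F that by (auto simp: Hom_def)
    then show ?thesis
      by (auto simp: Hom_def hom_def Pi_iff fun_eq_iff)
  qed
  ultimately have "card ({..<r} \<rightarrow>\<^sub>E Hom S G) \<le> card (Hom S (product_group {..<r} (\<lambda>_. G)))"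
    using assms(2) by (intro card_inj_on_le) auto
  then show ?thesis by (simp add: card_PiE)
qed

lemma card_coker_homs_power_le:
  assumes G: "finite_comm_group G"
  shows "card (coker_homs G L) ^ r \<le> card (coker_homs (product_group {..<r} (\<lambda>_. G)) L)"
proof -
  let ?P = "product_group {..<r} (\<lambda>_. G)"
  interpret G: finite_comm_group G by (rule G)
  interpret P: finite_comm_group ?P by (rule finite_comm_group_product_group[OF G]) simp
  have "finite (Hom (cokernel L) ?P)"
    using bij_betw_finite[OF P.bij_betw_hom_tuple] P.finite_coker_homs by blast
  then show ?thesis
    unfolding G.card_Hom_cokernel[symmetric] P.card_Hom_cokernel[symmetric]
    by (intro card_Hom_power_le group_cokernel)
qed

lemma card_Sur_sylow_part_cokernel_le:
  assumes p: "prime p" and G: "finite_comm_group G" and order: "order G = p ^ k"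
  shows "card (Sur (sylow_part p (cokernel L)) G) \<le>
    card (coker_homs (roots_unity_group (order G)) L) ^ order G"
proof -
  let ?S = "cokernel L" and ?P = "carrier (sylow_part p (cokernel L))" and ?\<mu> = "roots_unity_group (order G)"
  interpret S: comm_group ?S by (rule comm_group_cokernel)
  interpret G: finite_comm_group G by (rule G)
  interpret \<mu>: finite_comm_group ?\<mu> by (rule finite_comm_group_roots_unity_group[OF G.order_pos])
  let ?F = "(\<lambda>i. coset L (unit_vec (dim_row L) i)) ` {..<dim_row L}"
  have F: "finite ?F" "?F \<subseteq> carrier ?S" "generate ?S ?F = carrier ?S"
    by (auto simp: generate_coset_unit_vecs carrier_cokernel)
  have pure: "y \<in> ?P" if y: "y \<in> carrier ?S" and P: "y [^]\<^bsub>?S\<^esub> order G \<in> ?P" for y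
  proof -
    obtain j where "(y [^]\<^bsub>?S\<^esub> (p ^ k)) [^]\<^bsub>?S\<^esub> (p ^ j) = \<one>\<^bsub>?S\<^esub>"
      using P unfolding S.carrier_sylow_part[OF p] order by blast
    then have "y [^]\<^bsub>?S\<^esub> (p ^ (k + j)) = \<one>\<^bsub>?S\<^esub>" using y by (simp add: S.nat_pow_pow power_add)
    then show ?thesis unfolding S.carrier_sylow_part[OF p] using y by blast
  qed
  have fin: "finite (Hom ?S ?\<mu>)"
    using bij_betw_finite[OF \<mu>.bij_betw_hom_tuple] \<mu>.finite_coker_homs by blast
  note homs = card_Hom_pure_subgroup_le[OF S.comm_group_axioms F S.sylow_part_subgroup[OF p] G pure fin]
  have "card (Sur (sylow_part p ?S) G) \<le> card (Hom (sylow_part p ?S) G)"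
    using homs(1) unfolding sylow_part_eq[symmetric] by (intro card_mono) (auto simp: Sur_eq)
  also have "\<dots> \<le> card (Hom ?S ?\<mu>) ^ order G" using homs(2) unfolding sylow_part_eq[symmetric] .
  finally show ?thesis by (simp add: \<mu>.card_Hom_cokernel)
qed

section \<open>Singular Laplacians are rare\<close>

lemma primitive_left_kernel_vector:
  fixes L :: "int mat"
  assumes L: "L \<in> carrier_mat m m" and det: "det L = 0" and p: "\<not> is_unit p"
  obtains w i where "i < m" "\<not> p dvd w i" "\<And>j. j < m \<Longrightarrow> (\<Sum>i<m. w i * L $$ (i, j)) = 0"
proof -
  have "transpose_mat L \<in> carrier_mat m m" using L by simp
  then obtain v where v: "v \<in> carrier_vec m" "v \<noteq> 0\<^sub>v m" "transpose_mat L *\<^sub>v v = 0\<^sub>v m"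
    using det_transpose[OF L] det det_0_iff_vec_prod_zero by metis
  let ?d = "Gcd ((\<lambda>i. v $ i) ` {..<m})"
  define w where "w i = v $ i div ?d" for i
  have v_eq: "v $ i = ?d * w i" if "i < m" for i
    using that by (simp add: w_def)
  obtain i where "i < m" "v $ i \<noteq> 0" using v(1,2) by (metis eq_vecI carrier_vecD index_zero_vec)
  then have gcd_nonzero: "?d \<noteq> 0" by (auto simp: Gcd_0_iff)
  have "\<exists>i<m. \<not> p dvd w i"
  proof (rule ccontr)
    assume "\<not> ?thesis"
    then have "?d * p dvd v $ i" if "i < m" for i using v_eq[OF that] that by simp
    then have "?d * p dvd ?d" by (intro Gcd_greatest) auto
    then show False using p gcd_nonzero by simp
  qed
  then obtain i where "i < m" "\<not> p dvd w i" by blast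
  moreover have "(\<Sum>i<m. w i * L $$ (i, j)) = 0" if j: "j < m" for j
  proof -
    have "?d * (\<Sum>i<m. w i * L $$ (i, j)) = (\<Sum>i<m. L $$ (i, j) * v $ i)"
      unfolding sum_distrib_left by (intro sum.cong refl) (simp add: v_eq mult_ac)
    also have "\<dots> = (transpose_mat L *\<^sub>v v) $ j"
      using L v(1) j by (simp add: scalar_prod_def lessThan_atLeast0)
    finally show ?thesis using v(3) gcd_nonzero j by simp
  qed
  ultimately show ?thesis by (rule that)
qed

lemma (in comm_group) finprod_int_pow:
  assumes "x \<in> carrier G" "finite A"
  shows "(\<Otimes>i\<in>A. x [^] (k i :: int)) = x [^] (\<Sum>i\<in>A. k i)"
  using assms(2,1) by (induction A) (simp_all add: int_pow_mult)

lemma (in comm_group) left_kernel_power_in_coker_homs: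
  assumes L: "L \<in> carrier_mat m m" and x: "x \<in> carrier G"
    and w: "\<And>j. j < m \<Longrightarrow> (\<Sum>i<m. w i * L $$ (i, j)) = 0"
  shows "(\<lambda>i\<in>{..<m}. x [^] (w i :: int)) \<in> coker_homs G L"
proof -
  have "(\<Otimes>i\<in>{..<m}. (\<lambda>i\<in>{..<m}. x [^] w i) i [^] (L $$ (i, j))) = \<one>" if j: "j < m" for j
  proof -
    have "(\<Otimes>i\<in>{..<m}. (\<lambda>i\<in>{..<m}. x [^] w i) i [^] (L $$ (i, j))) =
        (\<Otimes>i\<in>{..<m}. x [^] (w i * L $$ (i, j)))"
      using x by (intro finprod_cong') (auto simp: int_pow_pow)
    also have "\<dots> = \<one>" using x w[OF j] by (simp add: finprod_int_pow)
    finally show ?thesis .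
  qed
  then show ?thesis using L x by (simp add: coker_homs_def)
qed

lemma (in comm_group) generate_eq_carrier_of_prime_order:
  assumes "prime (order G)" "S \<subseteq> carrier G" "x \<in> generate G S" "x \<noteq> \<one>"
  shows "generate G S = carrier G"
  using simple_group.no_real_normal_subgroup[OF prime_order_simple[OF assms(1)]]
    subgroup_imp_normal[OF generate_is_subgroup[OF assms(2)]] assms(3,4) by blast

lemma (in finite_comm_group) card_coker_surs_of_prime_order:
  assumes prime: "prime (order G)" and L: "L \<in> carrier_mat m m" and det: "det L = 0"
  shows "order G - 1 \<le> card (coker_surs G L)"
proof -
  have "\<not> is_unit (int (order G))" using prime by (auto simp: prime_nat_iff)
  from primitive_left_kernel_vector[OF L det this] obtain w i0 where i0: "i0 < m" "\<not> int (order G) dvd w i0"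
    and w: "\<And>j. j < m \<Longrightarrow> (\<Sum>i<m. w i * L $$ (i, j)) = 0" by metis
  have "coprime (w i0) (int (order G))"
    using prime_imp_coprime[OF _ i0(2)] prime by (simp add: coprime_commute)
  then obtain s where s: "[w i0 * s = 1] (mod int (order G))" using cong_solve_coprime_int by blast
  let ?f = "\<lambda>x. \<lambda>i\<in>{..<m}. x [^] w i"
  have recover: "?f x i0 [^] s = x" if x: "x \<in> carrier G" for x
    using int_pow_cong[OF x pow_order_eq_1[OF x] s] x i0(1) by (simp add: int_pow_pow)
  have "card (carrier G - {\<one>}) \<le> card (coker_surs G L)"
  proof (rule card_inj_on_le[of ?f])
    show "inj_on ?f (carrier G - {\<one>})"
    proof (rule inj_onI)
      fix x y assume "x \<in> carrier G - {\<one>}" "y \<in> carrier G - {\<one>}" and eq: "?f x = ?f y"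
      then have "?f x i0 [^] s = x" "?f y i0 [^] s = y" using recover by blast+
      then show "x = y" using eq by simp
    qed
    show "?f ` (carrier G - {\<one>}) \<subseteq> coker_surs G L"
    proof (rule image_subsetI)
      fix x assume x: "x \<in> carrier G - {\<one>}"
      have S: "?f x ` {..<m} \<subseteq> carrier G" using x by auto
      have "?f x i0 [^] s \<in> generate G (?f x ` {..<m})"
        using i0(1) by (intro subgroup_int_pow_closed generate_is_subgroup[OF S] generate.incl imageI) simp
      then have "x \<in> generate G (?f x ` {..<m})" using recover[of x] x by simp
      then have "generate G (?f x ` {..<m}) = carrier G"
        using generate_eq_carrier_of_prime_order[OF prime S] x by blast
      then show "?f x \<in> coker_surs G L"
        using left_kernel_power_in_coker_homs[OF L _ w, of x] L x by (simp add: coker_surs_def)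
    qed
    show "finite (coker_surs G L)"
      by (rule finite_subset[OF _ finite_coker_homs]) (auto simp: coker_surs_def)
  qed
  then show ?thesis by (simp add: order_def)
qed

lemma (in finite_comm_group) alt_bichars_of_prime_order:
  assumes prime: "prime (order G)"
  shows "alt_bichars G \<subseteq> {\<lambda>x\<in>carrier G. trivial_character G}"
proof
  fix b assume b: "b \<in> alt_bichars G"
  have b_eq_one: "b x y = 1" if x: "x \<in> carrier G" and y: "y \<in> carrier G" for x y
  proof (cases "x = \<one>")
    case False
    then have "y \<in> generate G {x}"
      using generate_eq_carrier_of_prime_order[OF prime, of "{x}" x] x y by (auto intro: generate.incl)
    then have "b x y = trivial_character G y"
      using group_hom.hom_eq_on_generate[OF character_group_hom[OF alt_bicharsD(1)[OF b x]]
          character_group_hom[OF trivial_character], of "{x}" y] alt_bicharsD(3)[OF b x] x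
      by (simp add: trivial_character_def)
    then show ?thesis using y by (simp add: trivial_character_def)
  qed (use alt_bichars_one[OF b] y in \<open>simp add: trivial_character_def\<close>)
  have "b x = trivial_character G" if "x \<in> carrier G" for x
    by (rule characters_eqI[OF alt_bicharsD(1)[OF b that] trivial_character])
       (use b_eq_one that in \<open>simp add: trivial_character_def\<close>)
  moreover have "b \<in> extensional (carrier G)" using b by (simp add: alt_bichars_def PiE_def)
  ultimately have "b = (\<lambda>x\<in>carrier G. trivial_character G)"
    by (intro extensionalityI[OF _ restrict_extensional]) auto
  then show "b \<in> {\<lambda>x\<in>carrier G. trivial_character G}" by simp
qed

subsection \<open>The probability of a singular Laplacian\<close>

abbreviation expected_singular :: "(int mat \<Rightarrow> real) \<Rightarrow> nat \<Rightarrow> real \<Rightarrow> real" where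
  "expected_singular f n q \<equiv> measure_pmf.expectation (erdos_renyi n q)
     (\<lambda>E. if det (reduced_laplacian n E) = 0 then f (reduced_laplacian n E) else 0)"

lemma expected_singular_nonneg: "(\<And>L. f L \<ge> 0) \<Longrightarrow> expected_singular f n q \<ge> 0"
  by (intro Bochner_Integration.integral_nonneg) simp

lemma finite_comm_group_integer_mod_group: "n > 0 \<Longrightarrow> finite_comm_group (integer_mod_group n)"
  by (simp add: finite_comm_groupI carrier_integer_mod_group)

lemma (in finite_comm_group) expected_singular_le_expected_surs:
  assumes "prime (order G)"
  shows "real (order G - 1) * expected_singular (\<lambda>_. 1) n q \<le> expected_surs G n q"
proof -
  have "real (order G - 1) * expected_singular (\<lambda>_. 1) n q = measure_pmf.expectation (erdos_renyi n q)
      (\<lambda>E. real (order G - 1) * (if det (reduced_laplacian n E) = 0 then 1 else 0))" by simp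
  also have "\<dots> \<le> expected_surs G n q"
    using card_coker_surs_of_prime_order[OF assms reduced_laplacian_carrier]
    by (intro expectation_erdos_renyi_mono) (simp del: of_nat_diff)
  finally show ?thesis .
qed

theorem expected_singular_one_tendsto:
  assumes q: "supercritical c q"
  shows "(\<lambda>n. expected_singular (\<lambda>_. 1) n (q n)) \<longlonglongrightarrow> 0"
proof (rule tendstoI)
  fix e :: real assume e: "e > 0"
  obtain N :: nat where N: "2 / e < N" using reals_Archimedean2 by blast
  obtain l where l: "prime l" "Suc N < l" using bigger_prime by blast
  let ?Z = "integer_mod_group l"
  interpret Z: finite_comm_group ?Z
    using l(2) by (intro finite_comm_group_integer_mod_group) simp
  have order: "order ?Z = l" using l(2) by (simp add: order_def carrier_integer_mod_group)
  have "card (alt_bichars ?Z) \<le> card {\<lambda>x\<in>carrier ?Z. trivial_character ?Z}"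
    using l(1) order by (intro card_mono Z.alt_bichars_of_prime_order) simp_all
  then have "real (card (alt_bichars ?Z)) < 2" by simp
  with Z.expected_surs_tendsto[OF q]
  have "\<forall>\<^sub>F n in sequentially. expected_surs ?Z n (q n) < 2" by (rule order_tendstoD)
  then show "\<forall>\<^sub>F n in sequentially. dist (expected_singular (\<lambda>_. 1) n (q n)) 0 < e"
  proof eventually_elim
    case (elim n)
    let ?P = "expected_singular (\<lambda>_. 1) n (q n)"
    have P: "?P \<ge> 0" by (rule expected_singular_nonneg) simp
    have "real N * ?P \<le> real (l - 1) * ?P" using l(2) P by (intro mult_right_mono) simp_all
    also have "\<dots> \<le> expected_surs ?Z n (q n)"
      using Z.expected_singular_le_expected_surs[of n "q n"] l(1) by (simp only: order)
    also have "\<dots> < 2" by (rule elim)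
    also have "2 < N * e" using N e by (simp add: divide_less_eq)
    finally have "?P < e" by (rule mult_left_less_imp_less) simp
    then show ?case using P by simp
  qed
qed

lemma expected_singular_le_second_moment:
  assumes T_pos: "T > 0"
  shows "expected_singular f n q \<le>
    measure_pmf.expectation (erdos_renyi n q) (\<lambda>E. (f (reduced_laplacian n E))\<^sup>2) / T
      + T * expected_singular (\<lambda>_. 1) n q"
proof -
  have "z \<le> z\<^sup>2 / T + T" for z
  proof -
    have "2 * z * T \<le> z\<^sup>2 + T\<^sup>2" using sum_squares_bound[of z T] by simp
    moreover have "0 \<le> z\<^sup>2 + T\<^sup>2" by simp
    ultimately have "z * T \<le> z\<^sup>2 + T\<^sup>2" by linarith
    then show ?thesis using T_pos by (simp add: field_simps power2_eq_square)
  qed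
  then have "expected_singular f n q \<le> measure_pmf.expectation (erdos_renyi n q)
      (\<lambda>E. (f (reduced_laplacian n E))\<^sup>2 / T + T * (if det (reduced_laplacian n E) = 0 then 1 else 0))"
    using T_pos by (intro expectation_erdos_renyi_mono) simp
  also have "\<dots> = measure_pmf.expectation (erdos_renyi n q) (\<lambda>E. (f (reduced_laplacian n E))\<^sup>2) / T
      + T * expected_singular (\<lambda>_. 1) n q"
    by (simp add: Bochner_Integration.integral_add[OF integrable_erdos_renyi integrable_erdos_renyi])
  finally show ?thesis .
qed

lemma expected_singular_tendsto_of_second_moment:
  assumes q: "supercritical c q" and f: "\<And>L. f L \<ge> 0"
    and second_moment: "\<forall>\<^sub>F n in sequentially.
      measure_pmf.expectation (erdos_renyi n (q n)) (\<lambda>E. (f (reduced_laplacian n E))\<^sup>2) \<le> B"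
  shows "(\<lambda>n. expected_singular f n (q n)) \<longlonglongrightarrow> 0"
proof (rule tendstoI)
  fix e :: real assume e: "e > 0"
  define T where "T = 2 * \<bar>B\<bar> / e + 1"
  have T_pos: "T > 0" using e by (simp add: T_def add_nonneg_pos)
  have "e / 2 * T = \<bar>B\<bar> + e / 2" using e by (simp add: T_def field_simps)
  then have B_div_T_le: "B / T \<le> e / 2" using e T_pos by (simp add: divide_le_eq)
  have "\<forall>\<^sub>F n in sequentially. T * expected_singular (\<lambda>_. 1) n (q n) < e / 2"
    using tendsto_mult_right_zero[OF expected_singular_one_tendsto[OF q]] e by (intro order_tendstoD(2)) auto
  with second_moment show "\<forall>\<^sub>F n in sequentially. dist (expected_singular f n (q n)) 0 < e"
  proof eventually_elim
    case (elim n)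
    have "expected_singular f n (q n) < e"
      using expected_singular_le_second_moment[OF T_pos, where f = f and n = n and q = "q n"]
        divide_right_mono[OF elim(1) less_imp_le[OF T_pos]] B_div_T_le elim(2)
      by linarith
    moreover have "expected_singular f n (q n) \<ge> 0" using f by (rule expected_singular_nonneg)
    ultimately show ?case by simp
  qed
qed

lemma (in finite_comm_group) expected_singular_homs_tendsto:
  assumes q: "supercritical c q"
  shows "(\<lambda>n. expected_singular (\<lambda>L. real (card (coker_homs G L))) n (q n)) \<longlonglongrightarrow> 0"
proof -
  let ?K = "product_group {..<2::nat} (\<lambda>_. G)"
  interpret K: finite_comm_group ?K
    by (rule finite_comm_group_product_group[OF finite_comm_group_axioms]) simp
  obtain B where B: "\<forall>\<^sub>F n in sequentially. expected_homs ?K n (q n) \<le> B"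
    using K.expected_homs_bounded[OF q] by blast
  have square: "(real (card (coker_homs G L)))\<^sup>2 \<le> real (card (coker_homs ?K L))" for L
    using of_nat_mono[OF card_coker_homs_power_le[OF finite_comm_group_axioms, of L 2], where 'a = real] by simp
  show ?thesis
  proof (rule expected_singular_tendsto_of_second_moment[OF q])
    show "\<forall>\<^sub>F n in sequentially. measure_pmf.expectation (erdos_renyi n (q n))
        (\<lambda>E. (real (card (coker_homs G (reduced_laplacian n E))))\<^sup>2) \<le> B"
      using B
    proof eventually_elim
      case (elim n)
      then show ?case using expectation_erdos_renyi_mono[OF square] by (rule order_trans[rotated])
    qed
  qed simp
qed

section \<open>Moments of the Sylow part of the sandpile group\<close>

abbreviation dual_power :: "('a, 'b) monoid_scheme \<Rightarrow> (nat \<Rightarrow> complex) monoid" where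
  "dual_power G \<equiv> product_group {..<order G} (\<lambda>_. roots_unity_group (order G))"

context finite_comm_group
begin

lemma finite_comm_group_dual_power: "finite_comm_group (dual_power G)"
  by (intro finite_comm_group_product_group finite_comm_group_roots_unity_group order_pos) simp

lemma Sur_sylow_part_deviation:
  assumes p: "prime p" and order: "order G = p ^ k" and L: "L \<in> carrier_mat m m"
  shows "\<bar>real (card (Sur (sylow_part p (cokernel L)) G)) - real (card (coker_surs G L))\<bar> \<le>
    (if det L = 0 then real (card (coker_homs (dual_power G) L)) else 0) +
    (if det L = 0 then real (card (coker_homs G L)) else 0)"
proof (cases "det L = 0")
  case True
  have "card (Sur (sylow_part p (cokernel L)) G) \<le> card (coker_homs (roots_unity_group (order G)) L) ^ order G"
    by (rule card_Sur_sylow_part_cokernel_le[OF p finite_comm_group_axioms order])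
  also have "\<dots> \<le> card (coker_homs (dual_power G) L)"
    by (intro card_coker_homs_power_le finite_comm_group_roots_unity_group order_pos)
  finally have "real (card (Sur (sylow_part p (cokernel L)) G)) \<le> real (card (coker_homs (dual_power G) L))"
    by (rule of_nat_mono)
  moreover have "real (card (coker_surs G L)) \<le> real (card (coker_homs G L))"
    by (intro of_nat_mono card_mono finite_coker_homs) (auto simp: coker_surs_def)
  ultimately show ?thesis unfolding if_P[OF True] by linarith
next
  case False
  have "card (Sur (sylow_part p (cokernel L)) G) = card (Sur (cokernel L) G)"
    using False cokernel_exponent[OF L]
    by (intro card_Sur_sylow_part[OF p comm_group_cokernel is_group order, of "nat \<bar>det L\<bar>"]) simp_all
  then show ?thesis using False by (simp add: card_Sur_cokernel)
qed

lemma expected_Sur_sylow_part_deviation_tendsto: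
  assumes p: "prime p" and order: "order G = p ^ k" and q: "supercritical c q"
  shows "(\<lambda>n. measure_pmf.expectation (erdos_renyi n (q n))
      (\<lambda>E. real (card (Sur (sylow_part p (sandpile_group n E)) G))) - expected_surs G n (q n)) \<longlonglongrightarrow> 0"
proof (rule Lim_null_comparison[OF always_eventually], rule allI)
  interpret D: finite_comm_group "dual_power G" by (rule finite_comm_group_dual_power)
  let ?bound = "\<lambda>n. expected_singular (\<lambda>L. real (card (coker_homs (dual_power G) L))) n (q n)
      + expected_singular (\<lambda>L. real (card (coker_homs G L))) n (q n)"
  show "?bound \<longlonglongrightarrow> 0"
    using tendsto_add[OF D.expected_singular_homs_tendsto[OF q] expected_singular_homs_tendsto[OF q]] by simp
  fix n
  let ?E = "measure_pmf.expectation (erdos_renyi n (q n))" and ?L = "reduced_laplacian n"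
  let ?X = "\<lambda>E. real (card (Sur (sylow_part p (cokernel (?L E))) G))"
    and ?Y = "\<lambda>E. real (card (coker_surs G (?L E)))"
  have "\<bar>?E ?X - ?E ?Y\<bar> = \<bar>?E (\<lambda>E. ?X E - ?Y E)\<bar>"
    by (simp add: Bochner_Integration.integral_diff[OF integrable_erdos_renyi integrable_erdos_renyi])
  also have "\<dots> \<le> ?E (\<lambda>E. \<bar>?X E - ?Y E\<bar>)" by (rule integral_abs_bound)
  also have "\<dots> \<le> ?E (\<lambda>E.
      (if det (?L E) = 0 then real (card (coker_homs (dual_power G) (?L E))) else 0) +
      (if det (?L E) = 0 then real (card (coker_homs G (?L E))) else 0))"
    by (intro expectation_erdos_renyi_mono Sur_sylow_part_deviation[OF p order reduced_laplacian_carrier])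
  also have "\<dots> = ?bound n"
    by (rule Bochner_Integration.integral_add[OF integrable_erdos_renyi integrable_erdos_renyi])
  finally show "norm (?E (\<lambda>E. real (card (Sur (sylow_part p (sandpile_group n E)) G))) - ?E ?Y) \<le> ?bound n"
    by (simp add: sandpile_group_def)
qed

end

lemma supercriticalI:
  assumes c_gt_1: "c > 1" and \<alpha>: "\<And>n. \<alpha> n = c * ln (real n) / real n"
    and \<beta>: "\<And>n. n \<ge> 1 \<Longrightarrow> \<alpha> n \<le> 1 / 2 \<Longrightarrow> \<beta> n \<in> {\<alpha> n..1 - \<alpha> n}"
  shows "supercritical ((1 + c) / 2) \<beta>"
proof -
  have "(\<lambda>n. c * ln (real n) / real n) \<longlonglongrightarrow> 0" by real_asymp
  then have \<alpha>_tendsto: "\<alpha> \<longlonglongrightarrow> 0" by (simp add: \<alpha>[abs_def])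
  have "(c - 1) / (2 * c) > 0" using c_gt_1 by simp
  then have "\<forall>\<^sub>F n in sequentially. \<alpha> n < (c - 1) / (2 * c)" by (rule order_tendstoD(2)[OF \<alpha>_tendsto])
  moreover have "\<forall>\<^sub>F n in sequentially. \<alpha> n < 1 / 2" by (rule order_tendstoD(2)[OF \<alpha>_tendsto]) simp
  moreover note eventually_ge_at_top[of 1]
  ultimately have "\<forall>\<^sub>F n in sequentially. 0 \<le> \<beta> n \<and> \<beta> n \<le> 1 \<and> (1 + c) / 2 * ln n / n \<le> \<beta> n * (1 - \<beta> n)"
  proof eventually_elim
    case (elim n)
    have \<alpha>_nonneg: "\<alpha> n \<ge> 0" using elim c_gt_1 by (simp add: \<alpha>)
    have \<beta>_bounds: "\<alpha> n \<le> \<beta> n" "\<beta> n \<le> 1 - \<alpha> n" using \<beta>[of n] elim by auto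
    have "(1 + c) / 2 * ln n / n = \<alpha> n * (1 - (c - 1) / (2 * c))"
      using c_gt_1 elim by (simp add: \<alpha> field_simps)
    also have "\<dots> \<le> \<alpha> n * (1 - \<alpha> n)" using elim \<alpha>_nonneg by (intro mult_left_mono) auto
    also have "\<dots> \<le> \<alpha> n * (1 - \<alpha> n) + (\<beta> n - \<alpha> n) * (1 - \<alpha> n - \<beta> n)" using \<beta>_bounds by simp
    also have "\<dots> = \<beta> n * (1 - \<beta> n)" by (simp add: algebra_simps)
    finally show ?case using \<beta>_bounds \<alpha>_nonneg by simp
  qed
  then show ?thesis using c_gt_1 by (simp add: supercritical_def)
qed

theorem theorem1p10:
  fixes p :: nat and c :: real and \<alpha> \<beta> :: "nat \<Rightarrow> real"
    and G :: "('a, 'b) monoid_scheme"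
  assumes "prime p" and "c > 1"
    and "\<And>n. \<alpha> n = c * ln (real n) / real n"
    and "\<And>n. n \<ge> 1 \<Longrightarrow> \<alpha> n \<le> 1 / 2 \<Longrightarrow> \<beta> n \<in> {\<alpha> n..1 - \<alpha> n}"
    and "comm_group G" and "finite (carrier G)" and "\<exists>k. card (carrier G) = p ^ k"
  shows "(\<lambda>n. measure_pmf.expectation (erdos_renyi n (\<beta> n))
            (\<lambda>E. real (card (Sur (sylow_part p (sandpile_group n E)) G))))
          \<longlonglongrightarrow> real (card (carrier (exterior_square G)))"
proof -
  interpret finite_comm_group G
    using assms(5,6) by (simp add: finite_comm_groupI)
  obtain k where order: "order G = p ^ k" using assms(7) by (auto simp: order_def)
  have q: "supercritical ((1 + c) / 2) \<beta>" by (rule supercriticalI[OF assms(2-4)])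
  from expected_surs_tendsto[OF q] expected_Sur_sylow_part_deviation_tendsto[OF assms(1) order q]
  show ?thesis unfolding card_alt_bichars by (rule Lim_transform)
qed

end
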